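(* Let $\lambda>0$. The following are equivalent: (1) $\{P(t)\}_{t\ge 0}$ is a stochastic semigroup. (2) The operator $BR(\lambda,A)$ is mean ergodic. (3) $m\{x\in E: f_\lambda(x)>0\}=0$, where $f_\lambda(x)=\lim_{n\to\infty}(BR(\lambda,A))^{*n}1(x)$. (4) There is $u\in L^1_+$ with $u>0$ a.e. such that $\lim_{n\to\infty}\|(BR(\lambda,A))^n u\|=0$.
   Context: $(E,\mathcal E,m)$ is a $\sigma$-finite measure space, $L^1=L^1(E,\mathcal E,m)$ with norm $\|\cdot\|$, $L^\infty=L^\infty(E,\mathcal E,m)$, $L^1_+$ is the cone of nonnegative elements of $L^1$, and for a linear subspace $\mathcal D\subseteq L^1$, $\mathcal D_+=\mathcal D\cap L^1_+$. Densities are the elements $u\in L^1_+$ with $\|u\|=1$; a linear operator on $L^1$ is stochastic if it maps densities to densities. A substochastic (resp. stochastic) semigroup is a strongly continuous semigroup of positive contractions (resp. stochastic operators) on $L^1$. A linear operator $T$ on $L^1$ is mean ergodic if $\lim_{N\to\infty}\frac1N\sum_{n=0}^{N-1}T^nu$ exists in $L^1$ for all $u\in L^1$. $R(\lambda,A)=(\lambda-A)^{-1}$ is the resolvent. Standing assumptions: $(A,\mathcal D(A))$ and $(B,\mathcal D(B))$ are linear operators in $L^1$ such that: (G1) $(A,\mathcal D(A))$ generates a substochastic semigroup $\{S(t)\}_{t\ge0}$; (G2) $\mathcal D(B)\supseteq\mathcal D(A)$ and $Bu\ge0$ for $u\in\mathcal D(A)_+$; (G3) $\int_E(Au+Bu)\,dm=0$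 for every $u\in\mathcal D(A)_+$. Under these assumptions (Kato--Voigt perturbation theorem) there is a smallest substochastic semigroup $\{P(t)\}_{t\ge0}$ on $L^1$ whose generator is an extension of $(A+B,\mathcal D(A))$ (smallest: $P(t)u\le \widetilde P(t)u$ for all $t\ge 0$, $u\in L^1_+$ and every such semigroup $\widetilde P$). Its generator $C$ is characterized by $R(\lambda,C)u=\lim_{N\to\infty}R(\lambda,A)\sum_{n=0}^N(BR(\lambda,A))^nu$ for $u\in L^1$, $\lambda>0$. This is the semigroup $\{P(t)\}_{t\ge0}$ of the claim. For $\lambda>0$ the operator $BR(\lambda,A)$ is an everywhere defined positive contraction on $L^1$; $(BR(\lambda,A))^*$ is its adjoint on $L^\infty$, and the limit defining $f_\lambda$ exists a.e. because the sequence is non-increasing. *)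

theory Defs
  imports "HOL-Analysis.Analysis"
begin

text \<open>
  Elements of \<open>L\<^sup>1\<close> and \<open>L\<^sup>\<infinity>\<close> are represented by real functions, equality being equality almost
  everywhere.  Accordingly, domains of operators are closed under almost everywhere equality and
  operators respect it.
\<close>

definition L1 :: "'a measure \<Rightarrow> ('a \<Rightarrow> real) set" where
  "L1 M = {u. integrable M u}"

definition L1_plus :: "'a measure \<Rightarrow> ('a \<Rightarrow> real) set" where
  "L1_plus M = {u \<in> L1 M. AE x in M. 0 \<le> u x}"

definition Linf :: "'a measure \<Rightarrow> ('a \<Rightarrow> real) set" where
  "Linf M = {g \<in> borel_measurable M. \<exists>c. AE x in M. \<bar>g x\<bar> \<le> c}"

definition L1_norm :: "'a measure \<Rightarrow> ('a \<Rightarrow> real) \<Rightarrow> real" where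
  "L1_norm M u = (LINT x|M. \<bar>u x\<bar>)"

definition densities :: "'a measure \<Rightarrow> ('a \<Rightarrow> real) set" where
  "densities M = {u \<in> L1_plus M. L1_norm M u = 1}"

definition linear_operator ::
  "'a measure \<Rightarrow> ('a \<Rightarrow> real) set \<Rightarrow> (('a \<Rightarrow> real) \<Rightarrow> ('a \<Rightarrow> real)) \<Rightarrow> bool" where
  "linear_operator M D T \<longleftrightarrow>
     D \<subseteq> L1 M \<and>
     (\<forall>u\<in>D. \<forall>v\<in>L1 M. (AE x in M. u x = v x) \<longrightarrow> v \<in> D) \<and>
     (\<lambda>x. 0) \<in> D \<and>
     (\<forall>u\<in>D. \<forall>v\<in>D. (\<lambda>x. u x + v x) \<in> D) \<and>
     (\<forall>c. \<forall>u\<in>D. (\<lambda>x. c * u x) \<in> D) \<and>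
     (\<forall>u\<in>D. T u \<in> L1 M) \<and>
     (\<forall>u\<in>D. \<forall>v\<in>D. (AE x in M. u x = v x) \<longrightarrow> (AE x in M. T u x = T v x)) \<and>
     (\<forall>u\<in>D. \<forall>v\<in>D. AE x in M. T (\<lambda>y. u y + v y) x = T u x + T v x) \<and>
     (\<forall>c. \<forall>u\<in>D. AE x in M. T (\<lambda>y. c * u y) x = c * T u x)"

definition positive_contraction :: "'a measure \<Rightarrow> (('a \<Rightarrow> real) \<Rightarrow> ('a \<Rightarrow> real)) \<Rightarrow> bool" where
  "positive_contraction M T \<longleftrightarrow>
     linear_operator M (L1 M) T \<and>
     (\<forall>u\<in>L1_plus M. T u \<in> L1_plus M) \<and>
     (\<forall>u\<in>L1 M. L1_norm M (T u) \<le> L1_norm M u)"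

definition stochastic_operator :: "'a measure \<Rightarrow> (('a \<Rightarrow> real) \<Rightarrow> ('a \<Rightarrow> real)) \<Rightarrow> bool" where
  "stochastic_operator M T \<longleftrightarrow>
     linear_operator M (L1 M) T \<and> (\<forall>u\<in>densities M. T u \<in> densities M)"

text \<open>Only the restriction of a semigroup to times \<open>t \<ge> 0\<close> is meaningful.\<close>

definition C0_semigroup ::
  "'a measure \<Rightarrow> (real \<Rightarrow> ('a \<Rightarrow> real) \<Rightarrow> ('a \<Rightarrow> real)) \<Rightarrow> bool" where
  "C0_semigroup M S \<longleftrightarrow>
     (\<forall>t\<ge>0. linear_operator M (L1 M) (S t) \<and>
        (\<exists>c. \<forall>u\<in>L1 M. L1_norm M (S t u) \<le> c * L1_norm M u)) \<and>
     (\<forall>u\<in>L1 M. AE x in M. S 0 u x = u x) \<and>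
     (\<forall>s\<ge>0. \<forall>t\<ge>0. \<forall>u\<in>L1 M. AE x in M. S (s + t) u x = S s (S t u) x) \<and>
     (\<forall>u\<in>L1 M. ((\<lambda>t. L1_norm M (\<lambda>x. S t u x - u x)) \<longlongrightarrow> 0) (at_right 0))"

definition substochastic_semigroup ::
  "'a measure \<Rightarrow> (real \<Rightarrow> ('a \<Rightarrow> real) \<Rightarrow> ('a \<Rightarrow> real)) \<Rightarrow> bool" where
  "substochastic_semigroup M S \<longleftrightarrow>
     C0_semigroup M S \<and> (\<forall>t\<ge>0. positive_contraction M (S t))"

definition stochastic_semigroup ::
  "'a measure \<Rightarrow> (real \<Rightarrow> ('a \<Rightarrow> real) \<Rightarrow> ('a \<Rightarrow> real)) \<Rightarrow> bool" where
  "stochastic_semigroup M S \<longleftrightarrow>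
     C0_semigroup M S \<and> (\<forall>t\<ge>0. stochastic_operator M (S t))"

text \<open>The graph of the infinitesimal generator of \<open>S\<close>.\<close>

definition generator_graph ::
  "'a measure \<Rightarrow> (real \<Rightarrow> ('a \<Rightarrow> real) \<Rightarrow> ('a \<Rightarrow> real)) \<Rightarrow> ('a \<Rightarrow> real) \<Rightarrow> ('a \<Rightarrow> real) \<Rightarrow> bool" where
  "generator_graph M S u v \<longleftrightarrow>
     u \<in> L1 M \<and> v \<in> L1 M \<and>
     ((\<lambda>t. L1_norm M (\<lambda>x. (S t u x - u x) / t - v x)) \<longlongrightarrow> 0) (at_right 0)"

definition generates ::
  "'a measure \<Rightarrow> ('a \<Rightarrow> real) set \<Rightarrow> (('a \<Rightarrow> real) \<Rightarrow> ('a \<Rightarrow> real)) \<Rightarrow>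
   (real \<Rightarrow> ('a \<Rightarrow> real) \<Rightarrow> ('a \<Rightarrow> real)) \<Rightarrow> bool" where
  "generates M D A S \<longleftrightarrow>
     (\<forall>u v. generator_graph M S u v \<longleftrightarrow> u \<in> D \<and> v \<in> L1 M \<and> (AE x in M. v x = A u x))"

definition generator_extends ::
  "'a measure \<Rightarrow> (real \<Rightarrow> ('a \<Rightarrow> real) \<Rightarrow> ('a \<Rightarrow> real)) \<Rightarrow> ('a \<Rightarrow> real) set \<Rightarrow>
   (('a \<Rightarrow> real) \<Rightarrow> ('a \<Rightarrow> real)) \<Rightarrow> bool" where
  "generator_extends M S D T \<longleftrightarrow> (\<forall>u\<in>D. generator_graph M S u (T u))"

definition smallest_substochastic_semigroup ::
  "'a measure \<Rightarrow> ('a \<Rightarrow> real) set \<Rightarrow> (('a \<Rightarrow> real) \<Rightarrow> ('a \<Rightarrow> real)) \<Rightarrow>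
   (real \<Rightarrow> ('a \<Rightarrow> real) \<Rightarrow> ('a \<Rightarrow> real)) \<Rightarrow> bool" where
  "smallest_substochastic_semigroup M D T P \<longleftrightarrow>
     substochastic_semigroup M P \<and> generator_extends M P D T \<and>
     (\<forall>Q. substochastic_semigroup M Q \<and> generator_extends M Q D T \<longrightarrow>
        (\<forall>t\<ge>0. \<forall>u\<in>L1_plus M. AE x in M. P t u x \<le> Q t u x))"

text \<open>
  The operator \<open>(\<lambda> - A)\<^sup>-\<^sup>1\<close>; the chosen function is determined up to almost everywhere equality if
  \<open>\<lambda>\<close> belongs to the resolvent set of \<open>A\<close>, in particular if \<open>\<lambda> > 0\<close> and \<open>A\<close> generates a
  contraction semigroup.
\<close>

definition resolvent ::
  "'a measure \<Rightarrow> ('a \<Rightarrow> real) set \<Rightarrow> (('a \<Rightarrow> real) \<Rightarrow> ('a \<Rightarrow> real)) \<Rightarrow> real \<Rightarrow>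
   ('a \<Rightarrow> real) \<Rightarrow> ('a \<Rightarrow> real)" where
  "resolvent M D A l v = (SOME u. u \<in> D \<and> (AE x in M. l * u x - A u x = v x))"

text \<open>
  The adjoint on \<open>L\<^sup>\<infinity>\<close> of a bounded operator on \<open>L\<^sup>1\<close>; for \<open>\<sigma>\<close>-finite \<open>M\<close> the chosen function exists
  and is determined up to almost everywhere equality.
\<close>

definition L1_adjoint ::
  "'a measure \<Rightarrow> (('a \<Rightarrow> real) \<Rightarrow> ('a \<Rightarrow> real)) \<Rightarrow> ('a \<Rightarrow> real) \<Rightarrow> ('a \<Rightarrow> real)" where
  "L1_adjoint M T g =
     (SOME h. h \<in> Linf M \<and> (\<forall>u\<in>L1 M. (LINT x|M. u x * h x) = (LINT x|M. T u x * g x)))"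

definition mean_ergodic :: "'a measure \<Rightarrow> (('a \<Rightarrow> real) \<Rightarrow> ('a \<Rightarrow> real)) \<Rightarrow> bool" where
  "mean_ergodic M T \<longleftrightarrow>
     (\<forall>u\<in>L1 M. \<exists>v\<in>L1 M.
        (\<lambda>N. L1_norm M (\<lambda>x. (1 / real N) * (\<Sum>n<N. (T ^^ n) u x) - v x)) \<longlonglongrightarrow> 0)"

definition BR ::
  "'a measure \<Rightarrow> ('a \<Rightarrow> real) set \<Rightarrow> (('a \<Rightarrow> real) \<Rightarrow> ('a \<Rightarrow> real)) \<Rightarrow>
   (('a \<Rightarrow> real) \<Rightarrow> ('a \<Rightarrow> real)) \<Rightarrow> real \<Rightarrow> ('a \<Rightarrow> real) \<Rightarrow> ('a \<Rightarrow> real)" where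
  "BR M D A B l v = B (resolvent M D A l v)"

text \<open>The limit exists for almost every \<open>x\<close>; on the exceptional null set the value is irrelevant.\<close>

definition f_lim ::
  "'a measure \<Rightarrow> ('a \<Rightarrow> real) set \<Rightarrow> (('a \<Rightarrow> real) \<Rightarrow> ('a \<Rightarrow> real)) \<Rightarrow>
   (('a \<Rightarrow> real) \<Rightarrow> ('a \<Rightarrow> real)) \<Rightarrow> real \<Rightarrow> 'a \<Rightarrow> real" where
  "f_lim M D A B l x = lim (\<lambda>n. (L1_adjoint M (BR M D A B l) ^^ n) (\<lambda>y. 1) x)"

end

theory Submission
  imports Defs "HOL-Probability.Discrete_Topology"
begin

text \<open>
  Put \<open>R = R(l, A)\<close> and \<open>K = B R\<close>.  Condition (G3), applied to \<open>R u\<close> with \<open>u \<ge> 0\<close>, is the mass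
  balance \<open>\<parallel>K u\<parallel> = \<parallel>u\<parallel> - l \<parallel>R u\<parallel>\<close>; summed along the iterates of \<open>K\<close> it says that
  \<open>l \<parallel>\<Sum>n<N. R (K\<^sup>n u)\<parallel> = \<parallel>u\<parallel> - \<parallel>K\<^sup>N u\<parallel>\<close>.  Each of the four conditions is shown to be equivalent to
  \<open>K\<^sup>n u \<rightarrow> 0\<close> for all \<open>u\<close>, that is, to the statement that the series \<open>\<Sum>n. R (K\<^sup>n u)\<close>
  accounts for the whole mass of \<open>u\<close>.

  Mean ergodicity: for \<open>u \<ge> 0\<close> the limit \<open>v\<close> of the averages is a nonnegative fixed point of \<open>K\<close>.
  The mass balance gives \<open>R v = 0\<close>, hence \<open>v = 0\<close>; as \<open>\<parallel>K\<^sup>n u\<parallel>\<close> decreases, it tends to \<open>0\<close>.  The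
  converse is Cesaro's theorem (\<open>mean_ergodic_iff_K_power_tendsto_0\<close>).

  The conditions on \<open>f\<close> and on a strictly positive \<open>u\<close>: for \<open>u \<ge> 0\<close> duality gives
  \<open>lim \<parallel>K\<^sup>n u\<parallel> = \<integral>u f\<close>, where \<open>f\<close> is the limit of the iterates of the adjoint on the constant \<open>1\<close>
  (\<open>L1_adjoint_limit_null_iff\<close>).

  Stochasticity of \<open>P\<close>: let \<open>C\<close> be its generator.  The partial sums \<open>x\<^sub>N = \<Sum>n<N. R (K\<^sup>n v)\<close> lie in the
  domain of \<open>A\<close> and satisfy \<open>(l - C) x\<^sub>N = v - K\<^sup>N v\<close>.  If \<open>K\<^sup>N v \<rightarrow> 0\<close>, they converge to \<open>R(l, C) v\<close> and
  the mass balance passes to the limit, so that the range of \<open>C\<close> has total mass \<open>0\<close> and \<open>P\<close> preserves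
  mass.  Conversely, the operators \<open>\<Sum>n. R(m, A) (B R(m, A))\<^sup>n\<close> for \<open>m \<ge> l\<close> satisfy the resolvent
  identity, and a Hille-Yosida argument yields a substochastic semigroup \<open>Q\<close> that has them as
  resolvents and whose generator extends \<open>A + B\<close> (\<open>kato_semigroup_exists\<close>).  Minimality gives
  \<open>P \<le> Q\<close>.  If \<open>P\<close> preserves mass then, \<open>Q\<close> being contractive, \<open>P = Q\<close>; now the resolvent of \<open>Q\<close>
  preserves mass as well, and the summed balance forces \<open>\<parallel>K\<^sup>n u\<parallel> \<rightarrow> 0\<close>
  (\<open>conservative_iff_K_power_tendsto_0\<close>).

  The semigroup part is carried out in an abstract AL-space, a closed subspace of a Banach space, in
  which equality is genuine equality and estimates are norm estimates; \<open>L\<^sup>1\<close> is such a space via an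
  isometric embedding.  No integrals of vector-valued functions occur: resolvents arise as limits of
  resolvents of discrete semigroups, semigroups as limits of the implicit Euler scheme.
\<close>

section \<open>AL-spaces\<close>

text \<open>
  The functional \<open>mass\<close> plays the role of the integral.  It encodes the order as well: an element is
  nonnegative exactly when its mass equals its norm, so the cone is closed and the norm is additive
  on it.  The carrier is a subspace rather than a type because \<open>L\<^sup>1\<close> depends on a measure.
\<close>

locale al_space =
  fixes V :: "'w::banach set" and mass :: "'w \<Rightarrow> real"
  assumes subspace_V: "subspace V"
    and closed_V: "closed V"
    and linear_mass: "linear mass"
    and abs_mass_le: "\<bar>mass x\<bar> \<le> norm x"
    and decomposition:
      "x \<in> V \<Longrightarrow> \<exists>p q. p \<in> V \<and> mass p = norm p \<and> q \<in> V \<and> mass q = norm q \<and>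
         x = p - q \<and> norm p + norm q = norm x"
begin

definition cone :: "'w set" where
  "cone = {x \<in> V. mass x = norm x}"

definition pos_contraction :: "('w \<Rightarrow> 'w) \<Rightarrow> bool" where
  "pos_contraction T \<longleftrightarrow>
     (\<forall>x\<in>V. T x \<in> V \<and> norm (T x) \<le> norm x) \<and>
     (\<forall>x\<in>V. \<forall>y\<in>V. T (x + y) = T x + T y) \<and>
     (\<forall>c. \<forall>x\<in>V. T (c *\<^sub>R x) = c *\<^sub>R T x) \<and>
     (\<forall>x\<in>cone. T x \<in> cone)"

lemma V_0 [simp, intro]: "0 \<in> V"
  using subspace_V subspace_0 by blast

lemma V_add [simp, intro]: "x \<in> V \<Longrightarrow> y \<in> V \<Longrightarrow> x + y \<in> V"
  using subspace_V subspace_add by blast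

lemma V_diff [simp, intro]: "x \<in> V \<Longrightarrow> y \<in> V \<Longrightarrow> x - y \<in> V"
  using subspace_V subspace_diff by blast

lemma V_scale [simp, intro]: "x \<in> V \<Longrightarrow> c *\<^sub>R x \<in> V"
  using subspace_V subspace_scale by blast

lemma V_uminus [simp, intro]: "x \<in> V \<Longrightarrow> - x \<in> V"
  using V_scale[of x "-1"] by simp

lemma V_sum [intro]: "(\<And>i. i \<in> I \<Longrightarrow> f i \<in> V) \<Longrightarrow> sum f I \<in> V"
  using subspace_V subspace_sum by blast

lemma mass_add: "mass (x + y) = mass x + mass y"
  and mass_diff: "mass (x - y) = mass x - mass y"
  and mass_scale: "mass (c *\<^sub>R x) = c * mass x"
  and mass_0 [simp]: "mass 0 = 0"
  and mass_sum: "mass (sum f I) = (\<Sum>i\<in>I. mass (f i))"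
  using linear_add[OF linear_mass] linear_diff[OF linear_mass] linear_cmul[OF linear_mass]
    linear_0[OF linear_mass] linear_sum[OF linear_mass] by auto

lemma bounded_linear_mass: "bounded_linear mass"
  using abs_mass_le by (intro bounded_linear_intro[where K = 1]) (auto simp: mass_add mass_scale)

lemmas tendsto_mass = bounded_linear.tendsto[OF bounded_linear_mass]

lemma cone_V: "x \<in> cone \<Longrightarrow> x \<in> V"
  and cone_norm: "x \<in> cone \<Longrightarrow> norm x = mass x"
  and cone_nonneg: "x \<in> cone \<Longrightarrow> 0 \<le> mass x"
  by (auto simp: cone_def)

lemma cone_0 [simp]: "0 \<in> cone"
  by (simp add: cone_def)

lemma cone_add: "x \<in> cone \<Longrightarrow> y \<in> cone \<Longrightarrow> x + y \<in> cone"
  using abs_mass_le[of "x + y"] norm_triangle_ineq[of x y] by (auto simp: cone_def mass_add)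

lemma cone_scale: "x \<in> cone \<Longrightarrow> 0 \<le> c \<Longrightarrow> c *\<^sub>R x \<in> cone"
  by (auto simp: cone_def mass_scale)

lemma cone_sum: "(\<And>i. i \<in> I \<Longrightarrow> f i \<in> cone) \<Longrightarrow> sum f I \<in> cone"
  by (induction I rule: infinite_finite_induct) (auto intro: cone_add)

lemma closed_cone: "closed cone"
proof -
  have "continuous_on UNIV mass"
    by (simp add: bounded_linear_mass linear_continuous_on)
  then have "closed {x. mass x = norm x}"
    by (intro closed_Collect_eq continuous_intros) auto
  moreover have "cone = V \<inter> {x. mass x = norm x}"
    by (auto simp: cone_def)
  ultimately show ?thesis
    using closed_V by auto
qed

lemma V_limit: "(f \<longlongrightarrow> x) F \<Longrightarrow> F \<noteq> bot \<Longrightarrow> (\<And>i. f i \<in> V) \<Longrightarrow> x \<in> V"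
  using Lim_in_closed_set[OF closed_V, of f F x] by (simp add: always_eventually)

lemma cone_limit: "(f \<longlongrightarrow> x) F \<Longrightarrow> F \<noteq> bot \<Longrightarrow> (\<And>i. f i \<in> cone) \<Longrightarrow> x \<in> cone"
  using Lim_in_closed_set[OF closed_cone, of f F x] by (simp add: always_eventually)

lemma cone_decomposition:
  assumes "x \<in> V"
  obtains p q where "p \<in> cone" "q \<in> cone" "x = p - q" "norm p + norm q = norm x"
  using decomposition[OF assms] that unfolding cone_def by blast

lemma pc_V: "pos_contraction T \<Longrightarrow> x \<in> V \<Longrightarrow> T x \<in> V"
  and pc_norm: "pos_contraction T \<Longrightarrow> x \<in> V \<Longrightarrow> norm (T x) \<le> norm x"
  and pc_add: "pos_contraction T \<Longrightarrow> x \<in> V \<Longrightarrow> y \<in> V \<Longrightarrow> T (x + y) = T x + T y"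
  and pc_scale: "pos_contraction T \<Longrightarrow> x \<in> V \<Longrightarrow> T (c *\<^sub>R x) = c *\<^sub>R T x"
  and pc_cone: "pos_contraction T \<Longrightarrow> x \<in> cone \<Longrightarrow> T x \<in> cone"
  by (auto simp: pos_contraction_def)

lemma pc_0: "pos_contraction T \<Longrightarrow> T 0 = 0"
  using pc_scale[of T 0 0] by simp

lemma pc_diff: "pos_contraction T \<Longrightarrow> x \<in> V \<Longrightarrow> y \<in> V \<Longrightarrow> T (x - y) = T x - T y"
  using pc_add[of T x "(-1) *\<^sub>R y"] pc_scale[of T y "-1"] V_scale[of y "-1"] by simp

lemma pc_sum:
  "pos_contraction T \<Longrightarrow> (\<And>i. i \<in> I \<Longrightarrow> f i \<in> V) \<Longrightarrow> T (sum f I) = (\<Sum>i\<in>I. T (f i))"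
  by (induction I rule: infinite_finite_induct) (auto simp: pc_0 pc_add V_sum)

lemma pc_norm_diff:
  "pos_contraction T \<Longrightarrow> x \<in> V \<Longrightarrow> y \<in> V \<Longrightarrow> norm (T x - T y) \<le> norm (x - y)"
  using pc_norm[of T "x - y"] by (simp add: pc_diff)

lemma pc_tendsto:
  assumes T: "pos_contraction T" and f: "(f \<longlongrightarrow> x) F" and V: "\<And>i. f i \<in> V" "x \<in> V"
  shows "((\<lambda>i. T (f i)) \<longlongrightarrow> T x) F"
proof (rule LIM_zero_cancel, rule tendsto_0_le[where K = 1])
  show "((\<lambda>i. f i - x) \<longlongrightarrow> 0) F"
    using f by (rule LIM_zero)
  show "\<forall>\<^sub>F i in F. norm (T (f i) - T x) \<le> norm (f i - x) * 1"
    using pc_norm_diff[OF T] V by (intro always_eventually) auto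
qed

lemma pc_power: "pos_contraction T \<Longrightarrow> pos_contraction (T ^^ n)"
proof (induction n)
  case (Suc n)
  note T = Suc.prems and Tn = Suc.IH[OF Suc.prems]
  show ?case
    unfolding pos_contraction_def
    using pc_V[OF T] pc_V[OF Tn] pc_add[OF T] pc_add[OF Tn] pc_scale[OF T] pc_scale[OF Tn]
      pc_cone[OF T] pc_cone[OF Tn]
    by (auto intro: order_trans[OF pc_norm[OF T] pc_norm[OF Tn]])
qed (simp add: pos_contraction_def)

text \<open>
  On the cone the norm is the mass, so contractivity only has to be checked for masses of nonnegative
  elements; the decomposition into positive and negative part, which is additive in norm, does the rest.
\<close>

lemma pos_contractionI:
  assumes add: "\<And>x y. x \<in> V \<Longrightarrow> y \<in> V \<Longrightarrow> T (x + y) = T x + T y"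
    and scale: "\<And>c x. x \<in> V \<Longrightarrow> T (c *\<^sub>R x) = c *\<^sub>R T x"
    and cone: "\<And>x. x \<in> cone \<Longrightarrow> T x \<in> cone"
    and le: "\<And>x. x \<in> cone \<Longrightarrow> mass (T x) \<le> mass x"
  shows "pos_contraction T"
proof -
  have "T x \<in> V \<and> norm (T x) \<le> norm x" if xV: "x \<in> V" for x
  proof -
    obtain p q where pq: "p \<in> cone" "q \<in> cone" "x = p - q" "norm p + norm q = norm x"
      by (rule cone_decomposition[OF xV])
    have "T (p + (-1) *\<^sub>R q) = T p + T ((-1) *\<^sub>R q)"
      by (rule add) (use pq in \<open>auto simp: cone_V simp del: scaleR_minus_left\<close>)
    also have "T ((-1) *\<^sub>R q) = (-1) *\<^sub>R T q"
      by (rule scale) (use pq cone_V in auto)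
    finally have Tx: "T x = T p - T q"
      using pq by simp
    then have "norm (T x) \<le> norm (T p) + norm (T q)"
      using norm_triangle_ineq4 by simp
    also have "\<dots> \<le> norm p + norm q"
      using le[of p] le[of q] pq cone by (simp add: cone_norm)
    finally show ?thesis
      using Tx pq cone by (auto simp: cone_V)
  qed
  then show ?thesis
    using assms unfolding pos_contraction_def by blast
qed

lemma pc_eq_on_V:
  assumes "pos_contraction T" "pos_contraction U" "\<And>x. x \<in> cone \<Longrightarrow> T x = U x" "x \<in> V"
  shows "T x = U x"
proof -
  obtain p q where "p \<in> cone" "q \<in> cone" "x = p - q"
    using cone_decomposition[OF assms(4)] by blast
  then show ?thesis
    using assms(1-3) by (simp add: pc_diff cone_V)
qed

section \<open>Contraction semigroups and their generators\<close>

definition pc_semigroup :: "(real \<Rightarrow> 'w \<Rightarrow> 'w) \<Rightarrow> bool" where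
  "pc_semigroup S \<longleftrightarrow>
     (\<forall>t\<ge>0. pos_contraction (S t)) \<and>
     (\<forall>x\<in>V. S 0 x = x) \<and>
     (\<forall>s\<ge>0. \<forall>t\<ge>0. \<forall>x\<in>V. S (s + t) x = S s (S t x)) \<and>
     (\<forall>x\<in>V. ((\<lambda>t. S t x) \<longlongrightarrow> x) (at_right 0))"

definition gen :: "(real \<Rightarrow> 'w \<Rightarrow> 'w) \<Rightarrow> 'w \<Rightarrow> 'w \<Rightarrow> bool" where
  "gen S x y \<longleftrightarrow>
     x \<in> V \<and> y \<in> V \<and> ((\<lambda>t. (S t x - x) /\<^sub>R t) \<longlongrightarrow> y) (at_right 0)"

lemma sg_pc: "pc_semigroup S \<Longrightarrow> 0 \<le> t \<Longrightarrow> pos_contraction (S t)"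
  and sg_0: "pc_semigroup S \<Longrightarrow> x \<in> V \<Longrightarrow> S 0 x = x"
  and sg_add: "pc_semigroup S \<Longrightarrow> 0 \<le> s \<Longrightarrow> 0 \<le> t \<Longrightarrow> x \<in> V \<Longrightarrow> S (s + t) x = S s (S t x)"
  and sg_tendsto: "pc_semigroup S \<Longrightarrow> x \<in> V \<Longrightarrow> ((\<lambda>t. S t x) \<longlongrightarrow> x) (at_right 0)"
  by (auto simp: pc_semigroup_def)

lemma sg_modulus:
  assumes S: "pc_semigroup S" and x: "x \<in> V" and e: "0 < e"
  obtains d where "0 < d" "\<And>t. 0 \<le> t \<Longrightarrow> t < d \<Longrightarrow> norm (S t x - x) < e"
proof -
  obtain d where d: "0 < d" "\<And>t. 0 < t \<Longrightarrow> t < d \<Longrightarrow> norm (S t x - x) < e"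
    using tendstoD[OF sg_tendsto[OF S x] e]
    by (auto simp: eventually_at_right[of 0 1, simplified] dist_norm)
  have "norm (S t x - x) < e" if "0 \<le> t" "t < d" for t
    using d(2)[of t] sg_0[OF S x] that e by (cases "t = 0") auto
  with d(1) show thesis
    by (rule that)
qed

text \<open>
  Strong continuity at \<open>0\<close> is thereby transported to every time, uniformly.
\<close>

lemma sg_diff_le:
  assumes S: "pc_semigroup S" and x: "x \<in> V" and st: "0 \<le> s" "s \<le> t"
  shows "norm (S t x - S s x) \<le> norm (S (t - s) x - x)"
proof -
  have "S t x = S s (S (t - s) x)"
    using sg_add[OF S st(1) _ x, of "t - s"] st by simp
  then show ?thesis
    using pc_norm_diff[OF sg_pc[OF S st(1)], of "S (t - s) x" x] x st
      pc_V[OF sg_pc[OF S], of "t - s" x] by simp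
qed

lemma gen_V: "gen S x y \<Longrightarrow> x \<in> V" "gen S x y \<Longrightarrow> y \<in> V"
  by (auto simp: gen_def)

lemma gen_tendsto: "gen S x y \<Longrightarrow> ((\<lambda>t. (S t x - x) /\<^sub>R t) \<longlongrightarrow> y) (at_right 0)"
  by (simp add: gen_def)

lemma gen_unique: "gen S x y \<Longrightarrow> gen S x z \<Longrightarrow> y = z"
  unfolding gen_def using tendsto_unique[OF trivial_limit_at_right_real] by blast

lemma gen_transform:
  assumes "((\<lambda>t. f t) \<longlongrightarrow> y) (at_right 0)" "x \<in> V" "y \<in> V"
    and "\<And>t. 0 < t \<Longrightarrow> f t = (S t x - x) /\<^sub>R t"
  shows "gen S x y"
proof -
  have "((\<lambda>t. (S t x - x) /\<^sub>R t) \<longlongrightarrow> y) (at_right 0)"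
    using assms(1)
    by (rule Lim_transform_eventually) (auto simp: eventually_at_filter assms(4))
  then show ?thesis
    using assms by (simp add: gen_def)
qed

lemma gen_add:
  assumes S: "pc_semigroup S" and 1: "gen S x y" and 2: "gen S x' y'"
  shows "gen S (x + x') (y + y')"
proof (rule gen_transform)
  show "((\<lambda>t. (S t x - x) /\<^sub>R t + (S t x' - x') /\<^sub>R t) \<longlongrightarrow> y + y') (at_right 0)"
    by (intro tendsto_add gen_tendsto 1 2)
  fix t :: real assume "0 < t"
  then show "(S t x - x) /\<^sub>R t + (S t x' - x') /\<^sub>R t = (S t (x + x') - (x + x')) /\<^sub>R t"
    using gen_V[OF 1] gen_V[OF 2] by (simp add: pc_add[OF sg_pc[OF S]] algebra_simps)
qed (use gen_V[OF 1] gen_V[OF 2] in auto)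

lemma gen_scale:
  assumes S: "pc_semigroup S" and 1: "gen S x y"
  shows "gen S (c *\<^sub>R x) (c *\<^sub>R y)"
proof (rule gen_transform)
  show "((\<lambda>t. c *\<^sub>R ((S t x - x) /\<^sub>R t)) \<longlongrightarrow> c *\<^sub>R y) (at_right 0)"
    by (intro tendsto_scaleR tendsto_const gen_tendsto 1)
  fix t :: real assume "0 < t"
  then show "c *\<^sub>R ((S t x - x) /\<^sub>R t) = (S t (c *\<^sub>R x) - c *\<^sub>R x) /\<^sub>R t"
    using gen_V[OF 1] by (simp add: pc_scale[OF sg_pc[OF S]] algebra_simps)
qed (use gen_V[OF 1] in auto)

lemma gen_diff:
  assumes S: "pc_semigroup S" and 1: "gen S x y" and 2: "gen S x' y'"
  shows "gen S (x - x') (y - y')"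
  using gen_add[OF S 1 gen_scale[OF S 2, of "-1"]] by simp

lemma gen_0: "pc_semigroup S \<Longrightarrow> gen S 0 0"
  by (rule gen_transform[of "\<lambda>_. 0"]) (auto simp: pc_0[OF sg_pc])

lemma gen_sum:
  assumes "pc_semigroup S" "\<And>i. i \<in> I \<Longrightarrow> gen S (f i) (g i)"
  shows "gen S (sum f I) (sum g I)"
  using assms(2) by (induction I rule: infinite_finite_induct) (auto intro: gen_add gen_0 assms(1))

lemma gen_invariant:
  assumes S: "pc_semigroup S" and 1: "gen S x y" and s: "0 \<le> s"
  shows "gen S (S s x) (S s y)"
proof (rule gen_transform)
  note T = sg_pc[OF S s] and V = gen_V[OF 1]
  let ?f = "\<lambda>t. if 0 < t then (S t x - x) /\<^sub>R t else y"
  have "((\<lambda>t. S s (?f t)) \<longlongrightarrow> S s y) (at_right 0)"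
  proof (rule pc_tendsto[OF T])
    show "(?f \<longlongrightarrow> y) (at_right 0)"
      using gen_tendsto[OF 1]
      by (rule Lim_transform_eventually) (auto simp: eventually_at_filter)
    show "?f t \<in> V" for t
      using V pc_V[OF sg_pc[OF S], of t x] by auto
  qed (use V in auto)
  then show "((\<lambda>t. S s (?f t)) \<longlongrightarrow> S s y) (at_right 0)" .
  fix t :: real assume t: "0 < t"
  have "S t (S s x) = S s (S t x)"
    using sg_add[OF S s, of t x] sg_add[OF S _ s, of t x] t V by (simp add: add.commute)
  then show "S s (?f t) = (S t (S s x) - S s x) /\<^sub>R t"
    using t V pc_V[OF sg_pc[OF S], of t x] by (simp add: pc_diff[OF T] pc_scale[OF T])
qed (use gen_V[OF 1] pc_V[OF sg_pc[OF S s]] in auto)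

text \<open>
  The difference quotients have this property: in \<open>l x - (S t x - x) / t\<close> the vector \<open>x\<close> occurs with
  coefficient \<open>l + 1 / t\<close> and the contraction \<open>S t\<close> takes back at most \<open>\<parallel>x\<parallel> / t\<close>.
\<close>

lemma gen_dissipative:
  assumes S: "pc_semigroup S" and 1: "gen S x y" and l: "0 < l"
  shows "l * norm x \<le> norm (l *\<^sub>R x - y)"
proof (rule tendsto_lowerbound)
  show "((\<lambda>t. norm (l *\<^sub>R x - (S t x - x) /\<^sub>R t)) \<longlongrightarrow> norm (l *\<^sub>R x - y)) (at_right 0)"
    by (intro tendsto_intros gen_tendsto 1)
  have "l * norm x \<le> norm (l *\<^sub>R x - (S t x - x) /\<^sub>R t)" if t: "0 < t" for t
  proof -
    have "l *\<^sub>R x - (S t x - x) /\<^sub>R t = (l + inverse t) *\<^sub>R x - inverse t *\<^sub>R S t x"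
      by (simp add: algebra_simps)
    moreover have "norm ((l + inverse t) *\<^sub>R x) = l * norm x + inverse t * norm x"
      using l t by (simp only: norm_scaleR) (simp add: algebra_simps)
    moreover have "norm (inverse t *\<^sub>R S t x) \<le> inverse t * norm x"
      using pc_norm[OF sg_pc[OF S], of t x] t gen_V[OF 1] by (simp add: mult_left_mono)
    ultimately show ?thesis
      using norm_triangle_ineq2[of "(l + inverse t) *\<^sub>R x" "inverse t *\<^sub>R S t x"] by simp
  qed
  then show "\<forall>\<^sub>F t in at_right 0. l * norm x \<le> norm (l *\<^sub>R x - (S t x - x) /\<^sub>R t)"
    by (auto simp: eventually_at_filter)
qed simp

section \<open>Conservative semigroups\<close>

text \<open>
  For \<open>x\<close> in the domain, the interval from \<open>0\<close> to \<open>t\<close> is cut into \<open>n\<close> pieces of length \<open>h = t / n\<close>.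
  On each of them the mass changes by \<open>h \<cdot> mass (S s y)\<close>, which vanishes because \<open>S s y\<close> is again a
  value of the generator, up to an error \<open>o(h)\<close>.  The total error \<open>n \<cdot> o(t / n)\<close> tends to \<open>0\<close>.
\<close>

lemma conservative_if_gen:
  assumes S: "pc_semigroup S" and dense: "V \<subseteq> closure {x. \<exists>y. gen S x y}"
    and gen0: "\<And>x y. gen S x y \<Longrightarrow> mass y = 0"
    and t: "0 \<le> t" and x: "x \<in> V"
  shows "mass (S t x) = mass x"
proof -
  have dom: "mass (S t x) = mass x" if g: "gen S x y" for x y
  proof (cases "t = 0")
    case True
    then show ?thesis
      using sg_0[OF S] gen_V[OF g] by simp
  next
    case False
    with t have t: "0 < t" by simp
    note V = gen_V[OF g]
    let ?h = "\<lambda>n. t / real (Suc n)"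
    define r where "r h = norm ((S h x - x) /\<^sub>R h - y)" for h
    have step: "\<bar>mass (S (real n * h + h) x) - mass (S (real n * h) x)\<bar> \<le> h * r h" if h: "0 < h" for n h
    proof -
      have T: "pos_contraction (S (real n * h))"
        using sg_pc[OF S] h by simp
      have Sh: "S h x \<in> V"
        using pc_V[OF sg_pc[OF S]] h V by simp
      have "S (real n * h + h) x - S (real n * h) x - h *\<^sub>R S (real n * h) y
          = S (real n * h) (S h x - x - h *\<^sub>R y)"
        using V Sh h by (simp add: sg_add[OF S] pc_diff[OF T] pc_scale[OF T])
      moreover have "mass (S (real n * h) y) = 0"
        using gen0 gen_invariant[OF S g, of "real n * h"] h by simp
      ultimately have "mass (S (real n * h + h) x) - mass (S (real n * h) x)
          = mass (S (real n * h) (S h x - x - h *\<^sub>R y))"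
        by (metis mass_diff mass_scale diff_zero mult_zero_right)
      also have "\<bar>\<dots>\<bar> \<le> norm (S h x - x - h *\<^sub>R y)"
        using abs_mass_le pc_norm[OF T] V Sh by (meson V_diff V_scale order_trans)
      also have "S h x - x - h *\<^sub>R y = h *\<^sub>R ((S h x - x) /\<^sub>R h - y)"
        using h by (simp add: algebra_simps)
      finally show ?thesis
        using h by (simp add: r_def)
    qed
    have "\<bar>mass (S (real n * h) x) - mass x\<bar> \<le> real n * (h * r h)" if h: "0 < h" for n h
    proof (induction n)
      case 0
      then show ?case using sg_0[OF S] V by simp
    next
      case (Suc n)
      have "real (Suc n) * h = real n * h + h" by (simp add: algebra_simps)
      then show ?case
        using Suc step[OF h, of n] by (simp add: algebra_simps)
    qed
    from this[of "?h n" "Suc n" for n]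
    have bound: "\<bar>mass (S t x) - mass x\<bar> \<le> t * r (?h n)" for n
      using t by (simp del: of_nat_Suc)
    have "filterlim ?h (at_right 0) sequentially"
      unfolding filterlim_at using t by (auto intro!: LIMSEQ_Suc[OF lim_const_over_n] simp del: of_nat_Suc)
    moreover have "(r \<longlongrightarrow> 0) (at_right 0)"
      unfolding r_def using gen_tendsto[OF g] by (simp add: LIM_zero tendsto_norm_zero)
    ultimately have "(\<lambda>n. r (?h n)) \<longlonglongrightarrow> 0"
      by (rule filterlim_compose[rotated])
    then have "(\<lambda>n. t * r (?h n)) \<longlonglongrightarrow> t * 0"
      by (intro tendsto_intros)
    then have "\<bar>mass (S t x) - mass x\<bar> \<le> t * 0"
      by (rule LIMSEQ_le_const) (use bound in auto)
    then show ?thesis by simp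
  qed
  obtain f where f: "\<And>n. f n \<in> {x. \<exists>y. gen S x y}" "f \<longlonglongrightarrow> x"
    using x dense by (meson closure_sequential subsetD)
  then have fV: "\<And>n. f n \<in> V" and eq: "\<And>n. mass (S t (f n)) = mass (f n)"
    using dom by (auto simp: gen_def)
  have "(\<lambda>n. mass (S t (f n))) \<longlonglongrightarrow> mass (S t x)"
    by (rule tendsto_mass[OF pc_tendsto[OF sg_pc[OF S t] f(2) fV x]])
  moreover have "(\<lambda>n. mass (S t (f n))) \<longlonglongrightarrow> mass x"
    unfolding eq by (rule tendsto_mass[OF f(2)])
  ultimately show ?thesis
    by (rule LIMSEQ_unique)
qed

lemma gen_if_conservative:
  assumes "\<And>t x. 0 \<le> t \<Longrightarrow> x \<in> V \<Longrightarrow> mass (S t x) = mass x" and g: "gen S x y"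
  shows "mass y = 0"
proof -
  have "((\<lambda>t. mass ((S t x - x) /\<^sub>R t)) \<longlongrightarrow> mass y) (at_right 0)"
    by (intro tendsto_mass gen_tendsto g)
  moreover have "((\<lambda>t. mass ((S t x - x) /\<^sub>R t)) \<longlongrightarrow> 0) (at_right 0)"
    by (rule Lim_transform_eventually[OF tendsto_const])
      (use gen_V[OF g] in \<open>auto simp: eventually_at_filter mass_diff mass_scale assms(1)\<close>)
  ultimately show ?thesis
    using tendsto_unique[OF trivial_limit_at_right_real] by blast
qed

end

section \<open>Resolvents of contraction semigroups\<close>

lemma grid_floor_bounds:
  fixes t h :: real
  assumes "0 \<le> t" "0 < h"
  shows "real (nat \<lfloor>t / h\<rfloor>) * h \<le> t" "t - h < real (nat \<lfloor>t / h\<rfloor>) * h"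
proof -
  have "real_of_int \<lfloor>t / h\<rfloor> * h \<le> t / h * h" "(t / h - 1) * h < real_of_int \<lfloor>t / h\<rfloor> * h"
    using assms by (intro mult_right_mono mult_strict_right_mono; linarith)+
  then show "real (nat \<lfloor>t / h\<rfloor>) * h \<le> t" "t - h < real (nat \<lfloor>t / h\<rfloor>) * h"
    using assms by (auto simp: algebra_simps)
qed

lemma grid_floor_tendsto:
  fixes t :: real
  assumes t: "0 \<le> t" and h: "\<And>j::nat. 0 < h j" "h \<longlonglongrightarrow> 0"
  shows "(\<lambda>j. real (nat \<lfloor>t / h j\<rfloor>) * h j) \<longlonglongrightarrow> t"
proof (rule tendsto_sandwich)
  show "(\<lambda>j. t - h j) \<longlonglongrightarrow> t"
    using tendsto_diff[OF tendsto_const h(2), of t] by simp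
  show "\<forall>\<^sub>F j in sequentially. t - h j \<le> real (nat \<lfloor>t / h j\<rfloor>) * h j"
    using grid_floor_bounds(2)[OF t h(1)] by (auto intro: always_eventually less_imp_le)
  show "\<forall>\<^sub>F j in sequentially. real (nat \<lfloor>t / h j\<rfloor>) * h j \<le> t"
    using grid_floor_bounds(1)[OF t h(1)] by (auto intro: always_eventually)
qed simp

context al_space
begin

lemma sg_tendsto_from_left:
  assumes S: "pc_semigroup S" and x: "x \<in> V"
    and s: "s \<longlonglongrightarrow> t" "\<And>j::nat. 0 \<le> s j" "\<And>j. s j \<le> t"
  shows "(\<lambda>j. S (s j) x) \<longlonglongrightarrow> S t x"
proof (rule tendstoI)
  fix e :: real assume e: "0 < e"
  obtain d where d: "0 < d" "\<And>t. 0 \<le> t \<Longrightarrow> t < d \<Longrightarrow> norm (S t x - x) < e"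
    using sg_modulus[OF S x e] by blast
  have "\<forall>\<^sub>F j in sequentially. dist (s j) t < d"
    using tendstoD[OF s(1) d(1)] .
  then show "\<forall>\<^sub>F j in sequentially. dist (S (s j) x) (S t x) < e"
  proof eventually_elim
    case (elim j)
    then have "norm (S (t - s j) x - x) < e"
      using s(3)[of j] by (intro d(2)) (auto simp: dist_real_def)
    then show ?case
      using sg_diff_le[OF S x s(2) s(3), of j] by (simp add: dist_norm norm_minus_commute)
  qed
qed

text \<open>
  With \<open>c = (1 - exp (- l k)) / l\<close> and \<open>q = exp (- l k)\<close> the fixed point equation defines a discrete
  analogue, with step size \<open>k\<close>, of the resolvent \<open>x = \<integral>\<^sub>0\<^sup>\<infinity> exp (- l s) S s v ds\<close>.  Unrolling it \<open>n\<close>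
  times separates the contribution of the time interval from \<open>0\<close> to \<open>n k\<close>.
\<close>

lemma discrete_resolvent_iterate:
  assumes S: "pc_semigroup S" and k: "0 \<le> k" and V: "x \<in> V" "v \<in> V"
    and fp: "x = c *\<^sub>R v + q *\<^sub>R S k x"
  shows "x = (\<Sum>j<n. (c * q ^ j) *\<^sub>R S (real j * k) v) + q ^ n *\<^sub>R S (real n * k) x"
proof (induction n)
  case 0
  then show ?case using sg_0[OF S] V by simp
next
  case (Suc n)
  have T: "pos_contraction (S (real n * k))"
    using sg_pc[OF S] k by simp
  have Sk: "S k x \<in> V"
    using pc_V[OF sg_pc[OF S]] k V by simp
  have eq: "real (Suc n) * k = real n * k + k"
    by (simp add: algebra_simps)
  have "S (real n * k) x = S (real n * k) (c *\<^sub>R v + q *\<^sub>R S k x)"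
    using fp by simp
  also have "\<dots> = c *\<^sub>R S (real n * k) v + q *\<^sub>R S (real (Suc n) * k) x"
    unfolding eq using V Sk k by (simp add: sg_add[OF S] pc_add[OF T] pc_scale[OF T])
  finally have "q ^ n *\<^sub>R S (real n * k) x
      = (c * q ^ n) *\<^sub>R S (real n * k) v + q ^ Suc n *\<^sub>R S (real (Suc n) * k) x"
    by (simp add: scaleR_add_right mult.commute)
  with Suc show ?case by (simp add: add.assoc)
qed

text \<open>
  The weights \<open>c q\<^sup>j\<close> are the integrals of \<open>exp (- l s)\<close> over the grid cells, so they add up to
  \<open>(1 - exp (- l n k)) / l\<close> exactly.  Hence replacing \<open>S s v\<close> by \<open>v\<close> on the interval from \<open>0\<close> to \<open>n k\<close>
  costs no more than the oscillation \<open>w\<close> of the orbit there, independently of the step size \<open>k\<close>.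
\<close>

lemma discrete_resolvent_estimate:
  assumes S: "pc_semigroup S" and l: "0 < l" and k: "0 \<le> k" and V: "x \<in> V" "v \<in> V"
    and fp: "x = ((1 - exp (- l * k)) / l) *\<^sub>R v + exp (- l * k) *\<^sub>R S k x"
    and w: "\<And>s. 0 \<le> s \<Longrightarrow> s \<le> real n * k \<Longrightarrow> norm (S s v - v) \<le> w"
  shows "norm (x - exp (- l * (real n * k)) *\<^sub>R S (real n * k) x
      - ((1 - exp (- l * (real n * k))) / l) *\<^sub>R v) \<le> (1 - exp (- l * (real n * k))) / l * w"
proof -
  define q where "q = exp (- l * k)"
  define c where "c = (1 - q) / l"
  have q: "0 < q" "q \<le> 1"
    using l k by (auto simp: q_def)
  then have c: "0 \<le> c"
    using l by (simp add: c_def)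
  have qn: "exp (- l * (real n * k)) = q ^ n"
    unfolding q_def by (simp flip: exp_of_nat_mult add: mult_ac)
  have geo: "(\<Sum>j<n. c * q ^ j) = (1 - q ^ n) / l"
    unfolding c_def one_diff_power_eq sum_distrib_left sum_divide_distrib
    by (intro sum.cong) (auto simp: field_simps)
  have "x - q ^ n *\<^sub>R S (real n * k) x = (\<Sum>j<n. (c * q ^ j) *\<^sub>R S (real j * k) v)"
    using discrete_resolvent_iterate[OF S k V, of c q n] fp
    unfolding c_def q_def by (simp add: algebra_simps)
  moreover have "((1 - q ^ n) / l) *\<^sub>R v = (\<Sum>j<n. (c * q ^ j) *\<^sub>R v)"
    by (simp only: geo[symmetric] scaleR_sum_left)
  ultimately have "x - q ^ n *\<^sub>R S (real n * k) x - ((1 - q ^ n) / l) *\<^sub>R v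
      = (\<Sum>j<n. (c * q ^ j) *\<^sub>R (S (real j * k) v - v))"
    by (simp add: sum_subtractf scaleR_diff_right)
  also have "norm \<dots> \<le> (\<Sum>j<n. (c * q ^ j) * w)"
  proof (intro sum_norm_le)
    fix j assume "j \<in> {..<n}"
    then have "norm (S (real j * k) v - v) \<le> w"
      using k by (intro w mult_right_mono) auto
    then show "norm ((c * q ^ j) *\<^sub>R (S (real j * k) v - v)) \<le> (c * q ^ j) * w"
      using c q by (simp add: abs_mult mult_left_mono)
  qed
  also have "\<dots> = (1 - q ^ n) / l * w"
    by (simp only: geo sum_distrib_right[symmetric])
  finally show ?thesis
    unfolding qn .
qed

text \<open>
  For the step sizes \<open>2\<^sup>-\<^sup>j\<close> the discrete resolvents \<open>X j\<close> exist by Banach's fixed point theorem.  If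
  \<open>i < j\<close>, then \<open>X j\<close> is up to the error of \<open>discrete_resolvent_estimate\<close> a solution of the equation
  for \<open>X i\<close>, and the latter is solved uniquely with a contraction factor; hence the sequence is Cauchy.
  The estimate survives in the limit for every time \<open>t\<close>, and dividing it by \<open>t\<close> identifies the value of
  the generator.  Running the argument in the cone instead of the whole space gives positivity.
\<close>

lemma resolvent_exists_with_modulus:
  assumes S: "pc_semigroup S" and l: "0 < l" and W: "W = V \<or> W = cone" and v: "v \<in> W"
  obtains x where "x \<in> W" "gen S x (l *\<^sub>R x - v)"
    "\<And>t w. 0 \<le> t \<Longrightarrow> (\<And>s. 0 \<le> s \<Longrightarrow> s \<le> t \<Longrightarrow> norm (S s v - v) \<le> w) \<Longrightarrow>
       norm (x - exp (- l * t) *\<^sub>R S t x - ((1 - exp (- l * t)) / l) *\<^sub>R v)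
         \<le> (1 - exp (- l * t)) / l * w"
proof -
  have WV: "W \<subseteq> V"
    using W cone_V by auto
  have vV: "v \<in> V"
    using v WV by auto
  have fixed: "\<exists>x\<in>W. x = ((1 - exp (- l * k)) / l) *\<^sub>R v + exp (- l * k) *\<^sub>R S k x"
    if k: "0 < k" for k
  proof -
    note T = sg_pc[OF S less_imp_le[OF k]]
    let ?f = "\<lambda>x. ((1 - exp (- l * k)) / l) *\<^sub>R v + exp (- l * k) *\<^sub>R S k x"
    have "\<exists>!x\<in>W. ?f x = x"
    proof (rule Banach_fix[where c = "exp (- l * k)"])
      show "complete W"
        using W closed_V closed_cone by (auto simp: complete_eq_closed)
      show "W \<noteq> {}"
        using v by auto
      show "?f ` W \<subseteq> W"
        using W v k l pc_V[OF T] pc_cone[OF T]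
        by (auto intro!: cone_add cone_scale)
      fix x y assume "x \<in> W" "y \<in> W"
      then show "dist (?f x) (?f y) \<le> exp (- l * k) * dist x y"
        using pc_norm_diff[OF T, of x y] WV
        by (auto simp: dist_norm scaleR_diff_right[symmetric])
    qed (use k l in auto)
    then show ?thesis
      by metis
  qed
  define h where "h j = (1/2 :: real) ^ j" for j
  have h: "0 < h j" for j
    by (simp add: h_def)
  have h0: "h \<longlonglongrightarrow> 0"
    unfolding h_def by (rule LIMSEQ_power_zero) simp
  obtain X where X: "\<And>j. X j \<in> W"
    "\<And>j. X j = ((1 - exp (- l * h j)) / l) *\<^sub>R v + exp (- l * h j) *\<^sub>R S (h j) (X j)"
    using fixed[OF h] by metis
  then have XV: "X j \<in> V" for j
    using WV by auto
  have "Cauchy X"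
  proof (rule CauchyI')
    fix e :: real assume e: "0 < e"
    then have "0 < l * e / 2"
      using l by simp
    then obtain d where d: "0 < d" "\<And>t. 0 \<le> t \<Longrightarrow> t < d \<Longrightarrow> norm (S t v - v) < l * e / 2"
      using sg_modulus[OF S vV] by blast
    obtain N where N: "\<And>n. n \<ge> N \<Longrightarrow> h n < d"
      using order_tendstoD(2)[OF h0 d(1)] by (auto simp: eventually_sequentially)
    have "dist (X i) (X j) < e" if ij: "N \<le> i" "i < j" for i j
    proof -
      let ?n = "2 ^ (j - i) :: nat" and ?q = "exp (- l * h i)"
      let ?c = "(1 - exp (- l * h i)) / l"
      \<comment> \<open>A single step of size \<open>h i\<close> consists of \<open>?n\<close> steps of size \<open>h j\<close>.\<close>
      have nk: "real ?n * h j = h i"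
      proof -
        have "(2::real) ^ j = 2 ^ i * 2 ^ (j - i)"
          using ij by (simp flip: power_add)
        then show ?thesis
          by (simp add: h_def power_one_over)
      qed
      have q: "?q < 1"
        using l h by simp
      note T = sg_pc[OF S less_imp_le[OF h[of i]]]
      have "norm (X j - ?q *\<^sub>R S (h i) (X j) - ?c *\<^sub>R v) \<le> ?c * (l * e / 2)"
      proof -
        have w: "norm (S s v - v) \<le> l * e / 2" if "0 \<le> s" "s \<le> real ?n * h j" for s
          using that d(2)[of s] N[OF ij(1)] unfolding nk by simp
        have "norm (X j - exp (- l * (real ?n * h j)) *\<^sub>R S (real ?n * h j) (X j)
            - ((1 - exp (- l * (real ?n * h j))) / l) *\<^sub>R v)
            \<le> (1 - exp (- l * (real ?n * h j))) / l * (l * e / 2)"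
          by (rule discrete_resolvent_estimate[OF S l less_imp_le[OF h] XV vV X(2)]) (rule w)
        then show ?thesis unfolding nk .
      qed
      also have "X j - ?q *\<^sub>R S (h i) (X j) - ?c *\<^sub>R v
          = (X j - X i) - ?q *\<^sub>R S (h i) (X j - X i)"
        using arg_cong[OF X(2)[of i], of "\<lambda>z. z - ?q *\<^sub>R S (h i) (X i)"] XV
        by (simp add: pc_diff[OF T] algebra_simps)
      finally have "norm ((X j - X i) - ?q *\<^sub>R S (h i) (X j - X i)) \<le> (1 - ?q) * (e / 2)"
        using l by simp
      moreover have "norm (?q *\<^sub>R S (h i) (X j - X i)) \<le> ?q * norm (X j - X i)"
        using pc_norm[OF T, of "X j - X i"] XV by simp
      moreover have "norm (X j - X i)
          \<le> norm ((X j - X i) - ?q *\<^sub>R S (h i) (X j - X i)) + norm (?q *\<^sub>R S (h i) (X j - X i))"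
        by (metis diff_add_cancel norm_triangle_ineq)
      ultimately have "norm (X j - X i) \<le> (1 - ?q) * (e / 2) + ?q * norm (X j - X i)"
        by linarith
      then have "(1 - ?q) * norm (X j - X i) \<le> (1 - ?q) * (e / 2)"
        by (simp add: algebra_simps)
      then have "norm (X j - X i) \<le> e / 2"
        using q by (simp add: mult_le_cancel_left_pos)
      then show ?thesis
        using e by (simp add: dist_norm norm_minus_commute)
    qed
    then show "\<exists>M. \<forall>m\<ge>M. \<forall>n>m. dist (X m) (X n) < e"
      by blast
  qed
  then obtain x where x: "X \<longlonglongrightarrow> x"
    by (auto simp: Cauchy_convergent_iff convergent_def)
  have xW: "x \<in> W"
    using W
  proof
    assume W': "W = V"
    show ?thesis
      unfolding W' by (rule V_limit[OF x]) (use X(1) W' in auto)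
  next
    assume W': "W = cone"
    show ?thesis
      unfolding W' by (rule cone_limit[OF x]) (use X(1) W' in auto)
  qed
  then have xV: "x \<in> V"
    using WV by auto
  have est: "norm (x - exp (- l * t) *\<^sub>R S t x - ((1 - exp (- l * t)) / l) *\<^sub>R v)
         \<le> (1 - exp (- l * t)) / l * w"
    if t: "0 \<le> t" and w: "\<And>s. 0 \<le> s \<Longrightarrow> s \<le> t \<Longrightarrow> norm (S s v - v) \<le> w" for t w
  proof -
    define n where "n j = nat \<lfloor>t / h j\<rfloor>" for j
    define s where "s j = real (n j) * h j" for j
    have s: "s \<longlonglongrightarrow> t" "\<And>j. 0 \<le> s j" "\<And>j. s j \<le> t"
      using grid_floor_tendsto[OF t h h0] grid_floor_bounds(1)[OF t h] h
      by (auto simp: s_def[abs_def] n_def less_imp_le)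
    have "(\<lambda>j. S (s j) (X j - x)) \<longlonglongrightarrow> 0"
    proof (rule tendsto_0_le[where K = 1])
      show "(\<lambda>j. X j - x) \<longlonglongrightarrow> 0"
        using x by (rule LIM_zero)
      show "\<forall>\<^sub>F j in sequentially. norm (S (s j) (X j - x)) \<le> norm (X j - x) * 1"
        using pc_norm[OF sg_pc[OF S s(2)]] XV xV by (intro always_eventually) auto
    qed
    then have "(\<lambda>j. S (s j) (X j - x) + S (s j) x) \<longlonglongrightarrow> 0 + S t x"
      by (intro tendsto_add sg_tendsto_from_left S xV s)
    then have SX: "(\<lambda>j. S (s j) (X j)) \<longlonglongrightarrow> S t x"
      using XV xV by (simp add: pc_diff[OF sg_pc[OF S s(2)]])
    show ?thesis
    proof (rule LIMSEQ_le)
      show "(\<lambda>j. norm (X j - exp (- l * s j) *\<^sub>R S (s j) (X j) - ((1 - exp (- l * s j)) / l) *\<^sub>R v))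
          \<longlonglongrightarrow> norm (x - exp (- l * t) *\<^sub>R S t x - ((1 - exp (- l * t)) / l) *\<^sub>R v)"
        using l by (intro tendsto_intros x SX s(1)) auto
      show "(\<lambda>j. (1 - exp (- l * s j)) / l * w) \<longlonglongrightarrow> (1 - exp (- l * t)) / l * w"
        using l by (intro tendsto_intros s(1)) auto
      have "norm (X j - exp (- l * s j) *\<^sub>R S (s j) (X j) - ((1 - exp (- l * s j)) / l) *\<^sub>R v)
          \<le> (1 - exp (- l * s j)) / l * w" for j
        unfolding s_def
        by (rule discrete_resolvent_estimate[OF S l less_imp_le[OF h] XV vV X(2)])
          (rule w, use s(3)[of j] in \<open>auto simp: s_def\<close>)
      then show "\<exists>N. \<forall>j\<ge>N. norm (X j - exp (- l * s j) *\<^sub>R S (s j) (X j)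
          - ((1 - exp (- l * s j)) / l) *\<^sub>R v) \<le> (1 - exp (- l * s j)) / l * w"
        by blast
    qed
  qed
  have "gen S x (l *\<^sub>R x - v)"
  proof -
    let ?a = "\<lambda>t::real. (exp (l * t) - 1) / t"
    have a: "(?a \<longlongrightarrow> l) (at_right 0)"
    proof -
      have "((\<lambda>t. exp (l * t)) has_real_derivative l) (at_right 0)"
        by (auto intro!: derivative_eq_intros)
      then show ?thesis
        by (simp add: has_field_derivative_iff)
    qed
    let ?y = "x - v /\<^sub>R l"
    have "((\<lambda>t. (S t x - x) /\<^sub>R t - ?a t *\<^sub>R ?y) \<longlongrightarrow> 0) (at_right 0)"
    proof (rule tendstoI)
      fix e :: real assume e: "0 < e"
      then have e2: "0 < e / 2" by simp
      obtain d where d: "0 < d" "\<And>t. 0 \<le> t \<Longrightarrow> t < d \<Longrightarrow> norm (S t v - v) < e / 2"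
        using sg_modulus[OF S vV e2] by blast
      have "\<forall>\<^sub>F t in at_right 0. ?a t < 2 * l"
        using l by (intro order_tendstoD(2)[OF a]) simp
      moreover have "\<forall>\<^sub>F t in at_right 0. t < d"
        by (rule order_tendstoD(2)[OF tendsto_ident_at d(1)])
      moreover have "\<forall>\<^sub>F t in at_right 0. 0 < (t::real)"
        by (simp add: eventually_at_filter)
      ultimately show "\<forall>\<^sub>F t in at_right 0. dist ((S t x - x) /\<^sub>R t - ?a t *\<^sub>R ?y) 0 < e"
      proof eventually_elim
        case (elim t)
        let ?E = "x - exp (- l * t) *\<^sub>R S t x - ((1 - exp (- l * t)) / l) *\<^sub>R v"
        have E: "norm ?E \<le> (1 - exp (- l * t)) / l * (e / 2)"
        proof (rule est)
          fix s :: real assume "0 \<le> s" "s \<le> t"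
          then show "norm (S s v - v) \<le> e / 2"
            using elim d(2)[of s] by simp
        qed (use elim in simp)
        have ee: "exp (l * t) * exp (- l * t) = 1"
          by (simp add: exp_minus_inverse)
        have "(- exp (l * t) / t) *\<^sub>R ?E
            = (exp (l * t) * exp (- l * t) / t) *\<^sub>R S t x - (exp (l * t) / t) *\<^sub>R x
              + ((exp (l * t) - exp (l * t) * exp (- l * t)) / l / t) *\<^sub>R v"
          by (simp add: scaleR_diff_right algebra_simps diff_divide_distrib)
        also have "\<dots> = (S t x - x) /\<^sub>R t - ?a t *\<^sub>R ?y"
          unfolding ee by (simp add: divide_inverse algebra_simps)
        finally have "norm ((S t x - x) /\<^sub>R t - ?a t *\<^sub>R ?y) = exp (l * t) / t * norm ?E"
          using elim by (metis abs_divide abs_exp_cancel abs_minus abs_of_pos norm_scaleR)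
        also have "\<dots> \<le> exp (l * t) / t * ((1 - exp (- l * t)) / l * (e / 2))"
          using E elim by (intro mult_left_mono) auto
        also have "\<dots> = (exp (l * t) - exp (l * t) * exp (- l * t)) / t / l * (e / 2)"
          by (simp add: algebra_simps diff_divide_distrib)
        also have "\<dots> = ?a t / l * (e / 2)"
          unfolding ee ..
        also have "\<dots> < 2 * (e / 2)"
          using elim l e by (intro mult_strict_right_mono) (auto simp: field_simps)
        finally show ?case by simp
      qed
    qed
    then have "((\<lambda>t. ((S t x - x) /\<^sub>R t - ?a t *\<^sub>R ?y) + ?a t *\<^sub>R ?y) \<longlongrightarrow> 0 + l *\<^sub>R ?y) (at_right 0)"
      by (intro tendsto_intros a)
    then show ?thesis
      using l xV vV by (simp add: gen_def scaleR_diff_right)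
  qed
  from xW this est show thesis
    by (rule that)
qed

text \<open>
  The estimate for the resolvent \<open>x\<close> of \<open>v\<close> says that \<open>x - exp (- t) S t x\<close>, divided by \<open>1 - exp (- t)\<close>,
  is close to \<open>v\<close> for small \<open>t\<close>; both \<open>x\<close> and \<open>S t x\<close> belong to the domain.
\<close>

lemma dom_dense:
  assumes S: "pc_semigroup S"
  shows "V \<subseteq> closure {x. \<exists>y. gen S x y}"
proof
  fix v assume v: "v \<in> V"
  obtain x where x: "x \<in> V" "gen S x (1 *\<^sub>R x - v)" and
    est: "\<And>t w. 0 \<le> t \<Longrightarrow> (\<And>s. 0 \<le> s \<Longrightarrow> s \<le> t \<Longrightarrow> norm (S s v - v) \<le> w) \<Longrightarrow>
       norm (x - exp (- 1 * t) *\<^sub>R S t x - ((1 - exp (- 1 * t)) / 1) *\<^sub>R v)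
         \<le> (1 - exp (- 1 * t)) / 1 * w"
    using resolvent_exists_with_modulus[OF S zero_less_one, of V v] v by blast
  show "v \<in> closure {x. \<exists>y. gen S x y}"
    unfolding closure_approachable
  proof (intro allI impI)
    fix e :: real assume e: "0 < e"
    then have "0 < e / 2" by simp
    then obtain d where d: "0 < d" "\<And>t. 0 \<le> t \<Longrightarrow> t < d \<Longrightarrow> norm (S t v - v) < e / 2"
      using sg_modulus[OF S v] by blast
    let ?t = "d / 2"
    define C where "C = 1 - exp (- ?t)"
    let ?u = "(x - exp (- ?t) *\<^sub>R S ?t x) /\<^sub>R C"
    have c: "0 < C"
      using d(1) by (simp add: C_def)
    have "norm (x - exp (- ?t) *\<^sub>R S ?t x - C *\<^sub>R v) \<le> C * (e / 2)"
    proof -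
      have "norm (x - exp (- 1 * ?t) *\<^sub>R S ?t x - ((1 - exp (- 1 * ?t)) / 1) *\<^sub>R v)
          \<le> (1 - exp (- 1 * ?t)) / 1 * (e / 2)"
      proof (rule est)
        fix s :: real assume "0 \<le> s" "s \<le> ?t"
        then show "norm (S s v - v) \<le> e / 2"
          using d(1) d(2)[of s] by simp
      qed (use d(1) in simp)
      then show ?thesis
        by (simp add: C_def)
    qed
    moreover have "norm (?u - v) = norm (x - exp (- ?t) *\<^sub>R S ?t x - C *\<^sub>R v) / C"
    proof -
      have "?u - v = (x - exp (- ?t) *\<^sub>R S ?t x - C *\<^sub>R v) /\<^sub>R C"
        using c by (simp add: scaleR_diff_right)
      then have "norm (?u - v) = norm ((x - exp (- ?t) *\<^sub>R S ?t x - C *\<^sub>R v) /\<^sub>R C)"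
        by (rule arg_cong)
      also have "\<dots> = norm (x - exp (- ?t) *\<^sub>R S ?t x - C *\<^sub>R v) / C"
        unfolding norm_scaleR abs_inverse abs_of_pos[OF c] by (rule divide_inverse_commute[symmetric])
      finally show ?thesis .
    qed
    ultimately have "norm (?u - v) \<le> e / 2"
      using c by (simp add: divide_le_eq mult.commute)
    moreover have "\<exists>y. gen S ?u y"
    proof -
      have "gen S (S ?t x) (S ?t (1 *\<^sub>R x - v))"
        by (rule gen_invariant[OF S x(2)]) (use d(1) in simp)
      from gen_scale[OF S gen_diff[OF S x(2) gen_scale[OF S this, of "exp (- ?t)"]], of "inverse C"]
      show ?thesis
        by (rule exI)
    qed
    ultimately show "\<exists>y\<in>{x. \<exists>y. gen S x y}. dist y v < e"
      using e by (intro bexI[of _ ?u]) (auto simp: dist_norm)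
  qed
qed

definition res :: "(real \<Rightarrow> 'w \<Rightarrow> 'w) \<Rightarrow> real \<Rightarrow> 'w \<Rightarrow> 'w" where
  "res S l v = (THE x. gen S x (l *\<^sub>R x - v))"

lemma resolvent_unique:
  assumes S: "pc_semigroup S" and l: "0 < l"
    and x: "gen S x (l *\<^sub>R x - v)" and y: "gen S y (l *\<^sub>R y - v)"
  shows "x = y"
proof -
  have "gen S (x - y) (l *\<^sub>R (x - y))"
    using gen_diff[OF S x y] by (simp add: scaleR_diff_right)
  from gen_dissipative[OF S this l] show ?thesis
    using l by (simp add: mult_le_0_iff)
qed

lemma res_eqI:
  assumes "pc_semigroup S" "0 < l" "gen S x (l *\<^sub>R x - v)"
  shows "res S l v = x"
  unfolding res_def using assms resolvent_unique by blast

lemma res_gen: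
  assumes S: "pc_semigroup S" and l: "0 < l" and v: "v \<in> V"
  shows "gen S (res S l v) (l *\<^sub>R res S l v - v)"
  using resolvent_exists_with_modulus[OF S l _ v] res_eqI[OF S l] by metis

lemma res_cone:
  assumes S: "pc_semigroup S" and l: "0 < l" and v: "v \<in> cone"
  shows "res S l v \<in> cone"
  using resolvent_exists_with_modulus[OF S l _ v] res_eqI[OF S l] by metis

lemma res_of_gen:
  assumes S: "pc_semigroup S" and l: "0 < l" and x: "gen S x y"
  shows "res S l (l *\<^sub>R x - y) = x"
  using res_eqI[OF S l, of x "l *\<^sub>R x - y"] x by simp

lemma res_V: "pc_semigroup S \<Longrightarrow> 0 < l \<Longrightarrow> v \<in> V \<Longrightarrow> res S l v \<in> V"
  using res_gen gen_V(1) by blast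

lemma res_add:
  assumes S: "pc_semigroup S" and l: "0 < l" and V: "x \<in> V" "y \<in> V"
  shows "res S l (x + y) = res S l x + res S l y"
  using gen_add[OF S res_gen[OF S l V(1)] res_gen[OF S l V(2)]]
  by (intro res_eqI[OF S l]) (simp add: algebra_simps)

lemma res_scale:
  assumes S: "pc_semigroup S" and l: "0 < l" and x: "x \<in> V"
  shows "res S l (c *\<^sub>R x) = c *\<^sub>R res S l x"
  using gen_scale[OF S res_gen[OF S l x], of c]
  by (intro res_eqI[OF S l]) (simp add: algebra_simps)

lemma res_diff:
  assumes S: "pc_semigroup S" and l: "0 < l" and V: "x \<in> V" "y \<in> V"
  shows "res S l (x - y) = res S l x - res S l y"
  using res_add[OF S l V(1) V_uminus[OF V(2)]] res_scale[OF S l V(2), of "-1"] by simp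

end

context al_space
begin

lemma pc_comp: "pos_contraction T \<Longrightarrow> pos_contraction U \<Longrightarrow> pos_contraction (\<lambda>x. T (U x))"
  unfolding pos_contraction_def by (auto intro: order_trans)

lemma pc_limit:
  assumes T: "\<And>j::nat. pos_contraction (T j)"
    and lim: "\<And>x. x \<in> V \<Longrightarrow> (\<lambda>j. T j x) \<longlonglongrightarrow> U x"
  shows "pos_contraction U"
  unfolding pos_contraction_def
proof (intro conjI ballI allI)
  fix x assume x: "x \<in> V"
  show "U x \<in> V"
    by (rule V_limit[OF lim[OF x]]) (use pc_V[OF T x] in auto)
  show "norm (U x) \<le> norm x"
    by (rule LIMSEQ_le_const2[OF tendsto_norm[OF lim[OF x]]]) (use pc_norm[OF T x] in auto)
  show "U (c *\<^sub>R x) = c *\<^sub>R U x" for c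
    using LIMSEQ_unique[OF lim[of "c *\<^sub>R x"]] tendsto_scaleR[OF tendsto_const lim[OF x], of c] x
    by (simp add: pc_scale[OF T])
  fix y assume y: "y \<in> V"
  show "U (x + y) = U x + U y"
    using LIMSEQ_unique[OF lim[of "x + y"]] tendsto_add[OF lim[OF x] lim[OF y]] x y
    by (simp add: pc_add[OF T])
next
  fix x assume x: "x \<in> cone"
  show "U x \<in> cone"
    by (rule cone_limit[OF lim[OF cone_V[OF x]]]) (use pc_cone[OF T x] in auto)
qed

lemma dense_approx:
  assumes "V \<subseteq> closure D" "x \<in> V" "0 < e"
  obtains z where "z \<in> D" "dist z x < e"
  using assms closure_approachable[of x D] by (auto dest: subsetD)

lemma pc_convergent_on_dense:
  assumes T: "\<And>j::nat. pos_contraction (T j)" and D: "D \<subseteq> V" "V \<subseteq> closure D"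
    and conv: "\<And>x. x \<in> D \<Longrightarrow> convergent (\<lambda>j. T j x)" and x: "x \<in> V"
  shows "convergent (\<lambda>j. T j x)"
  unfolding Cauchy_convergent_iff[symmetric]
proof (rule metric_CauchyI)
  fix e :: real assume e: "0 < e"
  then have e4: "0 < e / 4" by simp
  obtain z where z: "z \<in> D" "dist z x < e / 4"
    by (rule dense_approx[OF D(2) x e4])
  have "Cauchy (\<lambda>j. T j z)"
    using conv[OF z(1)] by (simp add: Cauchy_convergent_iff)
  then obtain N where N: "\<And>m n. m \<ge> N \<Longrightarrow> n \<ge> N \<Longrightarrow> dist (T m z) (T n z) < e / 4"
    using metric_CauchyD[OF _ e4] by blast
  have near: "dist (T j x) (T j z) < e / 4" for j
    using pc_norm_diff[OF T x, of z j] z D(1) by (auto simp: dist_norm norm_minus_commute)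
  have "dist (T m x) (T n x) < e" if "m \<ge> N" "n \<ge> N" for m n
    using N[OF that] near[of m] near[of n] dist_triangle[of "T m x" "T n x" "T m z"]
      dist_triangle[of "T m z" "T n x" "T n z"] dist_commute[of "T n x" "T n z"] e by linarith
  then show "\<exists>M. \<forall>m\<ge>M. \<forall>n\<ge>M. dist (T m x) (T n x) < e"
    by blast
qed

lemma pc_eq_on_dense:
  assumes T: "pos_contraction T" and U: "pos_contraction U" and D: "D \<subseteq> V" "V \<subseteq> closure D"
    and eq: "\<And>x. x \<in> D \<Longrightarrow> T x = U x" and x: "x \<in> V"
  shows "T x = U x"
proof -
  obtain f where f: "\<And>n. f n \<in> D" "f \<longlonglongrightarrow> x"
    using x D(2) by (meson closure_sequential subsetD)
  then have "\<And>n. f n \<in> V"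
    using D(1) by auto
  then have "(\<lambda>n. T (f n)) \<longlonglongrightarrow> T x" "(\<lambda>n. U (f n)) \<longlonglongrightarrow> U x"
    using pc_tendsto[OF T f(2)] pc_tendsto[OF U f(2)] x by auto
  then show ?thesis
    using eq[OF f(1)] LIMSEQ_unique by auto
qed

end

section \<open>Generation from a resolvent family\<close>

lemma sqrt_convex_combination_le:
  fixes a b X Y :: real
  assumes "0 \<le> a" "0 \<le> b" "a + b = 1" "0 \<le> X" "0 \<le> Y"
  shows "a * sqrt X + b * sqrt Y \<le> sqrt (a * X + b * Y)"
proof (rule real_le_rsqrt)
  have b: "b = 1 - a" using assms by simp
  have "a * (sqrt X)\<^sup>2 + b * (sqrt Y)\<^sup>2 - (a * sqrt X + b * sqrt Y)\<^sup>2 = a * b * (sqrt X - sqrt Y)\<^sup>2"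
    unfolding b by algebra
  also have "\<dots> \<ge> 0"
    using assms by simp
  finally show "(a * sqrt X + b * sqrt Y)\<^sup>2 \<le> a * X + b * Y"
    using assms by simp
qed

text \<open>
  Here \<open>J h\<close> stands for \<open>(1 - h G)\<^sup>-\<^sup>1\<close>, one step of the implicit Euler scheme for
  \<open>u' = G u\<close>, and \<open>J_identity\<close> is the resolvent identity; for \<open>k \<le> h\<close> the operator
  \<open>J k\<close> is applied there to a convex combination.
\<close>

locale resolvent_family = al_space +
  fixes J :: "real \<Rightarrow> 'a \<Rightarrow> 'a" and h0 :: real
  assumes h0: "0 < h0"
    and J_pc: "0 < h \<Longrightarrow> h \<le> h0 \<Longrightarrow> pos_contraction (J h)"
    and J_identity: "0 < k \<Longrightarrow> k \<le> h \<Longrightarrow> h \<le> h0 \<Longrightarrow> x \<in> V \<Longrightarrow>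
      J h x = J k ((k / h) *\<^sub>R x + (1 - k / h) *\<^sub>R J h x)"
    and J_dense: "V \<subseteq> closure (J h0 ` V)"
begin

text \<open>
  The operator that is to be extended to a generator, as a graph on the range of \<open>J h0\<close>.
\<close>

definition G :: "'a \<Rightarrow> 'a \<Rightarrow> bool" where
  "G x y \<longleftrightarrow> (\<exists>v\<in>V. x = J h0 v \<and> y = (J h0 v - v) /\<^sub>R h0)"

lemma G_V: "G x y \<Longrightarrow> x \<in> V" "G x y \<Longrightarrow> y \<in> V"
  using pc_V[OF J_pc[OF h0 order_refl]] by (auto simp: G_def)

lemma G_dom: "J h0 ` V = {x. \<exists>y. G x y}"
  by (auto simp: G_def)

lemma J_step:
  assumes G: "G x y" and k: "0 < k" "k \<le> h0"
  shows "J k x - x = k *\<^sub>R J k y"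
proof -
  obtain v where v: "v \<in> V" "x = J h0 v" "y = (x - v) /\<^sub>R h0"
    using G by (auto simp: G_def)
  have "x = J k ((k / h0) *\<^sub>R v + (1 - k / h0) *\<^sub>R x)"
    using J_identity[OF k order_refl v(1)] v(2) by simp
  also have "(k / h0) *\<^sub>R v + (1 - k / h0) *\<^sub>R x = x - k *\<^sub>R y"
    unfolding v(3) by (simp add: algebra_simps divide_inverse)
  also have "J k (x - k *\<^sub>R y) = J k x - k *\<^sub>R J k y"
    using G_V[OF G] by (simp add: pc_diff[OF J_pc[OF k]] pc_scale[OF J_pc[OF k]])
  finally show ?thesis by (simp add: algebra_simps)
qed

lemma J_step_norm:
  assumes G: "G x y" and k: "0 < k" "k \<le> h0"
  shows "norm (J k x - x) \<le> k * norm y"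
  using J_step[OF assms] pc_norm[OF J_pc[OF k] G_V(2)[OF G]] k by simp

lemma J_power_norm:
  assumes G: "G x y" and k: "0 < k" "k \<le> h0"
  shows "norm ((J k ^^ m) x - x) \<le> real m * k * norm y"
proof (induction m)
  case (Suc m)
  have "norm (J k ((J k ^^ m) x) - x) \<le> norm (J k ((J k ^^ m) x) - J k x) + norm (J k x - x)"
    using norm_triangle_ineq[of "J k ((J k ^^ m) x) - J k x" "J k x - x"] by simp
  also have "norm (J k ((J k ^^ m) x) - J k x) \<le> norm ((J k ^^ m) x - x)"
    using G_V(1)[OF G] pc_V[OF pc_power[OF J_pc[OF k]]] by (intro pc_norm_diff[OF J_pc[OF k]]) auto
  finally show ?case
    using Suc J_step_norm[OF assms] by (simp add: algebra_simps)
qed simp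

text \<open>
  The resolvent identity expresses \<open>J h q\<close> as \<open>J k\<close> of the convex combination of \<open>q\<close> and \<open>J h q\<close> with
  weights \<open>k / h\<close> and \<open>1 - k / h\<close>.  Therefore the distances \<open>a m n\<close> on the left hand side satisfy
  \<open>a (m+1) (n+1) \<le> (k / h) a m n + (1 - k / h) a m (n+1)\<close>.  Read as one step
  of a random walk on the index pairs, this changes \<open>m k - n h\<close> by an increment of mean \<open>0\<close> and variance
  \<open>k (h - k)\<close>.  The walk stops after at most \<open>m\<close> steps when an index is \<open>0\<close>, where \<open>a m n\<close> is at most
  \<open>\<bar>m k - n h\<bar> \<parallel>y\<parallel>\<close>, and the radicand bounds the second moment of the final \<open>m k - n h\<close>.  Formally,
  concavity of the square root makes the right hand side stable under the recursion.
\<close>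

lemma crandall_liggett:
  assumes G: "G x y" and k: "0 < k" "k \<le> h" "h \<le> h0"
  shows "norm ((J k ^^ m) x - (J h ^^ n) x)
    \<le> sqrt ((real m * k - real n * h)\<^sup>2 + real m * k * (h - k)) * norm y"
proof (induction m arbitrary: n)
  case 0
  have "norm (x - (J h ^^ n) x) \<le> real n * h * norm y"
    using J_power_norm[OF G, of h n] k by (simp add: norm_minus_commute)
  then show ?case
    using k by simp
next
  case (Suc m)
  have h: "0 < h" and k': "k \<le> h0"
    using k by auto
  have pV: "(J k ^^ m) x \<in> V" and qV: "(J h ^^ n) x \<in> V" for m n
    using G_V[OF G] pc_V[OF pc_power[OF J_pc]] k h by auto
  show ?case
  proof (cases n)
    case 0
    have "norm ((J k ^^ Suc m) x - x) \<le> (real (Suc m) * k) * norm y"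
      using J_power_norm[OF G, of k "Suc m"] k k' by simp
    also have "real (Suc m) * k \<le> sqrt ((real (Suc m) * k)\<^sup>2 + real (Suc m) * k * (h - k))"
      by (rule real_le_rsqrt) (use k in simp)
    finally show ?thesis
      using 0 by (simp add: mult_right_mono)
  next
    case (Suc n')
    define a where "a = k / h"
    define b where "b = 1 - a"
    define X where "X = (real m * k - real n' * h)\<^sup>2 + real m * k * (h - k)"
    define Y where "Y = (real m * k - real n * h)\<^sup>2 + real m * k * (h - k)"
    let ?p = "(J k ^^ m) x" and ?q = "(J h ^^ n') x" and ?q' = "(J h ^^ n) x"
    have ab: "0 \<le> a" "0 \<le> b" "a + b = 1" and ah: "a * h = k"
      using k h by (auto simp: a_def b_def)
    have XY: "0 \<le> X" "0 \<le> Y"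
      using k by (auto simp: X_def Y_def)
    have "?q' = J k (a *\<^sub>R ?q + b *\<^sub>R ?q')"
      using J_identity[OF k qV[of n']] Suc by (simp add: a_def b_def)
    then have "norm ((J k ^^ Suc m) x - ?q') = norm (J k ?p - J k (a *\<^sub>R ?q + b *\<^sub>R ?q'))"
      by simp
    also have "\<dots> \<le> norm (?p - (a *\<^sub>R ?q + b *\<^sub>R ?q'))"
      by (rule pc_norm_diff[OF J_pc[OF k(1) k']]) (use pV qV in auto)
    also have "?p - (a *\<^sub>R ?q + b *\<^sub>R ?q') = a *\<^sub>R (?p - ?q) + b *\<^sub>R (?p - ?q')"
      using ab(3) by (simp add: algebra_simps flip: scaleR_add_left)
    also have "norm \<dots> \<le> a * norm (?p - ?q) + b * norm (?p - ?q')"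
      using ab norm_triangle_ineq[of "a *\<^sub>R (?p - ?q)" "b *\<^sub>R (?p - ?q')"] by simp
    also have "\<dots> \<le> a * (sqrt X * norm y) + b * (sqrt Y * norm y)"
      using Suc.IH[of n'] Suc.IH[of n] ab unfolding X_def Y_def
      by (intro add_mono mult_left_mono) auto
    also have "\<dots> = (a * sqrt X + b * sqrt Y) * norm y"
      by (simp add: algebra_simps)
    also have "\<dots> \<le> sqrt (a * X + b * Y) * norm y"
      using sqrt_convex_combination_le[OF ab XY] by (rule mult_right_mono) simp
    also have "a * X + b * Y = (real (Suc m) * k - real n * h)\<^sup>2 + real (Suc m) * k * (h - k)"
    proof -
      have "real n = real n' + 1" "real (Suc m) = real m + 1"
        using Suc by auto
      then show ?thesis
        unfolding X_def Y_def b_def ah[symmetric] by algebra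
    qed
    finally show ?thesis .
  qed
qed

definition mesh :: "nat \<Rightarrow> real" where
  "mesh j = h0 / 2 ^ j"

definition steps :: "nat \<Rightarrow> real \<Rightarrow> nat" where
  "steps j t = nat \<lfloor>t / mesh j\<rfloor>"

definition euler :: "nat \<Rightarrow> real \<Rightarrow> 'a \<Rightarrow> 'a" where
  "euler j t x = (J (mesh j) ^^ steps j t) x"

definition Q :: "real \<Rightarrow> 'a \<Rightarrow> 'a" where
  "Q t x = lim (\<lambda>j. euler j t x)"

lemma mesh_pos: "0 < mesh j"
  using h0 by (simp add: mesh_def)

lemma mesh_antimono: "i \<le> j \<Longrightarrow> mesh j \<le> mesh i"
  unfolding mesh_def by (intro divide_left_mono power_increasing) (use h0 in auto)

lemma mesh_le: "mesh j \<le> h0"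
  using mesh_antimono[of 0 j] by (simp add: mesh_def)

lemma mesh_tendsto: "mesh \<longlonglongrightarrow> 0"
proof -
  have "(\<lambda>j. h0 * (1/2) ^ j) \<longlonglongrightarrow> h0 * 0"
    by (intro tendsto_intros LIMSEQ_power_zero) simp
  then show ?thesis
    by (simp add: mesh_def[abs_def] power_one_over)
qed

lemmas steps_le = grid_floor_bounds(1)[OF _ mesh_pos, folded steps_def]
  and steps_gt = grid_floor_bounds(2)[OF _ mesh_pos, folded steps_def]
  and steps_tendsto = grid_floor_tendsto[OF _ mesh_pos mesh_tendsto, folded steps_def]

lemma euler_pc: "pos_contraction (euler j t)"
  using pc_power[OF J_pc[OF mesh_pos mesh_le]] by (simp add: euler_def[abs_def])

lemma euler_cauchy:
  assumes G: "G x y" and t: "0 \<le> t" and ij: "i \<le> j"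
  shows "norm (euler j t x - euler i t x) \<le> sqrt ((mesh i)\<^sup>2 + t * mesh i) * norm y"
proof -
  have "norm (euler j t x - euler i t x)
      \<le> sqrt ((real (steps j t) * mesh j - real (steps i t) * mesh i)\<^sup>2
           + real (steps j t) * mesh j * (mesh i - mesh j)) * norm y"
    unfolding euler_def by (rule crandall_liggett[OF G mesh_pos mesh_antimono[OF ij] mesh_le])
  also have "\<dots> \<le> sqrt ((mesh i)\<^sup>2 + t * mesh i) * norm y"
  proof (intro mult_right_mono real_sqrt_le_mono add_mono norm_ge_zero)
    show "(real (steps j t) * mesh j - real (steps i t) * mesh i)\<^sup>2 \<le> (mesh i)\<^sup>2"
      using steps_le[OF t, of j] steps_gt[OF t, of j] steps_le[OF t, of i] steps_gt[OF t, of i]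
        mesh_antimono[OF ij] mesh_pos[of i] by (intro abs_le_square_iff[THEN iffD1]) simp
    show "real (steps j t) * mesh j * (mesh i - mesh j) \<le> t * mesh i"
      using steps_le[OF t, of j] t mesh_antimono[OF ij] mesh_pos[of j] by (intro mult_mono) auto
  qed
  finally show ?thesis .
qed

text \<open>
  On the range of \<open>J h0\<close> the error between two step sizes is of the order of the square root of
  the coarser one; contractivity extends the convergence to the closure of that range.
\<close>

lemma euler_tendsto:
  assumes t: "0 \<le> t" and x: "x \<in> V"
  shows "(\<lambda>j. euler j t x) \<longlonglongrightarrow> Q t x"
proof -
  have "convergent (\<lambda>j. euler j t x)"
  proof (rule pc_convergent_on_dense[OF euler_pc _ J_dense _ x])
    show "J h0 ` V \<subseteq> V"
      using pc_V[OF J_pc[OF h0]] by auto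
    fix x assume "x \<in> J h0 ` V"
    then obtain y where G: "G x y"
      using G_dom by auto
    have "(\<lambda>i. sqrt ((mesh i)\<^sup>2 + t * mesh i) * norm y) \<longlonglongrightarrow> sqrt (0\<^sup>2 + t * 0) * norm y"
      by (intro tendsto_intros mesh_tendsto)
    then have lim: "(\<lambda>i. sqrt ((mesh i)\<^sup>2 + t * mesh i) * norm y) \<longlonglongrightarrow> 0"
      by simp
    have "Cauchy (\<lambda>j. euler j t x)"
    proof (rule CauchyI')
      fix e :: real assume "0 < e"
      then have "\<forall>\<^sub>F i in sequentially. sqrt ((mesh i)\<^sup>2 + t * mesh i) * norm y < e"
        by (rule order_tendstoD(2)[OF lim])
      then obtain N where N: "\<And>i. i \<ge> N \<Longrightarrow> sqrt ((mesh i)\<^sup>2 + t * mesh i) * norm y < e"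
        unfolding eventually_sequentially by blast
      have "dist (euler m t x) (euler n t x) < e" if "N \<le> m" "m < n" for m n
        using euler_cauchy[OF G t, of m n] N[OF that(1)] that(2)
        by (simp add: dist_norm norm_minus_commute)
      then show "\<exists>M. \<forall>m\<ge>M. \<forall>n>m. dist (euler m t x) (euler n t x) < e"
        by blast
    qed
    then show "convergent (\<lambda>j. euler j t x)"
      by (simp add: Cauchy_convergent_iff)
  qed
  then show ?thesis
    unfolding Q_def by (simp add: convergent_LIMSEQ_iff)
qed

lemma Q_pc: "0 \<le> t \<Longrightarrow> pos_contraction (Q t)"
  using pc_limit[OF euler_pc euler_tendsto] .

lemma Q_norm:
  assumes G: "G x y" and t: "0 \<le> t"
  shows "norm (Q t x - x) \<le> t * norm y"
proof (rule LIMSEQ_le_const2)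
  show "(\<lambda>j. norm (euler j t x - x)) \<longlonglongrightarrow> norm (Q t x - x)"
    by (intro tendsto_intros euler_tendsto t G_V[OF G])
  have "norm (euler j t x - x) \<le> t * norm y" for j
    using J_power_norm[OF G mesh_pos[of j] mesh_le, of "steps j t"] mult_right_mono[OF steps_le[OF t, of j] norm_ge_zero, of y]
    unfolding euler_def by linarith
  then show "\<exists>N. \<forall>j\<ge>N. norm (euler j t x - x) \<le> t * norm y"
    by blast
qed

lemma Q_add:
  assumes s: "0 \<le> s" and t: "0 \<le> t" and x: "x \<in> V"
  shows "Q (s + t) x = Q s (Q t x)"
proof (rule pc_eq_on_dense[OF _ _ _ J_dense _ x])
  show "pos_contraction (Q (s + t))"
    using s t by (intro Q_pc) simp
  show "pos_contraction (\<lambda>x. Q s (Q t x))"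
    by (rule pc_comp[OF Q_pc[OF s] Q_pc[OF t]])
  show "J h0 ` V \<subseteq> V"
    using pc_V[OF J_pc[OF h0]] by auto
  fix x assume "x \<in> J h0 ` V"
  then obtain y where G: "G x y"
    using G_dom by auto
  then have x: "x \<in> V"
    by (rule G_V)
  note QV = pc_V[OF Q_pc[OF t] x] and eV = pc_V[OF euler_pc x]
  have "(\<lambda>j. euler j s (euler j t x - Q t x)) \<longlonglongrightarrow> 0"
  proof (rule tendsto_0_le[where K = 1])
    show "(\<lambda>j. euler j t x - Q t x) \<longlonglongrightarrow> 0"
      by (intro LIM_zero euler_tendsto t x)
    show "\<forall>\<^sub>F j in sequentially. norm (euler j s (euler j t x - Q t x)) \<le> norm (euler j t x - Q t x) * 1"
      using pc_norm[OF euler_pc] QV eV by (intro always_eventually) auto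
  qed
  then have "(\<lambda>j. euler j s (euler j t x - Q t x) + euler j s (Q t x)) \<longlonglongrightarrow> 0 + Q s (Q t x)"
    by (intro tendsto_add euler_tendsto s QV)
  then have lim: "(\<lambda>j. euler j s (euler j t x)) \<longlonglongrightarrow> Q s (Q t x)"
    using QV eV by (simp add: pc_diff[OF euler_pc])
  have "(\<lambda>j. euler j (s + t) x - euler j s (euler j t x)) \<longlonglongrightarrow> 0"
  proof (rule tendsto_0_le[where K = "norm y"])
    show "mesh \<longlonglongrightarrow> 0"
      by (rule mesh_tendsto)
    have "norm (euler j (s + t) x - euler j s (euler j t x)) \<le> norm (mesh j) * norm y" for j
    proof -
      let ?n = "steps j s + steps j t"
      note Jp = J_pc[OF mesh_pos mesh_le, of j]
      \<comment> \<open>Rounding \<open>s\<close> and \<open>t\<close> separately loses at most one step, which moves \<open>x\<close> by \<open>O(mesh j)\<close>.\<close>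
      have "\<lfloor>s / mesh j\<rfloor> + \<lfloor>t / mesh j\<rfloor> \<le> \<lfloor>(s + t) / mesh j\<rfloor>"
        "\<lfloor>(s + t) / mesh j\<rfloor> \<le> \<lfloor>s / mesh j\<rfloor> + \<lfloor>t / mesh j\<rfloor> + 1"
        unfolding add_divide_distrib by linarith+
      moreover have "0 \<le> \<lfloor>s / mesh j\<rfloor>" "0 \<le> \<lfloor>t / mesh j\<rfloor>"
        using s t mesh_pos[of j] by auto
      ultimately have "steps j (s + t) = ?n \<or> steps j (s + t) = Suc ?n"
        unfolding steps_def by linarith
      moreover have "norm ((J (mesh j) ^^ Suc ?n) x - (J (mesh j) ^^ ?n) x) \<le> mesh j * norm y"
      proof -
        have "(J (mesh j) ^^ Suc ?n) x = (J (mesh j) ^^ ?n) (J (mesh j) x)"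
          by (simp only: funpow_Suc_right comp_apply)
        then have "norm ((J (mesh j) ^^ Suc ?n) x - (J (mesh j) ^^ ?n) x) \<le> norm (J (mesh j) x - x)"
          using pc_norm_diff[OF pc_power[OF Jp] pc_V[OF Jp x] x] by simp
        then show ?thesis
          using J_step_norm[OF G mesh_pos mesh_le, of j] by linarith
      qed
      ultimately show ?thesis
        using mesh_pos[of j] unfolding euler_def by (auto simp: funpow_add)
    qed
    then show "\<forall>\<^sub>F j in sequentially. norm (euler j (s + t) x - euler j s (euler j t x))
        \<le> norm (mesh j) * norm y"
      by simp
  qed
  from tendsto_add[OF this lim] have "(\<lambda>j. euler j (s + t) x) \<longlonglongrightarrow> Q s (Q t x)"
    by simp
  moreover have "(\<lambda>j. euler j (s + t) x) \<longlonglongrightarrow> Q (s + t) x"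
    by (intro euler_tendsto x) (use s t in simp)
  ultimately show "Q (s + t) x = Q s (Q t x)"
    by (rule LIMSEQ_unique[symmetric])
qed

lemma Q_semigroup: "pc_semigroup Q"
  unfolding pc_semigroup_def
proof (intro conjI ballI allI impI)
  fix x assume x: "x \<in> V"
  have "(\<lambda>j. euler j 0 x) = (\<lambda>j. x)"
    by (simp add: euler_def steps_def)
  then show "Q 0 x = x"
    using LIMSEQ_unique[OF euler_tendsto[OF order_refl x]] by simp
  show "((\<lambda>t. Q t x) \<longlongrightarrow> x) (at_right 0)"
  proof (rule tendstoI)
    fix e :: real assume e: "0 < e"
    then have e4: "0 < e / 4" by simp
    obtain z where z: "z \<in> J h0 ` V" "dist z x < e / 4"
      by (rule dense_approx[OF J_dense x e4])
    then obtain y where G: "G z y"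
      using G_dom by auto
    have "((\<lambda>t. t * norm y) \<longlongrightarrow> 0 * norm y) (at_right 0)"
      by (intro tendsto_intros)
    then have "\<forall>\<^sub>F t in at_right 0. t * norm y < e / 4"
      using e by (intro order_tendstoD(2)) auto
    moreover have "\<forall>\<^sub>F t in at_right 0. 0 < (t::real)"
      by (simp add: eventually_at_filter)
    ultimately show "\<forall>\<^sub>F t in at_right 0. dist (Q t x) x < e"
    proof eventually_elim
      case (elim t)
      then have t: "0 \<le> t" by simp
      have "dist (Q t x) (Q t z) \<le> dist x z"
        unfolding dist_norm by (intro pc_norm_diff Q_pc t x G_V[OF G])
      moreover have "dist (Q t z) z \<le> t * norm y"
        using Q_norm[OF G t] by (simp add: dist_norm)
      ultimately show ?case
        using elim z(2) e dist_triangle[of "Q t x" x "Q t z"] dist_triangle[of "Q t z" x z]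
          dist_commute[of x z] by linarith
    qed
  qed
qed (auto simp: Q_pc Q_add)

text \<open>
  The increment of step \<open>i\<close> is \<open>k J\<^sup>i\<^sup>+\<^sup>1 g\<close>.  Since \<open>g\<close> itself need not lie in the domain, \<open>J\<^sup>i g - g\<close> is
  estimated through an element \<open>z\<close> of the domain close to \<open>g\<close>.
\<close>

lemma J_power_taylor:
  assumes G: "G x g" and G': "G z w" and k: "0 < k" "k \<le> h0"
  shows "norm ((J k ^^ n) x - x - (real n * k) *\<^sub>R g)
    \<le> real n * k * (2 * norm (g - z) + real n * k * norm w)"
proof (induction n)
  case (Suc n)
  note Jp = J_pc[OF k] and gV = G_V(2)[OF G] and xV = G_V(1)[OF G] and zV = G_V(1)[OF G']
  let ?B = "2 * norm (g - z) + real (Suc n) * k * norm w"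
  have "norm ((J k ^^ Suc n) g - g) \<le> ?B"
  proof -
    have "(J k ^^ Suc n) g - g = (J k ^^ Suc n) g - (J k ^^ Suc n) z + ((J k ^^ Suc n) z - z) - (g - z)"
      by simp
    also have "norm \<dots> \<le> norm ((J k ^^ Suc n) g - (J k ^^ Suc n) z) + norm ((J k ^^ Suc n) z - z) + norm (g - z)"
      by (intro norm_triangle_le_diff add_right_mono norm_triangle_ineq)
    also have "\<dots> \<le> norm (g - z) + real (Suc n) * k * norm w + norm (g - z)"
      by (intro add_mono pc_norm_diff[OF pc_power[OF Jp] gV zV] J_power_norm[OF G' k] order_refl)
    finally show ?thesis by simp
  qed
  then have 1: "norm (k *\<^sub>R ((J k ^^ Suc n) g - g)) \<le> k * ?B"
    using k by simp
  have "(J k ^^ Suc n) x - (J k ^^ n) x = (J k ^^ n) (J k x - x)"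
    using pc_diff[OF pc_power[OF Jp, of n] pc_V[OF Jp xV] xV]
    by (simp only: funpow_Suc_right comp_apply)
  also have "\<dots> = k *\<^sub>R (J k ^^ n) (J k g)"
    unfolding J_step[OF G k] by (rule pc_scale[OF pc_power[OF Jp] pc_V[OF Jp gV]])
  also have "(J k ^^ n) (J k g) = (J k ^^ Suc n) g"
    by (simp only: funpow_Suc_right comp_apply)
  finally have "(J k ^^ Suc n) x - x - (real (Suc n) * k) *\<^sub>R g
      = ((J k ^^ n) x - x - (real n * k) *\<^sub>R g) + k *\<^sub>R ((J k ^^ Suc n) g - g)"
    by (simp add: algebra_simps)
  then have "norm ((J k ^^ Suc n) x - x - (real (Suc n) * k) *\<^sub>R g)
      \<le> real n * k * (2 * norm (g - z) + real n * k * norm w) + k * ?B"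
    using Suc 1 norm_triangle_le by (metis add_mono)
  also have "\<dots> \<le> real n * k * ?B + k * ?B"
    using k by (intro add_mono mult_left_mono mult_right_mono) auto
  finally show ?case
    by (simp add: algebra_simps)
qed simp

lemma Q_taylor:
  assumes G: "G x g" and G': "G z w" and t: "0 \<le> t"
  shows "norm (Q t x - x - t *\<^sub>R g) \<le> t * (2 * norm (g - z) + t * norm w)"
proof (rule LIMSEQ_le)
  show "(\<lambda>j. norm (euler j t x - x - (real (steps j t) * mesh j) *\<^sub>R g)) \<longlonglongrightarrow> norm (Q t x - x - t *\<^sub>R g)"
    by (intro tendsto_intros euler_tendsto steps_tendsto t G_V[OF G])
  show "(\<lambda>j. real (steps j t) * mesh j * (2 * norm (g - z) + real (steps j t) * mesh j * norm w))
      \<longlonglongrightarrow> t * (2 * norm (g - z) + t * norm w)"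
    by (intro tendsto_intros steps_tendsto t)
  show "\<exists>N. \<forall>j\<ge>N. norm (euler j t x - x - (real (steps j t) * mesh j) *\<^sub>R g)
      \<le> real (steps j t) * mesh j * (2 * norm (g - z) + real (steps j t) * mesh j * norm w)"
    unfolding euler_def using J_power_taylor[OF G G' mesh_pos mesh_le] by blast
qed

lemma G_imp_gen:
  assumes G: "G x g"
  shows "gen Q x g"
proof -
  note V = G_V[OF G]
  have "((\<lambda>t. (Q t x - x) /\<^sub>R t) \<longlongrightarrow> g) (at_right 0)"
  proof (rule tendstoI)
    fix e :: real assume e: "0 < e"
    then have e4: "0 < e / 4" by simp
    obtain z where z: "z \<in> J h0 ` V" "dist z g < e / 4"
      by (rule dense_approx[OF J_dense V(2) e4])
    then obtain w where G': "G z w"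
      using G_dom by auto
    have "((\<lambda>t. t * norm w) \<longlongrightarrow> 0 * norm w) (at_right 0)"
      by (intro tendsto_intros)
    then have "\<forall>\<^sub>F t in at_right 0. t * norm w < e / 2"
      using e by (intro order_tendstoD(2)) auto
    moreover have "\<forall>\<^sub>F t in at_right 0. 0 < (t::real)"
      by (simp add: eventually_at_filter)
    ultimately show "\<forall>\<^sub>F t in at_right 0. dist ((Q t x - x) /\<^sub>R t) g < e"
    proof eventually_elim
      case (elim t)
      have "(Q t x - x) /\<^sub>R t - g = (Q t x - x - t *\<^sub>R g) /\<^sub>R t"
        using elim by (simp add: scaleR_diff_right)
      then have "norm ((Q t x - x) /\<^sub>R t - g) = norm (Q t x - x - t *\<^sub>R g) / t"
        using elim(2) by (simp only: norm_scaleR abs_inverse abs_of_pos divide_inverse_commute)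
      also have "\<dots> \<le> 2 * norm (g - z) + t * norm w"
        using Q_taylor[OF G G', of t] elim by (simp add: divide_le_eq mult.commute)
      finally show ?case
        using elim z(2) by (simp add: dist_norm norm_minus_commute)
    qed
  qed
  then show ?thesis
    using V by (simp add: gen_def)
qed

lemma hille_yosida: "v \<in> V \<Longrightarrow> gen Q (J h0 v) ((J h0 v - v) /\<^sub>R h0)"
  by (rule G_imp_gen) (auto simp: G_def)

end

section \<open>The Kato-Voigt perturbation\<close>

text \<open>
  The unperturbed generator \<open>A\<close> enters through its graph \<open>gen S\<close>; \<open>B_mass\<close> is condition (G3).
\<close>

locale kato_perturbation = al_space +
  fixes S :: "real \<Rightarrow> 'a \<Rightarrow> 'a" and B :: "'a \<Rightarrow> 'a"
  assumes S: "pc_semigroup S"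
    and B_V: "gen S x y \<Longrightarrow> B x \<in> V"
    and B_add: "gen S x y \<Longrightarrow> gen S x' y' \<Longrightarrow> B (x + x') = B x + B x'"
    and B_scale: "gen S x y \<Longrightarrow> B (c *\<^sub>R x) = c *\<^sub>R B x"
    and B_cone: "gen S x y \<Longrightarrow> x \<in> cone \<Longrightarrow> B x \<in> cone"
    and B_mass: "gen S x y \<Longrightarrow> x \<in> cone \<Longrightarrow> mass y + mass (B x) = 0"
begin

abbreviation R :: "real \<Rightarrow> 'a \<Rightarrow> 'a" where
  "R \<equiv> res S"

definition K :: "real \<Rightarrow> 'a \<Rightarrow> 'a" where
  "K l v = B (R l v)"

lemmas R_gen = res_gen[OF S] and R_V = res_V[OF S] and R_cone = res_cone[OF S]
  and R_add = res_add[OF S] and R_scale = res_scale[OF S] and R_diff = res_diff[OF S]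

lemma K_mass_cone:
  assumes "0 < l" "v \<in> cone"
  shows "mass (K l v) = mass v - l * mass (R l v)"
  using B_mass[OF R_gen[OF assms(1) cone_V[OF assms(2)]] R_cone[OF assms]]
  unfolding K_def mass_diff mass_scale by linarith

lemma K_pc:
  assumes l: "0 < l"
  shows "pos_contraction (K l)"
proof (rule pos_contractionI)
  fix x y assume "x \<in> V" "y \<in> V"
  then show "K l (x + y) = K l x + K l y"
    using B_add[OF R_gen R_gen] l by (simp add: K_def R_add)
next
  fix c x assume "x \<in> V"
  then show "K l (c *\<^sub>R x) = c *\<^sub>R K l x"
    using B_scale[OF R_gen] l by (simp add: K_def R_scale)
next
  fix x assume x: "x \<in> cone"
  then show "K l x \<in> cone"
    using B_cone[OF R_gen R_cone] l cone_V by (simp add: K_def)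
  show "mass (K l x) \<le> mass x"
    using K_mass_cone[OF l x] cone_nonneg[OF R_cone[OF l x]] l by simp
qed

lemma K_power_V: "0 < l \<Longrightarrow> v \<in> V \<Longrightarrow> (K l ^^ n) v \<in> V"
  and K_power_cone: "0 < l \<Longrightarrow> v \<in> cone \<Longrightarrow> (K l ^^ n) v \<in> cone"
  using pc_V[OF pc_power[OF K_pc]] pc_cone[OF pc_power[OF K_pc]] by auto

lemma K_mass:
  assumes l: "0 < l" and v: "v \<in> V"
  shows "mass (K l v) = mass v - l * mass (R l v)"
proof -
  obtain p q where pq: "p \<in> cone" "q \<in> cone" "v = p - q"
    using cone_decomposition[OF v] by blast
  then show ?thesis
    unfolding pq(3) using K_mass_cone[OF l pq(1)] K_mass_cone[OF l pq(2)] l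
    by (simp add: pc_diff[OF K_pc] R_diff cone_V mass_diff right_diff_distrib)
qed

definition partial_res :: "real \<Rightarrow> nat \<Rightarrow> 'a \<Rightarrow> 'a" where
  "partial_res l N v = (\<Sum>n<N. R l ((K l ^^ n) v))"

text \<open>
  The resolvent of the minimal semigroup.
\<close>

definition Rinf :: "real \<Rightarrow> 'a \<Rightarrow> 'a" where
  "Rinf l v = (\<Sum>n. R l ((K l ^^ n) v))"

lemma partial_res_mass:
  assumes l: "0 < l" and v: "v \<in> V"
  shows "l * mass (partial_res l N v) = mass v - mass ((K l ^^ N) v)"
proof (induction N)
  case (Suc N)
  then show ?case
    using K_mass[OF l K_power_V[OF l v, of N]] by (simp add: partial_res_def mass_add distrib_left)
qed (simp add: partial_res_def)

lemma B_sum: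
  assumes "finite I" "\<And>i. i \<in> I \<Longrightarrow> gen S (f i) (g i)"
  shows "B (sum f I) = (\<Sum>i\<in>I. B (f i))"
  using assms
proof (induction I)
  case empty
  show ?case
    using B_scale[OF gen_0[OF S], of 0] by simp
next
  case (insert i I)
  then show ?case
    using B_add[of "f i" "g i" "sum f I" "sum g I"] gen_sum[OF S, of I f g] by simp
qed

text \<open>
  The partial sums solve the perturbed resolvent equation up to the remainder \<open>K\<^sup>N v\<close>: applying
  \<open>l - A - B\<close> to the \<open>n\<close>-th term gives \<open>K\<^sup>n v - K\<^sup>n\<^sup>+\<^sup>1 v\<close>, and the sum telescopes.
\<close>

lemma partial_res_gen:
  assumes l: "0 < l" and v: "v \<in> V"
  shows "\<exists>y. gen S (partial_res l N v) y \<and>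
    l *\<^sub>R partial_res l N v - y - B (partial_res l N v) = v - (K l ^^ N) v"
proof (intro exI conjI)
  let ?y = "\<Sum>n<N. l *\<^sub>R R l ((K l ^^ n) v) - (K l ^^ n) v"
  note g = R_gen[OF l K_power_V[OF l v]]
  show "gen S (partial_res l N v) ?y"
    unfolding partial_res_def by (intro gen_sum S g)
  have "B (partial_res l N v) = (\<Sum>n<N. (K l ^^ Suc n) v)"
    unfolding partial_res_def using B_sum[OF _ g, of "{..<N}" "\<lambda>n. n"] by (simp add: K_def)
  then have "l *\<^sub>R partial_res l N v - ?y - B (partial_res l N v)
      = (\<Sum>n<N. (K l ^^ n) v - (K l ^^ Suc n) v)"
    by (simp add: partial_res_def scaleR_sum_right sum_subtractf)
  also have "\<dots> = v - (K l ^^ N) v"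
    using sum_lessThan_telescope'[of "\<lambda>n. (K l ^^ n) v" N] by simp
  finally show "l *\<^sub>R partial_res l N v - ?y - B (partial_res l N v) = v - (K l ^^ N) v" .
qed

text \<open>
  For nonnegative \<open>v\<close> the norms of the terms are their masses, and the mass balance bounds every partial
  sum of them by \<open>mass v / l\<close>.
\<close>

lemma summable_res_cone:
  assumes l: "0 < l" and v: "v \<in> cone"
  shows "summable (\<lambda>n. norm (R l ((K l ^^ n) v)))"
proof (rule bounded_imp_summable)
  fix N
  have "(\<Sum>n\<le>N. norm (R l ((K l ^^ n) v))) = mass (partial_res l (Suc N) v)"
    unfolding partial_res_def mass_sum lessThan_Suc_atMost
    by (intro sum.cong refl cone_norm R_cone K_power_cone l v)
  also have "\<dots> \<le> mass v / l"
    using partial_res_mass[OF l cone_V[OF v], of "Suc N"] cone_nonneg[OF K_power_cone[OF l v, of "Suc N"]] l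
    by (simp add: pos_le_divide_eq mult.commute)
  finally show "(\<Sum>n\<le>N. norm (R l ((K l ^^ n) v))) \<le> mass v / l" .
qed simp

lemma summable_res:
  assumes l: "0 < l" and v: "v \<in> V"
  shows "summable (\<lambda>n. R l ((K l ^^ n) v))"
proof -
  obtain p q where pq: "p \<in> cone" "q \<in> cone" "v = p - q"
    using cone_decomposition[OF v] by blast
  have "R l ((K l ^^ n) v) = R l ((K l ^^ n) p) - R l ((K l ^^ n) q)" for n
    using pq l by (simp add: pc_diff[OF pc_power[OF K_pc]] R_diff K_power_V cone_V)
  then show ?thesis
    using summable_diff[OF summable_norm_cancel summable_norm_cancel, OF summable_res_cone summable_res_cone]
      pq l by simp
qed

lemma Rinf_tendsto: "0 < l \<Longrightarrow> v \<in> V \<Longrightarrow> (\<lambda>N. partial_res l N v) \<longlonglongrightarrow> Rinf l v"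
  unfolding partial_res_def Rinf_def using summable_LIMSEQ[OF summable_res] .

lemma partial_res_V: "0 < l \<Longrightarrow> v \<in> V \<Longrightarrow> partial_res l N v \<in> V"
  and partial_res_cone: "0 < l \<Longrightarrow> v \<in> cone \<Longrightarrow> partial_res l N v \<in> cone"
  unfolding partial_res_def by (auto intro!: V_sum cone_sum R_V R_cone K_power_V K_power_cone)

lemma Rinf_mass:
  assumes l: "0 < l" and v: "v \<in> V"
  shows "(\<lambda>N. mass ((K l ^^ N) v)) \<longlonglongrightarrow> mass v - l * mass (Rinf l v)"
proof -
  have "(\<lambda>N. mass v - l * mass (partial_res l N v)) \<longlonglongrightarrow> mass v - l * mass (Rinf l v)"
    by (intro tendsto_intros tendsto_mass Rinf_tendsto l v)
  then show ?thesis
    using partial_res_mass[OF l v] by simp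
qed

lemma Rinf_pc:
  assumes l: "0 < l"
  shows "pos_contraction (\<lambda>v. l *\<^sub>R Rinf l v)"
proof (rule pos_contractionI)
  fix x y assume xy: "x \<in> V" "y \<in> V"
  have "Rinf l (x + y) = Rinf l x + Rinf l y"
    unfolding Rinf_def suminf_add[OF summable_res[OF l xy(1)] summable_res[OF l xy(2)]]
    using xy l by (simp add: pc_add[OF pc_power[OF K_pc]] R_add K_power_V)
  then show "l *\<^sub>R Rinf l (x + y) = l *\<^sub>R Rinf l x + l *\<^sub>R Rinf l y"
    by (simp add: scaleR_add_right)
next
  fix c x assume x: "x \<in> V"
  have "Rinf l (c *\<^sub>R x) = c *\<^sub>R Rinf l x"
    unfolding Rinf_def suminf_scaleR_right[OF summable_res[OF l x]]
    using x l by (simp add: pc_scale[OF pc_power[OF K_pc]] R_scale K_power_V)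
  then show "l *\<^sub>R Rinf l (c *\<^sub>R x) = c *\<^sub>R l *\<^sub>R Rinf l x"
    by simp
next
  fix x assume x: "x \<in> cone"
  have "Rinf l x \<in> cone"
    by (rule cone_limit[OF Rinf_tendsto[OF l cone_V[OF x]]]) (use partial_res_cone[OF l x] in auto)
  then show "l *\<^sub>R Rinf l x \<in> cone"
    using l by (simp add: cone_scale)
  have "0 \<le> mass x - l * mass (Rinf l x)"
    by (rule LIMSEQ_le_const[OF Rinf_mass[OF l cone_V[OF x]]])
      (use cone_nonneg[OF K_power_cone[OF l x]] in auto)
  then show "mass (l *\<^sub>R Rinf l x) \<le> mass x"
    by (simp add: mass_scale)
qed

lemma Rinf_V: "0 < l \<Longrightarrow> v \<in> V \<Longrightarrow> Rinf l v \<in> V"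
  using pc_V[OF Rinf_pc, THEN V_scale, of l v "inverse l"] by simp

lemma Rinf_cone: "0 < l \<Longrightarrow> v \<in> cone \<Longrightarrow> Rinf l v \<in> cone"
  using cone_scale[OF pc_cone[OF Rinf_pc], of l v "inverse l"] by simp

lemma Rinf_diff: "0 < l \<Longrightarrow> x \<in> V \<Longrightarrow> y \<in> V \<Longrightarrow> Rinf l (x - y) = Rinf l x - Rinf l y"
  using pc_diff[OF Rinf_pc, of l x y] by (simp flip: scaleR_diff_right)

lemma Rinf_scale: "0 < l \<Longrightarrow> x \<in> V \<Longrightarrow> Rinf l (c *\<^sub>R x) = c *\<^sub>R Rinf l x"
  using pc_scale[OF Rinf_pc, of l x c] scaleR_cancel_left[of l "Rinf l (c *\<^sub>R x)" "c *\<^sub>R Rinf l x"]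
  by (simp add: mult.commute)

lemma Rinf_continuous:
  assumes l: "0 < l" and f: "(f \<longlongrightarrow> x) F" "\<And>i. f i \<in> V" "x \<in> V"
  shows "((\<lambda>i. Rinf l (f i)) \<longlongrightarrow> Rinf l x) F"
  using tendsto_scaleR[OF tendsto_const pc_tendsto[OF Rinf_pc[OF l] f], of "inverse l"] l by simp

text \<open>
  Left inverse property on the domain of the unperturbed generator, where the argument has the form
  \<open>v - K v\<close>: the series telescopes because its terms tend to \<open>0\<close>.
\<close>

lemma Rinf_of_gen:
  assumes l: "0 < l" and g: "gen S x y"
  shows "Rinf l (l *\<^sub>R x - y - B x) = x"
proof -
  define v where "v = l *\<^sub>R x - y"
  have v: "v \<in> V" and Kv: "K l v = B x" and Rv: "R l v = x"
    using res_of_gen[OF S l g] gen_V[OF g] by (auto simp: v_def K_def)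
  have "R l ((K l ^^ n) (v - K l v)) = R l ((K l ^^ n) v) - R l ((K l ^^ Suc n) v)" for n
    using v l pc_V[OF K_pc[OF l] v]
    by (simp add: pc_diff[OF pc_power[OF K_pc]] R_diff K_power_V funpow_swap1)
  moreover have "(\<lambda>n. R l ((K l ^^ n) v) - R l ((K l ^^ Suc n) v)) sums (R l ((K l ^^ 0) v) - 0)"
    by (rule telescope_sums') (rule summable_LIMSEQ_zero[OF summable_res[OF l v]])
  ultimately show ?thesis
    unfolding Rinf_def v_def[symmetric] Kv[symmetric] using Rv by (simp add: sums_iff)
qed

lemma R_resolvent_identity:
  assumes l: "0 < l" and m: "0 < m" and v: "v \<in> V"
  shows "R l v = R m (v + (m - l) *\<^sub>R R l v)"
proof (rule res_eqI[OF S m, symmetric])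
  show "gen S (R l v) (m *\<^sub>R R l v - (v + (m - l) *\<^sub>R R l v))"
    using R_gen[OF l v] by (simp add: algebra_simps)
qed

lemma R_antimono:
  assumes l: "0 < l" "l \<le> m" and v: "v \<in> cone"
  shows "R l v - R m v \<in> cone" "K l v - K m v \<in> cone"
proof -
  have m: "0 < m" using l by simp
  note V = cone_V[OF v]
  have "R l v = R m v + (m - l) *\<^sub>R R m (R l v)"
    using R_resolvent_identity[OF l(1) m V] R_V[OF l(1) V] V m by (simp add: R_add R_scale)
  then have "R l v - R m v = (m - l) *\<^sub>R R m (R l v)"
    by (metis add_diff_cancel_left')
  then show c: "R l v - R m v \<in> cone"
    using l(2) R_cone[OF m R_cone[OF l(1) v]] by (simp add: cone_scale)
  have "K l v - K m v = B (R l v - R m v)"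
    using B_add[OF R_gen[OF l(1) V] gen_scale[OF S R_gen[OF m V], of "-1"]]
      B_scale[OF R_gen[OF m V], of "-1"] by (simp add: K_def)
  then show "K l v - K m v \<in> cone"
    using B_cone[OF gen_diff[OF S R_gen[OF l(1) V] R_gen[OF m V]] c] by simp
qed

lemma K_power_antimono:
  assumes l: "0 < l" "l \<le> m" and v: "v \<in> cone"
  shows "(K l ^^ n) v - (K m ^^ n) v \<in> cone"
proof (induction n)
  case (Suc n)
  have m: "0 < m" using l by simp
  let ?a = "(K l ^^ n) v" and ?b = "(K m ^^ n) v"
  have ab: "?a \<in> V" "?b \<in> V" "?b \<in> cone"
    using K_power_V[OF l(1)] K_power_V[OF m] K_power_cone[OF m v] cone_V[OF v] by auto
  have "K l ?a - K m ?b = K l (?a - ?b) + (K l ?b - K m ?b)"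
    using ab by (simp add: pc_diff[OF K_pc[OF l(1)]])
  then show ?case
    using cone_add[OF pc_cone[OF K_pc[OF l(1)] Suc] R_antimono(2)[OF l ab(3)]]
    by (simp only: funpow.simps comp_apply)
qed simp

lemma Rinf_antimono:
  assumes l: "0 < l" "l \<le> m" and v: "v \<in> cone"
  shows "Rinf l v - Rinf m v \<in> cone"
proof (rule cone_limit)
  have m: "0 < m" using l by simp
  show "(\<lambda>N. partial_res l N v - partial_res m N v) \<longlonglongrightarrow> Rinf l v - Rinf m v"
    by (intro tendsto_diff Rinf_tendsto l m cone_V v)
  fix N
  have "R l ((K l ^^ n) v) - R m ((K m ^^ n) v) \<in> cone" for n
  proof -
    let ?a = "(K l ^^ n) v" and ?b = "(K m ^^ n) v"
    have ab: "?a \<in> V" "?b \<in> V" "?b \<in> cone"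
      using K_power_V[OF l(1)] K_power_V[OF m] K_power_cone[OF m v] cone_V[OF v] by auto
    have "R l ?a - R m ?b = R l (?a - ?b) + (R l ?b - R m ?b)"
      using ab l by (simp add: R_diff)
    then show ?thesis
      using cone_add[OF R_cone[OF l(1) K_power_antimono[OF l v]] R_antimono(1)[OF l ab(3)]]
      by (simp only:)
  qed
  then show "partial_res l N v - partial_res m N v \<in> cone"
    unfolding partial_res_def sum_subtractf[symmetric] by (intro cone_sum)
qed simp

text \<open>
  For \<open>m = l\<close> this is a tail of the convergent series that defines \<open>Rinf l v\<close>.  Monotonicity in the
  parameter reduces the case \<open>m \<ge> l\<close> to it, although \<open>K\<^sup>N v\<close> itself need not tend to \<open>0\<close>.
\<close>

lemma Rinf_K_power_tendsto_0:
  assumes l: "0 < l" "l \<le> m" and v: "v \<in> V"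
  shows "(\<lambda>N. Rinf m ((K l ^^ N) v)) \<longlonglongrightarrow> 0"
proof -
  have m: "0 < m" using l by simp
  have *: "(\<lambda>N. Rinf m ((K l ^^ N) p)) \<longlonglongrightarrow> 0" if p: "p \<in> cone" for p
  proof (rule tendsto_0_le[where K = 1])
    have eq: "Rinf l ((K l ^^ N) p) = Rinf l p - partial_res l N p" for N
      unfolding Rinf_def partial_res_def
      using suminf_split_initial_segment[OF summable_res[OF l(1) cone_V[OF p]], of N]
      by (simp add: funpow_add)
    have "(\<lambda>N. Rinf l p - partial_res l N p) \<longlonglongrightarrow> Rinf l p - Rinf l p"
      by (intro tendsto_intros Rinf_tendsto l cone_V p)
    then show "(\<lambda>N. Rinf l ((K l ^^ N) p)) \<longlonglongrightarrow> 0"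
      unfolding eq by simp
    have "norm (Rinf m ((K l ^^ N) p)) \<le> norm (Rinf l ((K l ^^ N) p)) * 1" for N
      using cone_nonneg[OF Rinf_antimono[OF l K_power_cone[OF l(1) p, of N]]]
        cone_norm[OF Rinf_cone[OF l(1) K_power_cone[OF l(1) p, of N]]]
        cone_norm[OF Rinf_cone[OF m K_power_cone[OF l(1) p, of N]]] by (simp add: mass_diff)
    then show "\<forall>\<^sub>F N in sequentially. norm (Rinf m ((K l ^^ N) p)) \<le> norm (Rinf l ((K l ^^ N) p)) * 1"
      by simp
  qed
  obtain p q where pq: "p \<in> cone" "q \<in> cone" "v = p - q"
    using cone_decomposition[OF v] by blast
  have "Rinf m ((K l ^^ N) v) = Rinf m ((K l ^^ N) p) - Rinf m ((K l ^^ N) q)" for N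
    using pq l m by (simp add: pc_diff[OF pc_power[OF K_pc]] Rinf_diff K_power_V cone_V)
  then show ?thesis
    using tendsto_diff[OF *[OF pq(1)] *[OF pq(2)]] by simp
qed

text \<open>
  Applying \<open>Rinf m\<close>, a left inverse of \<open>m - A - B\<close>, to the equation for the partial sums at \<open>l\<close> gives
  the identity with the error \<open>Rinf m (K\<^sup>N v)\<close>.
\<close>

lemma Rinf_resolvent_identity:
  assumes l: "0 < l" "l \<le> m" and v: "v \<in> V"
  shows "Rinf l v = Rinf m (v + (m - l) *\<^sub>R Rinf l v)"
proof (rule LIMSEQ_unique)
  have m: "0 < m" using l by simp
  show "(\<lambda>N. partial_res l N v) \<longlonglongrightarrow> Rinf l v"
    by (rule Rinf_tendsto[OF l(1) v])
  have eq: "partial_res l N v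
      = Rinf m (v + (m - l) *\<^sub>R partial_res l N v) - Rinf m ((K l ^^ N) v)" for N
  proof -
    let ?x = "partial_res l N v"
    obtain y where y: "gen S ?x y" "l *\<^sub>R ?x - y - B ?x = v - (K l ^^ N) v"
      using partial_res_gen[OF l(1) v] by blast
    have "?x = Rinf m (m *\<^sub>R ?x - y - B ?x)"
      using Rinf_of_gen[OF m y(1)] by simp
    also have "m *\<^sub>R ?x - y - B ?x = (l *\<^sub>R ?x - y - B ?x) + (m - l) *\<^sub>R ?x"
      by (simp add: algebra_simps)
    also have "\<dots> = (v + (m - l) *\<^sub>R ?x) - (K l ^^ N) v"
      unfolding y(2) by simp
    also have "Rinf m \<dots> = Rinf m (v + (m - l) *\<^sub>R ?x) - Rinf m ((K l ^^ N) v)"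
      by (rule Rinf_diff[OF m]) (use v partial_res_V[OF l(1) v] K_power_V[OF l(1) v] in auto)
    finally show ?thesis .
  qed
  have "(\<lambda>N. v + (m - l) *\<^sub>R partial_res l N v) \<longlonglongrightarrow> v + (m - l) *\<^sub>R Rinf l v"
    by (rule tendsto_add[OF tendsto_const tendsto_scaleR[OF tendsto_const Rinf_tendsto[OF l(1) v]]])
  then have "(\<lambda>N. Rinf m (v + (m - l) *\<^sub>R partial_res l N v)) \<longlonglongrightarrow> Rinf m (v + (m - l) *\<^sub>R Rinf l v)"
    by (rule Rinf_continuous[OF m]) (use v partial_res_V[OF l(1) v] Rinf_V[OF l(1) v] in auto)
  from tendsto_diff[OF this Rinf_K_power_tendsto_0[OF l v]]
  have "(\<lambda>N. Rinf m (v + (m - l) *\<^sub>R partial_res l N v) - Rinf m ((K l ^^ N) v))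
      \<longlonglongrightarrow> Rinf m (v + (m - l) *\<^sub>R Rinf l v) - 0" .
  then show "(\<lambda>N. partial_res l N v) \<longlonglongrightarrow> Rinf m (v + (m - l) *\<^sub>R Rinf l v)"
    unfolding eq[symmetric] by simp
qed

definition extends_perturbed :: "(real \<Rightarrow> 'a \<Rightarrow> 'a) \<Rightarrow> bool" where
  "extends_perturbed P \<longleftrightarrow> (\<forall>x y. gen S x y \<longrightarrow> gen P x (y + B x))"

text \<open>
  The family \<open>J h = Rinf (1 / h) / h\<close> with \<open>h \<le> 1 / l\<close> is a resolvent family.  The range of \<open>Rinf l\<close> is
  dense since it contains the domain of the unperturbed generator.
\<close>

lemma kato_semigroup_exists:
  assumes l: "0 < l"
  obtains Q where "pc_semigroup Q" "extends_perturbed Q"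
    "\<And>v. v \<in> V \<Longrightarrow> gen Q (Rinf l v) (l *\<^sub>R Rinf l v - v)"
proof -
  let ?J = "\<lambda>h x. inverse h *\<^sub>R Rinf (inverse h) x" and ?h = "inverse l"
  interpret J: resolvent_family V mass ?J ?h
  proof
    show "0 < ?h"
      using l by simp
    show "pos_contraction (?J h)" if "0 < h" for h
      using Rinf_pc[of "inverse h"] that by simp
    show "?J h x = ?J k ((k / h) *\<^sub>R x + (1 - k / h) *\<^sub>R ?J h x)"
      if k: "0 < k" "k \<le> h" and x: "x \<in> V" for k h x
    proof -
      have h: "0 < h" using k by simp
      let ?l = "inverse h" and ?m = "inverse k"
      have lm: "0 < ?l" "?l \<le> ?m"
        using h k by (auto intro: le_imp_inverse_le)
      have "(k / h) *\<^sub>R x + (1 - k / h) *\<^sub>R ?J h x = (k / h) *\<^sub>R (x + (?m - ?l) *\<^sub>R Rinf ?l x)"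
        using h k(1) by (simp add: field_simps scaleR_add_right)
      moreover have "x + (?m - ?l) *\<^sub>R Rinf ?l x \<in> V"
        using x Rinf_V[OF lm(1) x] by auto
      ultimately have "?J k ((k / h) *\<^sub>R x + (1 - k / h) *\<^sub>R ?J h x) = (?m * (k / h)) *\<^sub>R Rinf ?l x"
        using Rinf_resolvent_identity[OF lm x] k(1) by (simp add: Rinf_scale)
      then show ?thesis
        using k(1) h by (simp add: field_simps)
    qed
    have "{x. \<exists>y. gen S x y} \<subseteq> ?J ?h ` V"
    proof
      fix x assume "x \<in> {x. \<exists>y. gen S x y}"
      then obtain y where g: "gen S x y"
        by auto
      let ?v = "l *\<^sub>R x - y - B x"
      have v: "?v \<in> V"
        using gen_V[OF g] B_V[OF g] by auto
      have "?J ?h (?h *\<^sub>R ?v) = x"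
        using Rinf_of_gen[OF l g] v l by (simp add: Rinf_scale)
      then show "x \<in> ?J ?h ` V"
        using v by (metis V_scale image_eqI)
    qed
    then show "V \<subseteq> closure (?J ?h ` V)"
      using dom_dense[OF S] closure_mono by blast
  qed
  have gen: "gen J.Q (Rinf l v) (l *\<^sub>R Rinf l v - v)" if v: "v \<in> V" for v
  proof -
    have "?J ?h (?h *\<^sub>R v) = Rinf l v"
      using v l by (simp add: Rinf_scale)
    then show ?thesis
      using J.hille_yosida[OF V_scale[OF v, of ?h]] l by (simp add: scaleR_diff_right)
  qed
  have "extends_perturbed J.Q"
    unfolding extends_perturbed_def
  proof (intro allI impI)
    fix x y assume g: "gen S x y"
    show "gen J.Q x (y + B x)"
      using gen[of "l *\<^sub>R x - y - B x"] Rinf_of_gen[OF l g] gen_V[OF g] B_V[OF g]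
      by (simp add: add.commute)
  qed
  then show thesis
    using that J.Q_semigroup gen by blast
qed

lemma K_power_tendsto_0_on_V:
  assumes l: "0 < l" and cone: "\<And>v. v \<in> cone \<Longrightarrow> (\<lambda>n. mass ((K l ^^ n) v)) \<longlonglongrightarrow> 0" and v: "v \<in> V"
  shows "(\<lambda>n. (K l ^^ n) v) \<longlonglongrightarrow> 0"
proof -
  have *: "(\<lambda>n. (K l ^^ n) p) \<longlonglongrightarrow> 0" if p: "p \<in> cone" for p
    using cone[OF p] by (subst tendsto_norm_zero_iff[symmetric]) (simp add: cone_norm[OF K_power_cone[OF l p]])
  obtain p q where pq: "p \<in> cone" "q \<in> cone" "v = p - q"
    using cone_decomposition[OF v] by blast
  then show ?thesis
    using tendsto_diff[OF *[OF pq(1)] *[OF pq(2)]] l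
    by (simp add: pc_diff[OF pc_power[OF K_pc]] cone_V)
qed

text \<open>
  If the powers vanish, dissipativity of the generator of \<open>P\<close> turns the equation for the partial sums
  into their convergence to the resolvent of \<open>P\<close>.  In the other direction minimality enters: a
  conservative \<open>P\<close> dominated by the contraction semigroup \<open>Q\<close> coincides with \<open>Q\<close>, whose resolvent is
  \<open>Rinf l\<close>.
\<close>

theorem conservative_iff_K_power_tendsto_0:
  assumes P: "pc_semigroup P" and ext: "extends_perturbed P"
    and minimal: "\<And>Q t x. pc_semigroup Q \<Longrightarrow> extends_perturbed Q \<Longrightarrow> 0 \<le> t \<Longrightarrow> x \<in> cone \<Longrightarrow>
      Q t x - P t x \<in> cone"
    and l: "0 < l"
  shows "(\<forall>t\<ge>0. \<forall>x\<in>V. mass (P t x) = mass x) \<longleftrightarrow> (\<forall>v\<in>V. (\<lambda>n. (K l ^^ n) v) \<longlonglongrightarrow> 0)"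
proof
  assume vanish: "\<forall>v\<in>V. (\<lambda>n. (K l ^^ n) v) \<longlonglongrightarrow> 0"
  have "mass y = 0" if g: "gen P x y" for x y
  proof -
    define v where "v = l *\<^sub>R x - y"
    have v: "v \<in> V"
      using gen_V[OF g] by (auto simp: v_def)
    let ?x = "\<lambda>N. partial_res l N v"
    have "norm (?x N - x) \<le> norm ((K l ^^ N) v) * inverse l" for N
    proof -
      obtain y' where y': "gen S (?x N) y'" "l *\<^sub>R ?x N - y' - B (?x N) = v - (K l ^^ N) v"
        using partial_res_gen[OF l v] by blast
      have "gen P (?x N - x) (y' + B (?x N) - y)"
        using gen_diff[OF P _ g] ext y'(1) unfolding extends_perturbed_def by blast
      from gen_dissipative[OF P this l]
      have "l * norm (?x N - x) \<le> norm (l *\<^sub>R (?x N - x) - (y' + B (?x N) - y))" .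
      also have "l *\<^sub>R (?x N - x) - (y' + B (?x N) - y) = (l *\<^sub>R ?x N - y' - B (?x N)) - v"
        by (simp add: v_def algebra_simps)
      also have "\<dots> = - (K l ^^ N) v"
        unfolding y'(2) by simp
      finally show ?thesis
        using l by (simp add: field_simps)
    qed
    then have "\<forall>\<^sub>F N in sequentially. norm (?x N - x) \<le> norm ((K l ^^ N) v) * inverse l"
      by (intro always_eventually allI)
    then have "(\<lambda>N. ?x N - x) \<longlonglongrightarrow> 0"
      by (rule tendsto_0_le[OF bspec[OF vanish v]])
    then have "?x \<longlonglongrightarrow> x"
      by (rule LIM_zero_cancel)
    then have "Rinf l v = x"
      using LIMSEQ_unique Rinf_tendsto[OF l v] by blast
    moreover have "(\<lambda>N. mass ((K l ^^ N) v)) \<longlonglongrightarrow> 0"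
      using tendsto_mass[of "\<lambda>N. (K l ^^ N) v" 0] vanish v by simp
    ultimately have "mass v - l * mass x = 0"
      using LIMSEQ_unique Rinf_mass[OF l v] by blast
    then show ?thesis
      by (simp add: v_def mass_diff mass_scale)
  qed
  then show "\<forall>t\<ge>0. \<forall>x\<in>V. mass (P t x) = mass x"
    using conservative_if_gen[OF P dom_dense[OF P]] by blast
next
  assume cons: "\<forall>t\<ge>0. \<forall>x\<in>V. mass (P t x) = mass x"
  obtain Q where Q: "pc_semigroup Q" "extends_perturbed Q"
    and gen_Q: "\<And>v. v \<in> V \<Longrightarrow> gen Q (Rinf l v) (l *\<^sub>R Rinf l v - v)"
    using kato_semigroup_exists[OF l] by blast
  have "mass (Q t x) = mass x" if t: "0 \<le> t" and x: "x \<in> V" for t x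
  proof -
    have "Q t z = P t z" if z: "z \<in> cone" for z
    proof -
      have "norm (Q t z - P t z) = mass (Q t z) - mass z"
        using cone_norm[OF minimal[OF Q t z]] cons t cone_V[OF z] by (simp add: mass_diff)
      also have "\<dots> \<le> 0"
        using abs_mass_le[of "Q t z"] pc_norm[OF sg_pc[OF Q(1) t] cone_V[OF z]] cone_norm[OF z] by simp
      finally show ?thesis by simp
    qed
    then have "Q t x = P t x"
      using pc_eq_on_V[OF sg_pc[OF Q(1) t] sg_pc[OF P t]] x by blast
    then show ?thesis
      using cons t x by simp
  qed
  then have "mass (l *\<^sub>R Rinf l v - v) = 0" if "v \<in> V" for v
    using gen_if_conservative[OF _ gen_Q[OF that]] by blast
  then have "(\<lambda>n. mass ((K l ^^ n) v)) \<longlonglongrightarrow> 0" if "v \<in> V" for v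
    using Rinf_mass[OF l that] that by (simp add: mass_diff mass_scale)
  then show "\<forall>v\<in>V. (\<lambda>n. (K l ^^ n) v) \<longlonglongrightarrow> 0"
    using K_power_tendsto_0_on_V[OF l] cone_V by blast
qed

text \<open>
  By the mass balance a nonnegative fixed point loses no mass, so its resolvent has mass \<open>0\<close>.
\<close>

lemma K_fixed_point_eq_0:
  assumes l: "0 < l" and w: "w \<in> cone" "K l w = w"
  shows "w = 0"
proof -
  have "l * mass (R l w) = 0"
    using K_mass_cone[OF l w(1)] unfolding w(2) by linarith
  then have "R l w = 0"
    using cone_norm[OF R_cone[OF l w(1)]] l by simp
  then have "gen S 0 (- w)"
    using R_gen[OF l cone_V[OF w(1)]] by simp
  then show ?thesis
    using gen_unique[OF gen_0[OF S]] by force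
qed

end

section \<open>Mean ergodicity\<close>

lemma cesaro_tendsto_0:
  fixes a :: "nat \<Rightarrow> 'b::real_normed_vector"
  assumes a: "a \<longlonglongrightarrow> 0"
  shows "(\<lambda>N. (1 / real N) *\<^sub>R (\<Sum>n<N. a n)) \<longlonglongrightarrow> 0"
proof (rule tendstoI)
  fix e :: real assume e: "0 < e"
  then have e2: "0 < e / 2" by simp
  obtain N0 where N0: "\<And>n. n \<ge> N0 \<Longrightarrow> norm (a n) < e / 2"
    using tendstoD[OF a e2] by (auto simp: eventually_sequentially)
  define c where "c = (\<Sum>n<N0. norm (a n))"
  have "(\<lambda>N. c / real N) \<longlonglongrightarrow> 0"
    by (rule lim_const_over_n)
  then have "\<forall>\<^sub>F N in sequentially. c / real N < e / 2"
    using e2 by (rule order_tendstoD(2))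
  moreover have "\<forall>\<^sub>F N in sequentially. N \<ge> max 1 N0"
    by (rule eventually_ge_at_top)
  ultimately show "\<forall>\<^sub>F N in sequentially. dist ((1 / real N) *\<^sub>R (\<Sum>n<N. a n)) 0 < e"
  proof eventually_elim
    case (elim N)
    have "norm (\<Sum>n<N. a n) \<le> (\<Sum>n<N. norm (a n))"
      by (rule norm_sum)
    also have "\<dots> \<le> (\<Sum>n<N. (if n < N0 then norm (a n) else 0) + e / 2)"
      using N0 e2 by (intro sum_mono) (auto simp: not_less less_imp_le)
    also have "\<dots> = c + real N * (e / 2)"
    proof -
      have "(\<Sum>n<N. if n < N0 then norm (a n) else 0) = (\<Sum>n\<in>{n\<in>{..<N}. n < N0}. norm (a n))"
        by (rule sum.inter_filter[symmetric]) simp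
      also have "{n\<in>{..<N}. n < N0} = {..<N0}"
        using elim by auto
      finally show ?thesis
        by (simp add: sum.distrib c_def)
    qed
    finally have "norm (\<Sum>n<N. a n) / real N \<le> c / real N + e / 2"
      using elim by (simp add: field_simps)
    then have "norm (\<Sum>n<N. a n) / real N < e"
      using elim(1) by linarith
    then show ?case
      by (simp add: dist_norm)
  qed
qed

context kato_perturbation
begin

text \<open>
  The limit of the averages of a nonnegative element is a nonnegative fixed point, hence \<open>0\<close>; as the
  masses \<open>mass (K\<^sup>n v)\<close> decrease, each is bounded by the mass of the average before it.
\<close>

theorem mean_ergodic_iff_K_power_tendsto_0:
  assumes l: "0 < l"
  shows "(\<forall>v\<in>V. \<exists>w\<in>V. (\<lambda>N. (1 / real N) *\<^sub>R (\<Sum>n<N. (K l ^^ n) v)) \<longlonglongrightarrow> w)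
    \<longleftrightarrow> (\<forall>v\<in>V. (\<lambda>n. (K l ^^ n) v) \<longlonglongrightarrow> 0)"
proof
  assume "\<forall>v\<in>V. (\<lambda>n. (K l ^^ n) v) \<longlonglongrightarrow> 0"
  then show "\<forall>v\<in>V. \<exists>w\<in>V. (\<lambda>N. (1 / real N) *\<^sub>R (\<Sum>n<N. (K l ^^ n) v)) \<longlonglongrightarrow> w"
    using cesaro_tendsto_0 by blast
next
  assume erg: "\<forall>v\<in>V. \<exists>w\<in>V. (\<lambda>N. (1 / real N) *\<^sub>R (\<Sum>n<N. (K l ^^ n) v)) \<longlonglongrightarrow> w"
  have "(\<lambda>n. mass ((K l ^^ n) v)) \<longlonglongrightarrow> 0" if v: "v \<in> cone" for v
  proof -
    let ?M = "\<lambda>N. (1 / real N) *\<^sub>R (\<Sum>n<N. (K l ^^ n) v)"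
    obtain w where w: "w \<in> V" "?M \<longlonglongrightarrow> w"
      using erg cone_V[OF v] by blast
    have Kn: "(K l ^^ n) v \<in> cone" for n
      using K_power_cone[OF l v] .
    have Mc: "?M N \<in> cone" for N
      by (intro cone_scale cone_sum Kn) auto
    have wc: "w \<in> cone"
      by (rule cone_limit[OF w(2)]) (use Mc in auto)
    have "K l w = w"
    proof (rule LIMSEQ_unique)
      show "(\<lambda>N. K l (?M N)) \<longlonglongrightarrow> K l w"
        by (rule pc_tendsto[OF K_pc[OF l] w(2)]) (use Mc cone_V w in auto)
      have eq: "K l (?M N) = ?M N + (1 / real N) *\<^sub>R ((K l ^^ N) v - v)" for N
      proof -
        have "K l (?M N) = (1 / real N) *\<^sub>R (\<Sum>n<N. (K l ^^ Suc n) v)"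
          using Kn cone_V by (simp add: pc_scale[OF K_pc[OF l]] pc_sum[OF K_pc[OF l]] V_sum)
        also have "(\<Sum>n<N. (K l ^^ Suc n) v) = (\<Sum>n<N. (K l ^^ n) v) + ((K l ^^ N) v - v)"
          by (induction N) auto
        finally show ?thesis
          by (simp add: scaleR_add_right)
      qed
      have "(\<lambda>N. (1 / real N) *\<^sub>R ((K l ^^ N) v - v)) \<longlonglongrightarrow> 0"
      proof (rule tendsto_0_le[where K = 1])
        show "(\<lambda>N. (2 * norm v) / real N) \<longlonglongrightarrow> 0"
          by (rule lim_const_over_n)
        have "norm ((1 / real N) *\<^sub>R ((K l ^^ N) v - v)) \<le> norm (2 * norm v / real N) * 1" for N
          using norm_triangle_ineq4[of "(K l ^^ N) v" v] pc_norm[OF pc_power[OF K_pc[OF l]] cone_V[OF v], of N]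
          by (simp add: divide_right_mono)
        then show "\<forall>\<^sub>F N in sequentially.
            norm ((1 / real N) *\<^sub>R ((K l ^^ N) v - v)) \<le> norm (2 * norm v / real N) * 1"
          by simp
      qed
      from tendsto_add[OF w(2) this] show "(\<lambda>N. K l (?M N)) \<longlonglongrightarrow> w"
        unfolding eq by simp
    qed
    then have "w = 0"
      by (rule K_fixed_point_eq_0[OF l wc])
    then have lim: "(\<lambda>N. mass (?M N)) \<longlonglongrightarrow> 0"
      using tendsto_mass[OF w(2)] by simp
    have dec: "mass ((K l ^^ N) v) \<le> mass ((K l ^^ n) v)" if "n \<le> N" for n N
      using that
    proof (induction N rule: dec_induct)
      case (step N)
      then show ?case
        using pc_norm[OF K_pc[OF l] cone_V[OF Kn[of N]]] cone_norm[OF Kn[of N]] cone_norm[OF Kn[of "Suc N"]]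
        by simp
    qed simp
    show ?thesis
    proof (rule tendsto_sandwich[OF _ _ tendsto_const lim])
      show "\<forall>\<^sub>F N in sequentially. 0 \<le> mass ((K l ^^ N) v)"
        using cone_nonneg[OF Kn] by simp
      show "\<forall>\<^sub>F N in sequentially. mass ((K l ^^ N) v) \<le> mass (?M N)"
        using eventually_gt_at_top[of 0]
      proof eventually_elim
        case (elim N)
        have "real N * mass ((K l ^^ N) v) \<le> (\<Sum>n<N. mass ((K l ^^ n) v))"
          using sum_mono[of "{..<N}" "\<lambda>_. mass ((K l ^^ N) v)"] dec by simp
        then show ?case
          using elim by (simp add: mass_scale mass_sum field_simps)
      qed
    qed
  qed
  then show "\<forall>v\<in>V. (\<lambda>n. (K l ^^ n) v) \<longlonglongrightarrow> 0"
    using K_power_tendsto_0_on_V[OF l] by blast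
qed

end

section \<open>L1 as an AL-space\<close>

lemma L1_integrable [dest]: "u \<in> L1 M \<Longrightarrow> integrable M u"
  by (simp add: L1_def)

lemma L1_add [intro]: "u \<in> L1 M \<Longrightarrow> v \<in> L1 M \<Longrightarrow> (\<lambda>x. u x + v x) \<in> L1 M"
  and L1_diff [intro]: "u \<in> L1 M \<Longrightarrow> v \<in> L1 M \<Longrightarrow> (\<lambda>x. u x - v x) \<in> L1 M"
  and L1_scale [intro]: "u \<in> L1 M \<Longrightarrow> (\<lambda>x. c * u x) \<in> L1 M"
  and L1_0 [simp]: "(\<lambda>x. 0) \<in> L1 M"
  by (simp_all add: L1_def)

lemma L1_plus_L1: "u \<in> L1_plus M \<Longrightarrow> u \<in> L1 M"
  and L1_plus_AE: "u \<in> L1_plus M \<Longrightarrow> AE x in M. 0 \<le> u x"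
  by (auto simp: L1_plus_def)

lemma L1_norm_L1_plus: "u \<in> L1_plus M \<Longrightarrow> L1_norm M u = (LINT x|M. u x)"
  unfolding L1_norm_def by (rule integral_cong_AE) (auto simp: L1_plus_def L1_def)

text \<open>
  The integral of \<open>u\<close> over \<open>X\<close> minus that over the complement.  The supremum over \<open>X\<close> of its absolute
  value is the \<open>L\<^sup>1\<close> norm, attained where \<open>X\<close> is the set on which \<open>u\<close> is nonnegative.
  The value \<open>0\<close> at nonmeasurable \<open>X\<close> does not affect the supremum.
\<close>

definition signed_integral :: "'a measure \<Rightarrow> ('a \<Rightarrow> real) \<Rightarrow> 'a set \<Rightarrow> real" where
  "signed_integral M u X =
     (if X \<in> sets M then LINT x|M. (2 * indicator X x - 1) * u x else 0)"

text \<open>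
  The signed integrals of \<open>u\<close> form a bounded function on the power set, which is continuous once the
  power set carries the discrete topology.  Functions that agree almost everywhere have the same image.
\<close>

definition L1_emb :: "'a measure \<Rightarrow> ('a \<Rightarrow> real) \<Rightarrow> ('a set discrete \<Rightarrow>\<^sub>C real)" where
  "L1_emb M u = Bcontfun (\<lambda>X. signed_integral M u (of_discrete X))"

text \<open>
  At \<open>X = space M\<close> the signed integral is the integral.
\<close>

definition total_mass :: "'a measure \<Rightarrow> ('a set discrete \<Rightarrow>\<^sub>C real) \<Rightarrow> real" where
  "total_mass M w = apply_bcontfun w (discrete (space M))"

definition L1_image :: "'a measure \<Rightarrow> ('a set discrete \<Rightarrow>\<^sub>C real) set" where
  "L1_image M = L1_emb M ` L1 M"

lemma continuous_on_discrete: "continuous_on S (f :: 'a discrete \<Rightarrow> 'b::topological_space)"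
  unfolding continuous_on_open_invariant by (metis inf.idem inf_commute open_discrete vimage_Int vimage_UNIV inf_top_left)

lemma signed_integrable:
  assumes "u \<in> L1 M" "X \<in> sets M"
  shows "integrable M (\<lambda>x. (2 * indicator X x - 1) * u x)"
proof -
  have "integrable M (\<lambda>x. 2 * (indicator X x * u x) - u x)"
    using integrable_mult_indicator[OF assms(2), of u] assms(1) by (auto simp: L1_def)
  then show ?thesis
    by (simp add: algebra_simps)
qed

lemma signed_integral_le:
  assumes "u \<in> L1 M"
  shows "\<bar>signed_integral M u X\<bar> \<le> L1_norm M u"
proof (cases "X \<in> sets M")
  case True
  have "\<bar>LINT x|M. (2 * indicator X x - 1) * u x\<bar> \<le> (LINT x|M. \<bar>(2 * indicator X x - 1) * u x\<bar>)"
    by (rule integral_abs_bound)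
  also have "\<dots> = L1_norm M u"
    unfolding L1_norm_def by (intro Bochner_Integration.integral_cong) (auto simp: indicator_def)
  finally show ?thesis
    using True by (simp add: signed_integral_def)
qed (simp add: signed_integral_def L1_norm_def)

lemma apply_L1_emb:
  assumes "u \<in> L1 M"
  shows "apply_bcontfun (L1_emb M u) X = signed_integral M u (of_discrete X)"
  unfolding L1_emb_def
  by (subst Bcontfun_inverse)
    (auto intro!: bcontfun_normI continuous_on_discrete signed_integral_le[OF assms])

lemma L1_emb_add:
  assumes u: "u \<in> L1 M" and v: "v \<in> L1 M"
  shows "L1_emb M (\<lambda>x. u x + v x) = L1_emb M u + L1_emb M v"
proof (rule bcontfun_eqI)
  fix X :: "'a set discrete"
  show "apply_bcontfun (L1_emb M (\<lambda>x. u x + v x)) X = apply_bcontfun (L1_emb M u + L1_emb M v) X"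
    using u v signed_integrable[OF u, of "of_discrete X"] signed_integrable[OF v, of "of_discrete X"]
    by (simp add: apply_L1_emb L1_add plus_bcontfun.rep_eq signed_integral_def distrib_left)
qed

lemma L1_emb_scale:
  assumes u: "u \<in> L1 M"
  shows "L1_emb M (\<lambda>x. c * u x) = c *\<^sub>R L1_emb M u"
proof (rule bcontfun_eqI)
  fix X :: "'a set discrete"
  show "apply_bcontfun (L1_emb M (\<lambda>x. c * u x)) X = apply_bcontfun (c *\<^sub>R L1_emb M u) X"
    using u by (simp add: apply_L1_emb L1_scale scaleR_bcontfun.rep_eq signed_integral_def
        mult.left_commute[of _ c])
qed

lemma L1_emb_diff:
  assumes u: "u \<in> L1 M" and v: "v \<in> L1 M"
  shows "L1_emb M (\<lambda>x. u x - v x) = L1_emb M u - L1_emb M v"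
  using L1_emb_add[OF u L1_scale[OF v, of "-1"]] L1_emb_scale[OF v, of "-1"] by simp

lemma L1_emb_0: "L1_emb M (\<lambda>x. 0) = 0"
  using L1_emb_scale[OF L1_0, of M 0] by simp

lemma norm_L1_emb:
  assumes u: "u \<in> L1 M"
  shows "norm (L1_emb M u) = L1_norm M u"
proof (rule antisym)
  show "norm (L1_emb M u) \<le> L1_norm M u"
    using signed_integral_le[OF u] by (intro norm_bound) (auto simp: apply_L1_emb[OF u])
  have [measurable]: "u \<in> borel_measurable M"
    using u by auto
  let ?X = "{x \<in> space M. 0 \<le> u x}"
  have "L1_norm M u = signed_integral M u ?X"
    unfolding L1_norm_def signed_integral_def
    by (auto intro!: Bochner_Integration.integral_cong simp: indicator_def)
  also have "\<dots> = apply_bcontfun (L1_emb M u) (discrete ?X)"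
    by (simp add: apply_L1_emb[OF u] discrete_inverse)
  also have "\<dots> \<le> norm (L1_emb M u)"
    using norm_bounded[of "L1_emb M u" "discrete ?X"] by simp
  finally show "L1_norm M u \<le> norm (L1_emb M u)" .
qed

lemma total_mass_L1_emb:
  assumes u: "u \<in> L1 M"
  shows "total_mass M (L1_emb M u) = (LINT x|M. u x)"
  by (auto simp: total_mass_def apply_L1_emb[OF u] discrete_inverse signed_integral_def
      intro!: Bochner_Integration.integral_cong)

lemma L1_norm_eq_0_iff:
  assumes "u \<in> L1 M"
  shows "L1_norm M u = 0 \<longleftrightarrow> (AE x in M. u x = 0)"
  unfolding L1_norm_def using assms by (subst integral_nonneg_eq_0_iff_AE) auto

lemma L1_emb_eq_iff:
  assumes u: "u \<in> L1 M" and v: "v \<in> L1 M"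
  shows "L1_emb M u = L1_emb M v \<longleftrightarrow> (AE x in M. u x = v x)"
proof -
  have "L1_emb M u = L1_emb M v \<longleftrightarrow> norm (L1_emb M (\<lambda>x. u x - v x)) = 0"
    by (simp add: L1_emb_diff[OF u v])
  also have "\<dots> \<longleftrightarrow> (AE x in M. u x - v x = 0)"
    using u v by (simp only: norm_L1_emb L1_diff L1_norm_eq_0_iff)
  finally show ?thesis by simp
qed

lemma L1_plus_iff_total_mass:
  assumes u: "u \<in> L1 M"
  shows "u \<in> L1_plus M \<longleftrightarrow> total_mass M (L1_emb M u) = norm (L1_emb M u)"
proof -
  have "total_mass M (L1_emb M u) = norm (L1_emb M u) \<longleftrightarrow> (LINT x|M. \<bar>u x\<bar> - u x) = 0"
    using u by (auto simp: total_mass_L1_emb norm_L1_emb L1_norm_def)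
  also have "\<dots> \<longleftrightarrow> (AE x in M. \<bar>u x\<bar> - u x = 0)"
    using u by (intro integral_nonneg_eq_0_iff_AE) auto
  also have "\<dots> \<longleftrightarrow> (AE x in M. 0 \<le> u x)"
    by (intro AE_cong) auto
  finally show ?thesis
    using u by (simp add: L1_plus_def)
qed

text \<open>
  An \<open>L\<^sup>1\<close>-summable series converges absolutely almost everywhere, with integrable sum of absolute
  values; that sum dominates the partial sums.
\<close>

lemma L1_series_converges:
  fixes d :: "nat \<Rightarrow> 'a \<Rightarrow> real"
  assumes d: "\<And>k. d k \<in> L1 M" and sum: "summable (\<lambda>k. L1_norm M (d k))"
  shows "\<exists>s\<in>L1 M. (\<lambda>n. L1_emb M (\<lambda>x. \<Sum>k<n. d k x)) \<longlonglongrightarrow> L1_emb M s"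
proof -
  have [measurable]: "d k \<in> borel_measurable M" for k
    using d by auto
  have nn: "(\<integral>\<^sup>+x. ennreal \<bar>d k x\<bar> \<partial>M) = ennreal (L1_norm M (d k))" for k
    unfolding L1_norm_def using d by (intro nn_integral_eq_integral) auto
  have "(\<integral>\<^sup>+x. (\<Sum>k. ennreal \<bar>d k x\<bar>) \<partial>M) = (\<Sum>k. ennreal (L1_norm M (d k)))"
    by (simp add: nn_integral_suminf nn)
  also have "\<dots> \<noteq> top"
    by (rule ennreal_suminf_neq_top[OF sum]) (simp add: L1_norm_def)
  finally have "(\<integral>\<^sup>+x. (\<Sum>k. ennreal \<bar>d k x\<bar>) \<partial>M) \<noteq> \<infinity>"
    unfolding infinity_ennreal_def .
  then have "AE x in M. (\<Sum>k. ennreal \<bar>d k x\<bar>) \<noteq> \<infinity>"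
    by (rule nn_integral_PInf_AE[rotated]) measurable
  then have AE_sum: "AE x in M. summable (\<lambda>k. norm (d k x))"
  proof eventually_elim
    case (elim x)
    then show ?case
      by (intro summable_suminf_not_top) (simp_all add: infinity_ennreal_def)
  qed
  define s where "s x = (\<Sum>k. d k x)" for x
  define g where "g x = (\<Sum>k. norm (d k x))" for x
  have s: "s \<in> L1 M"
    using integrable_suminf[OF _ AE_sum] d sum by (simp add: L1_def L1_norm_def s_def[abs_def])
  have g: "integrable M g"
    unfolding g_def[abs_def]
    by (rule integrable_suminf) (use d AE_sum sum in \<open>auto simp: L1_norm_def\<close>)
  have S: "(\<lambda>x. \<Sum>k<n. d k x) \<in> L1 M" for n
    using d by (auto simp: L1_def)
  have "(\<lambda>n. LINT x|M. \<bar>(\<Sum>k<n. d k x) - s x\<bar>) \<longlonglongrightarrow> (LINT x|M. 0)"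
  proof (rule integral_dominated_convergence)
    show "AE x in M. (\<lambda>n. \<bar>(\<Sum>k<n. d k x) - s x\<bar>) \<longlonglongrightarrow> 0"
      using AE_sum
    proof eventually_elim
      case (elim x)
      then have "(\<lambda>n. \<Sum>k<n. d k x) \<longlonglongrightarrow> s x"
        unfolding s_def by (rule summable_LIMSEQ[OF summable_norm_cancel])
      then show ?case
        by (simp add: LIM_zero tendsto_rabs_zero)
    qed
    show "integrable M (\<lambda>x. 2 * g x)"
      using g by simp
    show "AE x in M. norm \<bar>(\<Sum>k<n. d k x) - s x\<bar> \<le> 2 * g x" for n
      using AE_sum
    proof eventually_elim
      case (elim x)
      have "\<bar>\<Sum>k<n. d k x\<bar> \<le> (\<Sum>k<n. norm (d k x))"
        by (simp add: sum_abs)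
      also have "\<dots> \<le> g x"
        unfolding g_def by (rule sum_le_suminf) (use elim in auto)
      finally show ?case
        using summable_norm[OF elim] unfolding s_def g_def by simp
    qed
  qed (use s S in auto)
  then have "(\<lambda>n. norm (L1_emb M (\<lambda>x. \<Sum>k<n. d k x) - L1_emb M s)) \<longlonglongrightarrow> 0"
    using S s by (simp add: L1_emb_diff[symmetric] norm_L1_emb L1_diff L1_norm_def)
  then have "(\<lambda>n. L1_emb M (\<lambda>x. \<Sum>k<n. d k x)) \<longlonglongrightarrow> L1_emb M s"
    by (simp add: tendsto_norm_zero_iff LIM_zero_iff)
  with s show ?thesis by blast
qed

text \<open>
  Completeness of \<open>L\<^sup>1\<close>: a convergent sequence of images has a subsequence whose increments are
  summable in norm.
\<close>

lemma closed_L1_image: "closed (L1_image M)"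
proof -
  have "w \<in> L1_image M" if f: "\<And>n. f n \<in> L1_image M" "f \<longlonglongrightarrow> w" for f w
  proof -
    have "\<forall>k. \<exists>n. \<forall>m\<ge>n. dist (f m) w < (1/2) ^ k"
    proof
      fix k :: nat
      show "\<exists>n. \<forall>m\<ge>n. dist (f m) w < (1/2) ^ k"
        using tendstoD[OF f(2), of "(1/2) ^ k"] by (simp add: eventually_sequentially)
    qed
    then obtain r where r: "\<And>k m. m \<ge> r k \<Longrightarrow> dist (f m) w < (1/2) ^ k"
      by metis
    have "\<forall>k. \<exists>v\<in>L1 M. f (r k) = L1_emb M v"
      using f(1) unfolding L1_image_def by blast
    then obtain u where u: "\<And>k. u k \<in> L1 M" "\<And>k. f (r k) = L1_emb M (u k)"
      by metis
    have lim_u: "(\<lambda>k. L1_emb M (u k)) \<longlonglongrightarrow> w"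
    proof (rule LIM_zero_cancel, rule tendsto_0_le[where K = 1])
      show "(\<lambda>k. (1/2 :: real) ^ k) \<longlonglongrightarrow> 0"
        by (rule LIMSEQ_power_zero) simp
      show "\<forall>\<^sub>F k in sequentially. norm (L1_emb M (u k) - w) \<le> norm ((1/2 :: real) ^ k) * 1"
        using r[OF order_refl] u(2) by (intro always_eventually) (simp add: dist_norm less_imp_le)
    qed
    define d where "d k x = u (Suc k) x - u k x" for k x
    have d: "d k \<in> L1 M" for k
      unfolding d_def[abs_def] by (intro L1_diff u)
    have "L1_norm M (d k) \<le> 2 * (1/2) ^ k" for k
    proof -
      have "L1_norm M (d k) = norm (L1_emb M (d k))"
        by (rule norm_L1_emb[OF d, symmetric])
      also have "\<dots> = dist (f (r (Suc k))) (f (r k))"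
        unfolding d_def[abs_def] L1_emb_diff[OF u(1) u(1)] u(2) dist_norm ..
      also have "\<dots> \<le> dist (f (r (Suc k))) w + dist (f (r k)) w"
        using dist_triangle2 .
      also have "\<dots> \<le> (1/2) ^ Suc k + (1/2) ^ k"
        by (intro add_mono less_imp_le r order_refl)
      also have "\<dots> \<le> 2 * (1/2) ^ k"
        by simp
      finally show ?thesis .
    qed
    then have bound: "norm (L1_norm M (d k)) \<le> 2 * (1/2) ^ k" for k
      by (simp add: L1_norm_def)
    have "summable (\<lambda>k. 2 * (1/2 :: real) ^ k)"
      by (rule summable_mult[OF summable_geometric]) simp
    then have "summable (\<lambda>k. L1_norm M (d k))"
      by (rule summable_comparison_test'[where N = 0]) (rule bound)
    from L1_series_converges[OF d this] obtain s where s: "s \<in> L1 M"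
      "(\<lambda>n. L1_emb M (\<lambda>x. \<Sum>k<n. d k x)) \<longlonglongrightarrow> L1_emb M s"
      by blast
    have "(\<Sum>k<n. d k x) = u n x - u 0 x" for n x
      unfolding d_def by (rule sum_lessThan_telescope)
    then have "L1_emb M (u n) - L1_emb M (u 0) = L1_emb M (\<lambda>x. \<Sum>k<n. d k x)" for n
      by (simp add: L1_emb_diff u)
    with s(2) have "(\<lambda>n. L1_emb M (u n) - L1_emb M (u 0)) \<longlonglongrightarrow> L1_emb M s"
      by simp
    from tendsto_add[OF this tendsto_const, of "L1_emb M (u 0)"]
    have "(\<lambda>n. L1_emb M (u n)) \<longlonglongrightarrow> L1_emb M (\<lambda>x. s x + u 0 x)"
      by (simp add: L1_emb_add s u)
    then have "w = L1_emb M (\<lambda>x. s x + u 0 x)"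
      by (rule LIMSEQ_unique[OF lim_u])
    then show ?thesis
      unfolding L1_image_def using L1_add[OF s(1) u(1)] by blast
  qed
  then show ?thesis
    unfolding closed_sequential_limits by blast
qed

instance bcontfun :: (metric_space, banach) banach ..

lemma al_space_L1: "al_space (L1_image M) (total_mass M)"
proof (rule al_space.intro)
  show "subspace (L1_image M)"
    unfolding subspace_def
  proof (intro conjI ballI allI)
    show "0 \<in> L1_image M"
      unfolding L1_image_def using imageI[OF L1_0, of "L1_emb M" M] by (simp add: L1_emb_0)
    fix x assume x: "x \<in> L1_image M"
    then show "c *\<^sub>R x \<in> L1_image M" for c
      unfolding L1_image_def by (auto simp: L1_emb_scale[symmetric] intro!: imageI)
    fix y assume "y \<in> L1_image M"
    with x show "x + y \<in> L1_image M"
      unfolding L1_image_def by (auto simp: L1_emb_add[symmetric] intro!: imageI)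
  qed
  show "closed (L1_image M)"
    by (rule closed_L1_image)
  show "linear (total_mass M)"
    by (rule linearI) (simp_all add: total_mass_def plus_bcontfun.rep_eq scaleR_bcontfun.rep_eq)
  show "\<bar>total_mass M x\<bar> \<le> norm x" for x
    using norm_bounded[of x] by (simp add: total_mass_def)
  fix x assume "x \<in> L1_image M"
  then obtain u where u: "u \<in> L1 M" "x = L1_emb M u"
    by (auto simp: L1_image_def)
  let ?p = "\<lambda>x. max 0 (u x)" and ?q = "\<lambda>x. max 0 (- u x)"
  have pq: "?p \<in> L1_plus M" "?q \<in> L1_plus M"
    using u(1) by (auto simp: L1_plus_def L1_def)
  then have L1: "?p \<in> L1 M" "?q \<in> L1 M"
    by (auto simp: L1_plus_L1)
  have "u = (\<lambda>x. ?p x - ?q x)"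
    by (auto simp: max_def)
  then have x: "x = L1_emb M ?p - L1_emb M ?q"
    using L1_emb_diff[OF L1] u(2) by simp
  have "norm (L1_emb M ?p) + norm (L1_emb M ?q) = (LINT x|M. ?p x + ?q x)"
    using L1 by (simp add: norm_L1_emb L1_norm_L1_plus pq L1_integrable)
  also have "\<dots> = norm x"
    unfolding u(2) norm_L1_emb[OF u(1)] L1_norm_def
    by (intro Bochner_Integration.integral_cong) auto
  finally show "\<exists>p q. p \<in> L1_image M \<and> total_mass M p = norm p \<and> q \<in> L1_image M \<and>
      total_mass M q = norm q \<and> x = p - q \<and> norm p + norm q = norm x"
    using x L1 pq L1_plus_iff_total_mass[OF L1(1)] L1_plus_iff_total_mass[OF L1(2)]
    unfolding L1_image_def by blast
qed

section \<open>The adjoint on bounded functions\<close>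

lemma (in sigma_finite_measure) positive_integrable_exists:
  obtains w where "integrable M w" "\<And>x. x \<in> space M \<Longrightarrow> 0 < (w x :: real)"
proof -
  obtain h where h: "h \<in> borel_measurable M" "integral\<^sup>N M h \<noteq> \<infinity>"
    "\<And>x. x \<in> space M \<Longrightarrow> 0 < h x \<and> h x < \<infinity>"
    using Ex_finite_integrable_function by blast
  show thesis
  proof
    have "(\<integral>\<^sup>+x. ennreal (enn2real (h x)) \<partial>M) = integral\<^sup>N M h"
      using h(3) by (intro nn_integral_cong ennreal_enn2real) auto
    then show "integrable M (\<lambda>x. enn2real (h x))"
      using h(1,2) by (intro integrableI_nonneg) (auto simp: less_top)
    show "0 < enn2real (h x)" if "x \<in> space M" for x
      using h(3)[OF that] by (simp add: enn2real_positive_iff)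
  qed
qed

lemma AE_nonneg_if_set_integrals_nonneg:
  fixes f :: "'a \<Rightarrow> real"
  assumes f: "integrable M f"
    and nonneg: "\<And>X. X \<in> sets M \<Longrightarrow> 0 \<le> (LINT x|M. indicator X x * f x)"
  shows "AE x in M. 0 \<le> f x"
proof -
  have [measurable]: "f \<in> borel_measurable M"
    using f by auto
  let ?X = "{x \<in> space M. f x < 0}"
  have int: "integrable M (\<lambda>x. - (indicator ?X x * f x))"
    using integrable_mult_indicator[OF _ f, of ?X] by simp
  have neg: "0 \<le> - (indicator ?X x * f x)" for x
    by (auto simp: indicator_def)
  have "(LINT x|M. - (indicator ?X x * f x)) = 0"
    using nonneg[of ?X] Bochner_Integration.integral_nonneg[of M "\<lambda>x. - (indicator ?X x * f x)"] neg by simp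
  then have "AE x in M. - (indicator ?X x * f x) = 0"
    using integral_nonneg_eq_0_iff_AE[OF int] neg by simp
  then show ?thesis
    by (rule AE_mp) (auto intro!: AE_I2 simp: indicator_def split: if_splits)
qed

text \<open>
  Well-definedness modulo almost everywhere equality follows from the bound.
\<close>

definition L1_functional :: "'a measure \<Rightarrow> real \<Rightarrow> (('a \<Rightarrow> real) \<Rightarrow> real) \<Rightarrow> bool" where
  "L1_functional M c \<psi> \<longleftrightarrow>
     (\<forall>u\<in>L1 M. \<forall>v\<in>L1 M. \<psi> (\<lambda>x. u x + v x) = \<psi> u + \<psi> v) \<and>
     (\<forall>a. \<forall>u\<in>L1 M. \<psi> (\<lambda>x. a * u x) = a * \<psi> u) \<and>
     (\<forall>u\<in>L1 M. \<bar>\<psi> u\<bar> \<le> c * L1_norm M u)"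

lemma L1_functional_add:
    "L1_functional M c \<psi> \<Longrightarrow> u \<in> L1 M \<Longrightarrow> v \<in> L1 M \<Longrightarrow> \<psi> (\<lambda>x. u x + v x) = \<psi> u + \<psi> v"
  and L1_functional_scale:
    "L1_functional M c \<psi> \<Longrightarrow> u \<in> L1 M \<Longrightarrow> \<psi> (\<lambda>x. a * u x) = a * \<psi> u"
  and L1_functional_bound:
    "L1_functional M c \<psi> \<Longrightarrow> u \<in> L1 M \<Longrightarrow> \<bar>\<psi> u\<bar> \<le> c * L1_norm M u"
  by (auto simp: L1_functional_def)

lemma L1_functional_diff:
  assumes "L1_functional M c \<psi>" "u \<in> L1 M" "v \<in> L1 M"
  shows "\<psi> (\<lambda>x. u x - v x) = \<psi> u - \<psi> v"
  using L1_functional_add[OF assms(1,2) L1_scale[OF assms(3), of "-1"]]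
    L1_functional_scale[OF assms(1,3), of "-1"] by simp

lemma L1_functional_cong:
  assumes \<psi>: "L1_functional M c \<psi>" and u: "u \<in> L1 M" and v: "v \<in> L1 M"
    and eq: "AE x in M. u x = v x"
  shows "\<psi> u = \<psi> v"
proof -
  have "L1_norm M (\<lambda>x. u x - v x) = 0"
    using eq by (subst L1_norm_eq_0_iff[OF L1_diff[OF u v]]) simp
  then show ?thesis
    using L1_functional_bound[OF \<psi> L1_diff[OF u v]] L1_functional_diff[OF \<psi> u v] by simp
qed

lemma L1_functional_limit:
  fixes \<psi> :: "('a \<Rightarrow> real) \<Rightarrow> real"
  assumes \<psi>: "L1_functional M c \<psi>"
    and s: "\<And>n::nat. s n \<in> L1 M" and u: "u \<in> L1 M" and g: "integrable M g"
    and le: "\<And>n x. x \<in> space M \<Longrightarrow> \<bar>s n x\<bar> \<le> g x"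
    and conv: "\<And>x. x \<in> space M \<Longrightarrow> (\<lambda>n. s n x) \<longlonglongrightarrow> u x"
  shows "(\<lambda>n. \<psi> (s n)) \<longlonglongrightarrow> \<psi> u"
proof (rule LIM_zero_cancel, rule tendsto_0_le[where K = c])
  have "(\<lambda>n. LINT x|M. \<bar>s n x - u x\<bar>) \<longlonglongrightarrow> (LINT x|M. 0)"
  proof (rule integral_dominated_convergence[where w = "\<lambda>x. g x + \<bar>u x\<bar>"])
    show "AE x in M. (\<lambda>n. \<bar>s n x - u x\<bar>) \<longlonglongrightarrow> 0"
      using conv by (intro AE_I2) (simp add: LIM_zero tendsto_rabs_zero)
    have "\<bar>s n x - u x\<bar> \<le> g x + \<bar>u x\<bar>" if "x \<in> space M" for n x
      using le[OF that, of n] by linarith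
    then show "AE x in M. norm \<bar>s n x - u x\<bar> \<le> g x + \<bar>u x\<bar>" for n
      by (intro AE_I2) simp
  qed (use s u g in \<open>auto simp: L1_def\<close>)
  then show "(\<lambda>n. L1_norm M (\<lambda>x. s n x - u x)) \<longlonglongrightarrow> 0"
    by (simp add: L1_norm_def)
  have "norm (\<psi> (s n) - \<psi> u) \<le> norm (L1_norm M (\<lambda>x. s n x - u x)) * c" for n
    using L1_functional_bound[OF \<psi> L1_diff[OF s[of n] u]] L1_functional_diff[OF \<psi> s[of n] u]
    by (simp add: L1_norm_def mult.commute)
  then show "\<forall>\<^sub>F n in sequentially. norm (\<psi> (s n) - \<psi> u) \<le> norm (L1_norm M (\<lambda>x. s n x - u x)) * c"
    by simp
qed

lemma integrable_L1_mult_bounded: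
  assumes h: "h \<in> borel_measurable M" "AE x in M. \<bar>h x\<bar> \<le> c" and u: "u \<in> L1 M"
  shows "integrable M (\<lambda>x. u x * h x)"
proof (rule Bochner_Integration.integrable_bound)
  show "integrable M (\<lambda>x. c * u x)"
    using u by auto
  show "AE x in M. norm (u x * h x) \<le> norm (c * u x)"
    using h(2)
  proof eventually_elim
    case (elim x)
    then have "\<bar>u x\<bar> * \<bar>h x\<bar> \<le> \<bar>u x\<bar> * \<bar>c\<bar>"
      by (intro mult_left_mono) auto
    then show ?case
      by (simp add: abs_mult mult.commute)
  qed
qed (use u h(1) in \<open>auto simp: L1_def\<close>)

lemma L1_functional_of_Linf:
  assumes h: "h \<in> borel_measurable M" "AE x in M. \<bar>h x\<bar> \<le> c"
  shows "L1_functional M c (\<lambda>u. LINT x|M. u x * h x)"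
  unfolding L1_functional_def
proof (intro conjI ballI allI)
  note int = integrable_L1_mult_bounded[OF h]
  fix u assume u: "u \<in> L1 M"
  show "(LINT x|M. (a * u x) * h x) = a * (LINT x|M. u x * h x)" for a
    by (simp add: mult.assoc)
  show "(LINT x|M. (u x + v x) * h x) = (LINT x|M. u x * h x) + (LINT x|M. v x * h x)"
    if "v \<in> L1 M" for v
    using int[OF u] int[OF that] by (simp add: distrib_right)
  have "\<bar>LINT x|M. u x * h x\<bar> \<le> (LINT x|M. \<bar>u x * h x\<bar>)"
    by (rule integral_abs_bound)
  also have "\<dots> \<le> (LINT x|M. c * \<bar>u x\<bar>)"
  proof (rule integral_mono_AE)
    show "AE x in M. \<bar>u x * h x\<bar> \<le> c * \<bar>u x\<bar>"
      using h(2)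
    proof eventually_elim
      case (elim x)
      then have "\<bar>u x\<bar> * \<bar>h x\<bar> \<le> \<bar>u x\<bar> * c"
        by (rule mult_left_mono) simp
      then show ?case
        by (simp add: abs_mult mult.commute)
    qed
  qed (use int[OF u] u in auto)
  finally show "\<bar>LINT x|M. u x * h x\<bar> \<le> c * L1_norm M u"
    by (simp add: L1_norm_def)
qed

text \<open>
  Riesz representation of a positive element of the dual of \<open>L\<^sup>1\<close>.  With a strictly positive integrable
  weight \<open>w\<close>, the set function \<open>X \<mapsto> \<psi> (1\<^sub>X w)\<close> is a finite measure that is absolutely continuous with
  respect to \<open>M\<close>.  If \<open>r\<close> is its Radon-Nikodym density, then \<open>h = r / w\<close> represents \<open>\<psi>\<close>, and
  \<open>r \<le> c w\<close> because this holds for all integrals over sets.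
\<close>

lemma (in sigma_finite_measure) positive_functional_density:
  fixes \<psi> :: "('a \<Rightarrow> real) \<Rightarrow> real"
  assumes \<psi>: "L1_functional M c \<psi>"
    and pos: "\<And>u. u \<in> L1_plus M \<Longrightarrow> 0 \<le> \<psi> u"
  shows "\<exists>h\<in>Linf M. \<forall>u\<in>L1 M. (LINT x|M. u x * h x) = \<psi> u"
proof -
  note add = L1_functional_add[OF \<psi>] and scale = L1_functional_scale[OF \<psi>]
    and bound = L1_functional_bound[OF \<psi>]
  obtain w :: "'a \<Rightarrow> real" where w: "integrable M w" "\<And>x. x \<in> space M \<Longrightarrow> 0 < w x"
    using positive_integrable_exists by blast
  have [measurable]: "w \<in> borel_measurable M"
    using w by auto
  have wX: "(\<lambda>x. indicator X x * w x) \<in> L1_plus M" if "X \<in> sets M" for X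
    using integrable_mult_indicator[OF that w(1)] less_imp_le[OF w(2)]
    by (auto simp: L1_plus_def L1_def)
  define N where "N = measure_of (space M) (sets M) (\<lambda>X. ennreal (\<psi> (\<lambda>x. indicator X x * w x)))"
  have setsN [measurable_cong, simp]: "sets N = sets M"
    by (simp add: N_def)
  have N: "emeasure N X = ennreal (\<psi> (\<lambda>x. indicator X x * w x))" if X: "X \<in> sets M" for X
    unfolding N_def
  proof (rule emeasure_measure_of_sigma)
    show "sigma_algebra (space M) (sets M)" ..
    have "\<psi> (\<lambda>x. 0) = 0"
      using scale[OF L1_0, of 0] by simp
    then show "positive (sets M) (\<lambda>X. ennreal (\<psi> (\<lambda>x. indicator X x * w x)))"
      by (simp add: positive_def)
    show "countably_additive (sets M) (\<lambda>X. ennreal (\<psi> (\<lambda>x. indicator X x * w x)))"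
      unfolding countably_additive_def
    proof (intro allI impI)
      fix F :: "nat \<Rightarrow> 'a set"
      assume F: "range F \<subseteq> sets M" "disjoint_family F" "(\<Union>i. F i) \<in> sets M"
      have Fi: "F i \<in> sets M" for i
        using F(1) by auto
      have sums: "(\<Sum>i<n. \<psi> (\<lambda>x. indicator (F i) x * w x)) = \<psi> (\<lambda>x. (\<Sum>i<n. indicator (F i) x) * w x)"
        and L1: "(\<lambda>x. (\<Sum>i<n. indicator (F i) x) * w x) \<in> L1 M" for n
      proof (induction n)
        case (Suc n)
        {
          case 1
          show ?case
            using add[OF Suc(2) L1_plus_L1[OF wX[OF Fi[of n]]]] Suc(1) by (simp add: distrib_right)
        next
          case 2
          show ?case
            using L1_add[OF Suc(2) L1_plus_L1[OF wX[OF Fi[of n]]]] by (simp add: distrib_right)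
        }
      qed (use \<open>\<psi> (\<lambda>x. 0) = 0\<close> in auto)
      have "(\<lambda>n. \<psi> (\<lambda>x. (\<Sum>i<n. indicator (F i) x) * w x)) \<longlonglongrightarrow> \<psi> (\<lambda>x. indicator (\<Union>i. F i) x * w x)"
      proof (rule L1_functional_limit[OF \<psi> L1 L1_plus_L1[OF wX[OF F(3)]] w(1)])
        fix x assume x: "x \<in> space M"
        have s: "(\<lambda>i. indicator (F i) x :: real) sums indicator (\<Union>i. F i) x"
          using F(2) by (intro indicator_sums) (auto simp: disjoint_family_on_def)
        show "\<bar>(\<Sum>i<n. indicator (F i) x) * w x\<bar> \<le> w x" for n
        proof -
          have "(\<Sum>i<n. indicator (F i) x :: real) \<le> indicator (\<Union>i. F i) x"
            unfolding sums_unique[OF s] by (rule sum_le_suminf) (use s in \<open>auto simp: sums_iff\<close>)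
          also have "\<dots> \<le> 1"
            by (simp add: indicator_def)
          finally show ?thesis
            using w(2)[OF x] by (simp add: abs_mult sum_nonneg mult_left_le_one_le)
        qed
        show "(\<lambda>n. (\<Sum>i<n. indicator (F i) x) * w x) \<longlonglongrightarrow> indicator (\<Union>i. F i) x * w x"
          using s unfolding sums_def by (intro tendsto_mult_right)
      qed
      then have "(\<lambda>i. \<psi> (\<lambda>x. indicator (F i) x * w x)) sums \<psi> (\<lambda>x. indicator (\<Union>i. F i) x * w x)"
        unfolding sums_def sums .
      then show "(\<Sum>i. ennreal (\<psi> (\<lambda>x. indicator (F i) x * w x))) = ennreal (\<psi> (\<lambda>x. indicator (\<Union>i. F i) x * w x))"
        using pos[OF wX[OF Fi]] pos[OF wX[OF F(3)]]
        by (subst suminf_ennreal_eq) auto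
    qed
  qed (rule X)
  have "absolutely_continuous M N"
    unfolding absolutely_continuous_def
  proof
    fix X assume X: "X \<in> null_sets M"
    then have Xs: "X \<in> sets M" by auto
    have "AE x in M. indicator X x * w x = 0"
      using AE_not_in[OF X] by eventually_elim simp
    then have "L1_norm M (\<lambda>x. indicator X x * w x) = 0"
      using L1_norm_eq_0_iff[OF L1_plus_L1[OF wX[OF Xs]]] by simp
    then have "\<psi> (\<lambda>x. indicator X x * w x) = 0"
      using bound[OF L1_plus_L1[OF wX[OF Xs]]] by simp
    then show "X \<in> null_sets N"
      using N[OF Xs] Xs by (auto intro: null_setsI)
  qed
  then obtain k where k: "k \<in> borel_measurable M" "density M k = N"
    using Radon_Nikodym[OF _ setsN] by blast
  note [measurable] = k(1)
  have kX: "(\<integral>\<^sup>+x. k x * indicator X x \<partial>M) = ennreal (\<psi> (\<lambda>x. indicator X x * w x))" if "X \<in> sets M" for X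
    using N[OF that] emeasure_density[OF k(1) that] k(2) by simp
  have k_fin: "AE x in M. k x \<noteq> \<infinity>"
  proof (rule nn_integral_PInf_AE[OF k(1)])
    have "(\<integral>\<^sup>+x. k x \<partial>M) = (\<integral>\<^sup>+x. k x * indicator (space M) x \<partial>M)"
      by (intro nn_integral_cong) simp
    then show "(\<integral>\<^sup>+x. k x \<partial>M) \<noteq> \<infinity>"
      using kX[OF sets.top] by simp
  qed
  define r where "r x = enn2real (k x)" for x
  have [measurable]: "r \<in> borel_measurable M"
    unfolding r_def[abs_def] by measurable
  have r_has: "integrable M (\<lambda>x. indicator X x * r x) \<and>
      (LINT x|M. indicator X x * r x) = \<psi> (\<lambda>x. indicator X x * w x)" if X: "X \<in> sets M" for X
  proof -
    have "(\<integral>\<^sup>+x. ennreal (indicator X x * r x) \<partial>M) = (\<integral>\<^sup>+x. k x * indicator X x \<partial>M)"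
      using k_fin by (intro nn_integral_cong_AE, eventually_elim)
        (auto simp: r_def less_top indicator_def)
    then have "(\<integral>\<^sup>+x. ennreal (indicator X x * r x) \<partial>M) = ennreal (\<psi> (\<lambda>x. indicator X x * w x))"
      using kX[OF X] by simp
    then show ?thesis
      using X pos[OF wX[OF X]]
      by (subst nn_integral_eq_integrable[symmetric]) (auto simp: r_def)
  qed
  have r_int: "integrable M r"
  proof -
    have "integrable M r \<longleftrightarrow> integrable M (\<lambda>x. indicator (space M) x * r x)"
      by (intro Bochner_Integration.integrable_cong) auto
    then show ?thesis
      using r_has[OF sets.top] by simp
  qed
  have r_le: "AE x in M. 0 \<le> c * w x - r x"
  proof (rule AE_nonneg_if_set_integrals_nonneg)
    show "integrable M (\<lambda>x. c * w x - r x)"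
      using w r_int by auto
    fix X assume X: "X \<in> sets M"
    note wX' = L1_plus_L1[OF wX[OF X]]
    have "(LINT x|M. indicator X x * (c * w x - r x))
        = (LINT x|M. c * (indicator X x * w x) - indicator X x * r x)"
      by (simp add: algebra_simps)
    also have "\<dots> = c * L1_norm M (\<lambda>x. indicator X x * w x) - \<psi> (\<lambda>x. indicator X x * w x)"
      using r_has[OF X] wX' by (subst Bochner_Integration.integral_diff)
        (auto simp: L1_def L1_norm_L1_plus[OF wX[OF X]])
    also have "\<dots> \<ge> 0"
      using bound[OF wX'] by simp
    finally show "0 \<le> (LINT x|M. indicator X x * (c * w x - r x))" .
  qed
  define h where "h x = r x / w x" for x
  have [measurable]: "h \<in> borel_measurable M"
    unfolding h_def[abs_def] by measurable
  have h_le: "AE x in M. \<bar>h x\<bar> \<le> c"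
    using r_le AE_space
  proof eventually_elim
    case (elim x)
    then show ?case
      using w(2)[OF elim(2)] by (simp add: h_def r_def field_simps)
  qed
  then have h: "h \<in> Linf M"
    by (auto simp: Linf_def)
  let ?\<phi> = "\<lambda>u. LINT x|M. u x * h x"
  have \<phi>: "L1_functional M c ?\<phi>"
    by (rule L1_functional_of_Linf[OF _ h_le]) measurable
  have wL1: "(\<lambda>x. f x * w x) \<in> L1 M" if "integrable (density M w) f" for f :: "'a \<Rightarrow> real"
  proof -
    have "integrable M (\<lambda>x. w x *\<^sub>R f x)"
      using that w(2) by (subst integrable_density[symmetric]) (auto intro!: AE_I2 less_imp_le)
    then show ?thesis
      by (simp add: L1_def mult.commute)
  qed
  have weighted: "?\<phi> (\<lambda>x. f x * w x) = \<psi> (\<lambda>x. f x * w x)"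
    if f: "integrable (density M w) f" for f
    using f
  proof (induct f rule: integrable_induct)
    case (base A a)
    then have A: "A \<in> sets M"
      by simp
    have "?\<phi> (\<lambda>x. indicator A x * w x) = (LINT x|M. indicator A x * r x)"
      using less_imp_neq[OF w(2)] by (intro Bochner_Integration.integral_cong) (simp_all add: h_def)
    then have "?\<phi> (\<lambda>x. a * (indicator A x * w x)) = \<psi> (\<lambda>x. a * (indicator A x * w x))"
      using r_has[OF A] L1_functional_scale[OF \<phi> L1_plus_L1[OF wX[OF A]]] scale[OF L1_plus_L1[OF wX[OF A]]] by simp
    then show ?case
      by (simp add: mult_ac)
  next
    case (add f g)
    then show ?case
      using L1_functional_add[OF \<phi> wL1 wL1] L1_functional_add[OF \<psi> wL1 wL1] by (simp add: distrib_right)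
  next
    case (lim f s)
    have dom: "\<bar>s n x * w x\<bar> \<le> 2 * \<bar>f x * w x\<bar>" if "x \<in> space M" for n x
      using lim(4)[of x] w(2)[OF that] that by (simp add: abs_mult)
    have conv: "(\<lambda>n. s n x * w x) \<longlonglongrightarrow> f x * w x" if "x \<in> space M" for x
      using lim(3)[of x] that by (intro tendsto_intros) simp
    have int: "integrable M (\<lambda>x. 2 * \<bar>f x * w x\<bar>)"
      using wL1[OF lim(5)] by auto
    have "(\<lambda>n. ?\<phi> (\<lambda>x. s n x * w x)) \<longlonglongrightarrow> ?\<phi> (\<lambda>x. f x * w x)"
      by (rule L1_functional_limit[OF \<phi> wL1[OF lim(1)] wL1[OF lim(5)] int dom conv])
    moreover have "(\<lambda>n. \<psi> (\<lambda>x. s n x * w x)) \<longlonglongrightarrow> \<psi> (\<lambda>x. f x * w x)"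
      by (rule L1_functional_limit[OF \<psi> wL1[OF lim(1)] wL1[OF lim(5)] int dom conv])
    ultimately show ?case
      unfolding lim(2) by (rule LIMSEQ_unique)
  qed
  have "?\<phi> u = \<psi> u" if u: "u \<in> L1 M" for u
  proof -
    let ?f = "\<lambda>x. u x / w x"
    have eq: "?f x * w x = u x" if "x \<in> space M" for x
      using w(2)[OF that] by simp
    have "integrable (density M w) ?f"
    proof (subst integrable_density)
      have "integrable M (\<lambda>x. w x *\<^sub>R ?f x) \<longleftrightarrow> integrable M u"
        using eq by (intro Bochner_Integration.integrable_cong) (auto simp: mult.commute)
      then show "integrable M (\<lambda>x. w x *\<^sub>R ?f x)"
        using u by auto
    qed (use u w(2) in \<open>auto simp: L1_def intro!: AE_I2 less_imp_le\<close>)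
    note f = weighted[OF this] wL1[OF this]
    have "?\<phi> u = ?\<phi> (\<lambda>x. ?f x * w x)"
      using eq by (intro Bochner_Integration.integral_cong) auto
    also note f(1)
    also have "\<psi> (\<lambda>x. ?f x * w x) = \<psi> u"
      by (rule L1_functional_cong[OF \<psi> f(2) u]) (use eq in \<open>auto intro: AE_I2\<close>)
    finally show ?thesis .
  qed
  with h show ?thesis by blast
qed

lemma
  assumes T: "positive_contraction M T"
  shows positive_contraction_L1: "u \<in> L1 M \<Longrightarrow> T u \<in> L1 M"
    and positive_contraction_L1_plus: "u \<in> L1_plus M \<Longrightarrow> T u \<in> L1_plus M"
    and positive_contraction_norm: "u \<in> L1 M \<Longrightarrow> L1_norm M (T u) \<le> L1_norm M u"
    and positive_contraction_add: "u \<in> L1 M \<Longrightarrow> v \<in> L1 M \<Longrightarrow>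
      AE x in M. T (\<lambda>y. u y + v y) x = T u x + T v x"
    and positive_contraction_scale: "u \<in> L1 M \<Longrightarrow> AE x in M. T (\<lambda>y. c * u y) x = c * T u x"
  using T by (auto simp: positive_contraction_def linear_operator_def)

lemma positive_contraction_power:
  assumes T: "positive_contraction M T"
  shows "u \<in> L1 M \<Longrightarrow> (T ^^ n) u \<in> L1 M" "u \<in> L1_plus M \<Longrightarrow> (T ^^ n) u \<in> L1_plus M"
  by (induction n) (auto intro: positive_contraction_L1[OF T] positive_contraction_L1_plus[OF T])

lemma (in sigma_finite_measure) Linf_nonneg:
  assumes h: "h \<in> Linf M" and nonneg: "\<And>u. u \<in> L1_plus M \<Longrightarrow> 0 \<le> (LINT x|M. u x * h x)"
  shows "AE x in M. 0 \<le> h x"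
proof -
  obtain c where c: "h \<in> borel_measurable M" "AE x in M. \<bar>h x\<bar> \<le> c"
    using h by (auto simp: Linf_def)
  obtain w :: "'a \<Rightarrow> real" where w: "integrable M w" "\<And>x. x \<in> space M \<Longrightarrow> 0 < w x"
    using positive_integrable_exists by blast
  have "AE x in M. 0 \<le> w x * h x"
  proof (rule AE_nonneg_if_set_integrals_nonneg)
    show "integrable M (\<lambda>x. w x * h x)"
      using w by (intro integrable_L1_mult_bounded[OF c]) (simp add: L1_def)
    fix X assume X: "X \<in> sets M"
    have "(\<lambda>x. indicator X x * w x) \<in> L1_plus M"
      using integrable_mult_indicator[OF X w(1)] less_imp_le[OF w(2)]
      by (auto simp: L1_plus_def L1_def)
    from nonneg[OF this] show "0 \<le> (LINT x|M. indicator X x * (w x * h x))"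
      by (simp add: mult.assoc)
  qed
  then show ?thesis
    using AE_space by eventually_elim (use w(2) in \<open>force simp: zero_le_mult_iff\<close>)
qed

lemma (in sigma_finite_measure) L1_adjoint_spec:
  assumes T: "positive_contraction M T" and g: "g \<in> Linf M" "AE x in M. 0 \<le> g x"
  shows "L1_adjoint M T g \<in> Linf M"
    and "u \<in> L1 M \<Longrightarrow> (LINT x|M. u x * L1_adjoint M T g x) = (LINT x|M. T u x * g x)"
proof -
  obtain c where c: "g \<in> borel_measurable M" "AE x in M. \<bar>g x\<bar> \<le> c"
    using g by (auto simp: Linf_def)
  have c': "AE x in M. \<bar>g x\<bar> \<le> \<bar>c\<bar>"
    using c(2) by eventually_elim simp
  let ?\<psi> = "\<lambda>u. LINT x|M. u x * g x"
  note \<psi> = L1_functional_of_Linf[OF c(1) c'] and TL1 = positive_contraction_L1[OF T]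
  have "\<exists>h\<in>Linf M. \<forall>u\<in>L1 M. (LINT x|M. u x * h x) = ?\<psi> (T u)"
  proof (rule positive_functional_density)
    show "L1_functional M \<bar>c\<bar> (\<lambda>u. ?\<psi> (T u))"
      unfolding L1_functional_def
    proof (intro conjI ballI allI)
      fix u assume u: "u \<in> L1 M"
      show "?\<psi> (T (\<lambda>x. u x + v x)) = ?\<psi> (T u) + ?\<psi> (T v)" if v: "v \<in> L1 M" for v
      proof -
        have "?\<psi> (T (\<lambda>x. u x + v x)) = ?\<psi> (\<lambda>x. T u x + T v x)"
          by (rule L1_functional_cong[OF \<psi>])
            (use positive_contraction_add[OF T u v] u v TL1 in auto)
        then show ?thesis
          using L1_functional_add[OF \<psi> TL1[OF u] TL1[OF v]] by simp
      qed
      show "?\<psi> (T (\<lambda>x. a * u x)) = a * ?\<psi> (T u)" for a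
      proof -
        have "?\<psi> (T (\<lambda>x. a * u x)) = ?\<psi> (\<lambda>x. a * T u x)"
          by (rule L1_functional_cong[OF \<psi>])
            (use positive_contraction_scale[OF T u] u TL1 in auto)
        then show ?thesis
          using L1_functional_scale[OF \<psi> TL1[OF u]] by simp
      qed
      have "\<bar>?\<psi> (T u)\<bar> \<le> \<bar>c\<bar> * L1_norm M (T u)"
        by (rule L1_functional_bound[OF \<psi> TL1[OF u]])
      also have "\<dots> \<le> \<bar>c\<bar> * L1_norm M u"
        by (intro mult_left_mono positive_contraction_norm[OF T u]) simp
      finally show "\<bar>?\<psi> (T u)\<bar> \<le> \<bar>c\<bar> * L1_norm M u" .
    qed
    fix u assume u: "u \<in> L1_plus M"
    show "0 \<le> ?\<psi> (T u)"
      using g(2) L1_plus_AE[OF positive_contraction_L1_plus[OF T u]]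
      by (intro integral_nonneg_AE) (auto elim: eventually_elim2)
  qed
  then have "\<exists>h. h \<in> Linf M \<and> (\<forall>u\<in>L1 M. (LINT x|M. u x * h x) = (LINT x|M. T u x * g x))"
    by blast
  from someI_ex[OF this]
  show "L1_adjoint M T g \<in> Linf M"
    "u \<in> L1 M \<Longrightarrow> (LINT x|M. u x * L1_adjoint M T g x) = (LINT x|M. T u x * g x)"
    unfolding L1_adjoint_def by blast+
qed

lemma (in sigma_finite_measure) L1_adjoint_power:
  assumes T: "positive_contraction M T"
  shows "(L1_adjoint M T ^^ n) (\<lambda>y. 1) \<in> Linf M \<and>
    (AE x in M. 0 \<le> (L1_adjoint M T ^^ n) (\<lambda>y. 1) x) \<and>
    (\<forall>u\<in>L1 M. (LINT x|M. u x * (L1_adjoint M T ^^ n) (\<lambda>y. 1) x) = (LINT x|M. (T ^^ n) u x))"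
proof (induction n)
  case 0
  show ?case
    by (auto simp: Linf_def)
next
  case (Suc n)
  let ?g = "(L1_adjoint M T ^^ n) (\<lambda>y. 1)"
  have g: "?g \<in> Linf M" "AE x in M. 0 \<le> ?g x"
    and mass: "\<And>u. u \<in> L1 M \<Longrightarrow> (LINT x|M. u x * ?g x) = (LINT x|M. (T ^^ n) u x)"
    using Suc by auto
  have mass': "(LINT x|M. u x * L1_adjoint M T ?g x) = (LINT x|M. (T ^^ Suc n) u x)" if "u \<in> L1 M" for u
    using L1_adjoint_spec(2)[OF T g that] mass[OF positive_contraction_L1[OF T that]]
    by (simp add: funpow_swap1)
  have "AE x in M. 0 \<le> L1_adjoint M T ?g x"
  proof (rule Linf_nonneg[OF L1_adjoint_spec(1)[OF T g]])
    fix u assume u: "u \<in> L1_plus M"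
    show "0 \<le> (LINT x|M. u x * L1_adjoint M T ?g x)"
      unfolding mass'[OF L1_plus_L1[OF u]]
      using L1_plus_AE[OF positive_contraction_power(2)[OF T u, of "Suc n"]]
      by (rule integral_nonneg_AE)
  qed
  then show ?case
    using L1_adjoint_spec(1)[OF T g] mass' by simp
qed

text \<open>
  Testing with nonnegative \<open>u\<close> shows that the iterates \<open>g n\<close> are nonnegative, because \<open>T\<close> is positive,
  and decreasing, because \<open>T\<close> is a contraction.  Being bounded by \<open>g 0 = 1\<close>, they converge almost
  everywhere, and dominated convergence applies to \<open>\<integral>u g\<^sub>n = \<integral>T\<^sup>n u\<close>.
\<close>

lemma (in sigma_finite_measure) L1_adjoint_limit:
  assumes T: "positive_contraction M T"
  defines "g \<equiv> \<lambda>n. (L1_adjoint M T ^^ n) (\<lambda>y. 1)"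
  shows "AE x in M. 0 \<le> lim (\<lambda>n. g n x)"
    and "(\<lambda>x. lim (\<lambda>n. g n x)) \<in> borel_measurable M"
    and "u \<in> L1 M \<Longrightarrow> integrable M (\<lambda>x. u x * lim (\<lambda>n. g n x))"
    and "u \<in> L1 M \<Longrightarrow> (\<lambda>n. LINT x|M. (T ^^ n) u x) \<longlonglongrightarrow> (LINT x|M. u x * lim (\<lambda>n. g n x))"
proof -
  have g: "g n \<in> Linf M" and nonneg: "AE x in M. 0 \<le> g n x"
    and mass: "u \<in> L1 M \<Longrightarrow> (LINT x|M. u x * g n x) = (LINT x|M. (T ^^ n) u x)" for n u
    using L1_adjoint_power[OF T, of n] by (auto simp: g_def)
  have [measurable]: "g n \<in> borel_measurable M" for n
    using g[of n] by (simp add: Linf_def)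
  have int: "integrable M (\<lambda>x. u x * g n x)" if "u \<in> L1 M" for u n
    using g[of n] integrable_L1_mult_bounded[OF _ _ that, of "g n"] by (auto simp: Linf_def)
  have "AE x in M. 0 \<le> g n x - g (Suc n) x" for n
  proof (rule Linf_nonneg)
    obtain c c' where "AE x in M. \<bar>g n x\<bar> \<le> c" "AE x in M. \<bar>g (Suc n) x\<bar> \<le> c'"
      using g[of n] g[of "Suc n"] by (auto simp: Linf_def)
    then have "AE x in M. \<bar>g n x - g (Suc n) x\<bar> \<le> c + c'"
      by eventually_elim linarith
    then show "(\<lambda>x. g n x - g (Suc n) x) \<in> Linf M"
      by (auto simp: Linf_def)
    fix u assume u: "u \<in> L1_plus M"
    note uL = L1_plus_L1[OF u]
    have "(LINT x|M. u x * (g n x - g (Suc n) x)) = (LINT x|M. u x * g n x) - (LINT x|M. u x * g (Suc n) x)"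
      using int[OF uL] by (simp add: right_diff_distrib)
    also have "\<dots> = L1_norm M ((T ^^ n) u) - L1_norm M (T ((T ^^ n) u))"
      using positive_contraction_power(2)[OF T u, of n] positive_contraction_power(2)[OF T u, of "Suc n"]
      by (simp add: mass[OF uL] L1_norm_L1_plus)
    also have "\<dots> \<ge> 0"
      using positive_contraction_norm[OF T positive_contraction_power(1)[OF T uL]] by simp
    finally show "0 \<le> (LINT x|M. u x * (g n x - g (Suc n) x))" .
  qed
  then have "AE x in M. \<forall>n. 0 \<le> g n x \<and> g (Suc n) x \<le> g n x"
    using nonneg by (simp add: AE_all_countable)
  then have lim: "AE x in M. (\<forall>n. 0 \<le> g n x \<and> g n x \<le> 1) \<and> (\<lambda>n. g n x) \<longlonglongrightarrow> lim (\<lambda>n. g n x)"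
  proof eventually_elim
    case (elim x)
    then have dec: "decseq (\<lambda>n. g n x)"
      by (auto intro: decseq_SucI)
    then have "g n x \<le> 1" for n
      using decseqD[OF dec, of 0 n] by (simp add: g_def)
    moreover have "convergent (\<lambda>n. g n x)"
    proof -
      have "\<forall>n. 0 \<le> g n x"
        using elim by blast
      from decseq_convergent[OF dec this] show ?thesis
        by (auto intro: convergentI)
    qed
    ultimately show ?case
      using elim by (simp add: convergent_LIMSEQ_iff)
  qed
  then have f: "AE x in M. 0 \<le> lim (\<lambda>n. g n x) \<and> lim (\<lambda>n. g n x) \<le> 1"
    by eventually_elim (auto intro: LIMSEQ_le_const LIMSEQ_le_const2)
  then show "AE x in M. 0 \<le> lim (\<lambda>n. g n x)"
    by eventually_elim simp
  show meas: "(\<lambda>x. lim (\<lambda>n. g n x)) \<in> borel_measurable M"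
    by measurable
  assume u: "u \<in> L1 M"
  show "integrable M (\<lambda>x. u x * lim (\<lambda>n. g n x))"
    using f by (intro integrable_L1_mult_bounded[where c = 1] meas u) (auto elim: eventually_mono)
  have "(\<lambda>n. LINT x|M. u x * g n x) \<longlonglongrightarrow> (LINT x|M. u x * lim (\<lambda>n. g n x))"
  proof (rule integral_dominated_convergence[where w = "\<lambda>x. \<bar>u x\<bar>"])
    show "AE x in M. (\<lambda>n. u x * g n x) \<longlonglongrightarrow> u x * lim (\<lambda>n. g n x)"
      using lim by eventually_elim (auto intro: tendsto_mult)
    show "AE x in M. norm (u x * g n x) \<le> \<bar>u x\<bar>" for n
      using lim by eventually_elim (auto simp: abs_mult intro: mult_left_le)
  qed (use u meas in \<open>auto simp: L1_def\<close>)
  then show "(\<lambda>n. LINT x|M. (T ^^ n) u x) \<longlonglongrightarrow> (LINT x|M. u x * lim (\<lambda>n. g n x))"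
    by (simp add: mass[OF u])
qed

text \<open>
  For \<open>u \<ge> 0\<close> the norms of \<open>T\<^sup>n u\<close> tend to \<open>\<integral>u f\<close>.  This vanishes for all \<open>u\<close> if \<open>f = 0\<close>, and if it
  vanishes for a single strictly positive \<open>u\<close>, then \<open>f = 0\<close>.
\<close>

theorem (in sigma_finite_measure) L1_adjoint_limit_null_iff:
  assumes T: "positive_contraction M T"
  defines "f \<equiv> \<lambda>x. lim (\<lambda>n. (L1_adjoint M T ^^ n) (\<lambda>y. 1) x)"
  shows "emeasure M {x \<in> space M. 0 < f x} = 0 \<longleftrightarrow>
      (\<forall>u\<in>L1_plus M. (\<lambda>n. L1_norm M ((T ^^ n) u)) \<longlonglongrightarrow> 0)" (is "?null \<longleftrightarrow> ?all")
    and "emeasure M {x \<in> space M. 0 < f x} = 0 \<longleftrightarrow>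
      (\<exists>u\<in>L1_plus M. (AE x in M. 0 < u x) \<and> (\<lambda>n. L1_norm M ((T ^^ n) u)) \<longlonglongrightarrow> 0)"
      (is "_ \<longleftrightarrow> ?ex")
proof -
  note limit = L1_adjoint_limit[OF T, folded f_def]
  have [measurable]: "f \<in> borel_measurable M"
    using limit(2) by (simp add: f_def)
  have f: "AE x in M. 0 \<le> f x" and int: "\<And>u. u \<in> L1 M \<Longrightarrow> integrable M (\<lambda>x. u x * f x)"
    and mass: "\<And>u. u \<in> L1 M \<Longrightarrow> (\<lambda>n. LINT x|M. (T ^^ n) u x) \<longlonglongrightarrow> (LINT x|M. u x * f x)"
    using limit by (auto simp: f_def)
  have norm: "(\<lambda>n. L1_norm M ((T ^^ n) u)) \<longlonglongrightarrow> (LINT x|M. u x * f x)" if "u \<in> L1_plus M" for u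
    using mass[OF L1_plus_L1[OF that]] L1_norm_L1_plus[OF positive_contraction_power(2)[OF T that]] by simp
  have null: "?null \<longleftrightarrow> (AE x in M. f x = 0)"
  proof -
    have "?null \<longleftrightarrow> (AE x in M. \<not> 0 < f x)"
      by (subst AE_iff_measurable[OF _ refl]) auto
    also have "\<dots> \<longleftrightarrow> (AE x in M. f x = 0)"
      using f by (auto elim: eventually_elim2)
    finally show ?thesis .
  qed
  have 1: "?all" if "?null"
  proof
    fix u assume u: "u \<in> L1_plus M"
    have "(LINT x|M. u x * f x) = (LINT x|M. 0)"
      using that int[OF L1_plus_L1[OF u]] unfolding null by (intro integral_cong_AE) (auto elim: eventually_mono)
    then show "(\<lambda>n. L1_norm M ((T ^^ n) u)) \<longlonglongrightarrow> 0"
      using norm[OF u] by simp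
  qed
  have 2: "?ex" if "?all"
  proof -
    obtain w :: "'a \<Rightarrow> real" where w: "integrable M w" "\<And>x. x \<in> space M \<Longrightarrow> 0 < w x"
      using positive_integrable_exists by blast
    then have "w \<in> L1_plus M" "AE x in M. 0 < w x"
      by (auto simp: L1_plus_def L1_def less_imp_le)
    with that show ?thesis by blast
  qed
  have 3: "?null" if ex: "?ex"
  proof -
    obtain u where u: "u \<in> L1_plus M" "AE x in M. 0 < u x" "(\<lambda>n. L1_norm M ((T ^^ n) u)) \<longlonglongrightarrow> 0"
      using ex by blast
    have "(LINT x|M. u x * f x) = 0"
      using LIMSEQ_unique[OF norm[OF u(1)] u(3)] .
    moreover have "AE x in M. 0 \<le> u x * f x"
      using u(2) f by eventually_elim simp
    ultimately have "AE x in M. u x * f x = 0"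
      using integral_nonneg_eq_0_iff_AE[OF int[OF L1_plus_L1[OF u(1)]]] by simp
    with u(2) have "AE x in M. f x = 0"
      by eventually_elim simp
    then show ?thesis
      unfolding null .
  qed
  show "?null \<longleftrightarrow> ?all" "?null \<longleftrightarrow> ?ex"
    using 1 2 3 by blast+
qed

section \<open>Transfer between functions and their images\<close>

text \<open>
  The operator \<open>T\<close> acts on functions, \<open>T'\<close> on their classes.  An operator \<open>T\<close> that respects almost
  everywhere equality is represented by \<open>w \<mapsto> L1_emb M (T (L1_rep M w))\<close>, and conversely \<open>T'\<close> represents
  \<open>u \<mapsto> L1_rep M (T' (L1_emb M u))\<close>.
\<close>

definition represents ::
  "'a measure \<Rightarrow> (('a \<Rightarrow> real) \<Rightarrow> ('a \<Rightarrow> real)) \<Rightarrow>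
   (('a set discrete \<Rightarrow>\<^sub>C real) \<Rightarrow> ('a set discrete \<Rightarrow>\<^sub>C real)) \<Rightarrow> bool" where
  "represents M T T' \<longleftrightarrow> (\<forall>u\<in>L1 M. T u \<in> L1 M \<and> L1_emb M (T u) = T' (L1_emb M u))"

definition L1_rep :: "'a measure \<Rightarrow> ('a set discrete \<Rightarrow>\<^sub>C real) \<Rightarrow> ('a \<Rightarrow> real)" where
  "L1_rep M w = (SOME u. u \<in> L1 M \<and> L1_emb M u = w)"

lemma L1_rep:
  assumes "w \<in> L1_image M"
  shows "L1_rep M w \<in> L1 M" "L1_emb M (L1_rep M w) = w"
proof -
  have "\<exists>u. u \<in> L1 M \<and> L1_emb M u = w"
    using assms by (auto simp: L1_image_def)
  from someI_ex[OF this] show "L1_rep M w \<in> L1 M" "L1_emb M (L1_rep M w) = w"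
    by (auto simp: L1_rep_def)
qed

lemma L1_emb_in_image [simp]: "u \<in> L1 M \<Longrightarrow> L1_emb M u \<in> L1_image M"
  by (simp add: L1_image_def)

lemma ball_L1_image: "(\<forall>w\<in>L1_image M. Q w) \<longleftrightarrow> (\<forall>u\<in>L1 M. Q (L1_emb M u))"
  by (auto simp: L1_image_def)

lemma representsD:
  "represents M T T' \<Longrightarrow> u \<in> L1 M \<Longrightarrow> T u \<in> L1 M"
  "represents M T T' \<Longrightarrow> u \<in> L1 M \<Longrightarrow> L1_emb M (T u) = T' (L1_emb M u)"
  by (auto simp: represents_def)

lemma represents_power:
  assumes "represents M T T'"
  shows "represents M (T ^^ n) (T' ^^ n)"
  using assms by (induction n) (auto simp: represents_def)

lemma represents_unlift:
  assumes "\<And>w. w \<in> L1_image M \<Longrightarrow> T' w \<in> L1_image M"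
  shows "represents M (\<lambda>u. L1_rep M (T' (L1_emb M u))) T'"
  unfolding represents_def using L1_rep[OF assms] by auto

lemma
  assumes T: "linear_operator M D T" and u: "u \<in> D"
  shows linear_operator_dom_L1: "u \<in> L1 M"
    and linear_operator_L1: "T u \<in> L1 M"
    and linear_operator_dom_cong: "v \<in> L1 M \<Longrightarrow> AE x in M. u x = v x \<Longrightarrow> v \<in> D"
    and linear_operator_dom_add: "v \<in> D \<Longrightarrow> (\<lambda>x. u x + v x) \<in> D"
    and linear_operator_dom_scale: "(\<lambda>x. c * u x) \<in> D"
    and linear_operator_cong: "v \<in> D \<Longrightarrow> AE x in M. u x = v x \<Longrightarrow> AE x in M. T u x = T v x"
    and linear_operator_add: "v \<in> D \<Longrightarrow> AE x in M. T (\<lambda>y. u y + v y) x = T u x + T v x"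
    and linear_operator_scale: "AE x in M. T (\<lambda>y. c * u y) x = c * T u x"
proof -
  have dom: "D \<subseteq> L1 M" and L1: "\<forall>u\<in>D. T u \<in> L1 M"
    and dom_cong: "\<forall>u\<in>D. \<forall>v\<in>L1 M. (AE x in M. u x = v x) \<longrightarrow> v \<in> D"
    and dom_add: "\<forall>u\<in>D. \<forall>v\<in>D. (\<lambda>x. u x + v x) \<in> D"
    and dom_scale: "\<forall>c. \<forall>u\<in>D. (\<lambda>x. c * u x) \<in> D"
    and cong: "\<forall>u\<in>D. \<forall>v\<in>D. (AE x in M. u x = v x) \<longrightarrow> (AE x in M. T u x = T v x)"
    and add: "\<forall>u\<in>D. \<forall>v\<in>D. AE x in M. T (\<lambda>y. u y + v y) x = T u x + T v x"
    and scale: "\<forall>c. \<forall>u\<in>D. AE x in M. T (\<lambda>y. c * u y) x = c * T u x"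
    using T unfolding linear_operator_def by - (elim conjE, assumption)+
  show "u \<in> L1 M"
    by (rule subsetD[OF dom u])
  show "T u \<in> L1 M"
    by (rule bspec[OF L1 u])
  show "v \<in> L1 M \<Longrightarrow> AE x in M. u x = v x \<Longrightarrow> v \<in> D"
    by (rule dom_cong[rule_format, OF u])
  show "v \<in> D \<Longrightarrow> (\<lambda>x. u x + v x) \<in> D"
    by (rule dom_add[rule_format, OF u])
  show "(\<lambda>x. c * u x) \<in> D"
    by (rule dom_scale[rule_format, OF u])
  show "v \<in> D \<Longrightarrow> AE x in M. u x = v x \<Longrightarrow> AE x in M. T u x = T v x"
    by (rule cong[rule_format, OF u])
  show "v \<in> D \<Longrightarrow> AE x in M. T (\<lambda>y. u y + v y) x = T u x + T v x"
    by (rule add[rule_format, OF u])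
  show "AE x in M. T (\<lambda>y. c * u y) x = c * T u x"
    by (rule scale[rule_format, OF u])
qed

lemma lift_L1_emb:
  assumes T: "linear_operator M D T" and u: "u \<in> D"
  shows "L1_emb M (T (L1_rep M (L1_emb M u))) = L1_emb M (T u)"
proof -
  note uL = linear_operator_dom_L1[OF T u]
  let ?u = "L1_rep M (L1_emb M u)"
  have r: "?u \<in> L1 M" "L1_emb M ?u = L1_emb M u"
    using L1_rep[of "L1_emb M u" M] uL by auto
  then have eq: "AE x in M. u x = ?u x"
    using L1_emb_eq_iff[OF uL r(1)] by simp
  have D: "?u \<in> D"
    by (rule linear_operator_dom_cong[OF T u r(1) eq])
  show ?thesis
    using linear_operator_cong[OF T u D eq]
      L1_emb_eq_iff[OF linear_operator_L1[OF T u] linear_operator_L1[OF T D]] by simp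
qed

lemma represents_lift:
  assumes T: "linear_operator M (L1 M) T"
  shows "represents M T (\<lambda>w. L1_emb M (T (L1_rep M w)))"
  unfolding represents_def by (intro ballI conjI linear_operator_L1[OF T] lift_L1_emb[OF T, symmetric])

context
  fixes M :: "'a measure"
begin

interpretation L1: al_space "L1_image M" "total_mass M"
  by (rule al_space_L1)

lemma cone_L1_emb:
  assumes "u \<in> L1 M"
  shows "L1_emb M u \<in> L1.cone \<longleftrightarrow> u \<in> L1_plus M"
  using assms L1_plus_iff_total_mass by (auto simp: L1.cone_def)

lemma ball_cone: "(\<forall>w\<in>L1.cone. Q w) \<longleftrightarrow> (\<forall>u\<in>L1_plus M. Q (L1_emb M u))"
proof -
  have "L1.cone = L1_emb M ` L1_plus M"
  proof (intro equalityI subsetI)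
    fix x assume x: "x \<in> L1.cone"
    then obtain u where "u \<in> L1 M" "x = L1_emb M u"
      using L1.cone_V[OF x] by (auto simp: L1_image_def)
    then show "x \<in> L1_emb M ` L1_plus M"
      using x cone_L1_emb by auto
  next
    fix x assume "x \<in> L1_emb M ` L1_plus M"
    then show "x \<in> L1.cone"
      using cone_L1_emb[OF L1_plus_L1] by auto
  qed
  then show ?thesis
    by simp
qed

lemma represents_linear_operator:
  assumes r: "represents M T T'"
    and add: "\<And>x y. x \<in> L1_image M \<Longrightarrow> y \<in> L1_image M \<Longrightarrow> T' (x + y) = T' x + T' y"
    and scale: "\<And>c x. x \<in> L1_image M \<Longrightarrow> T' (c *\<^sub>R x) = c *\<^sub>R T' x"
  shows "linear_operator M (L1 M) T"
  unfolding linear_operator_def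
proof (intro conjI ballI allI impI)
  note TL = representsD(1)[OF r] and eT = representsD(2)[OF r]
  fix u assume u: "u \<in> L1 M"
  show "T u \<in> L1 M"
    by (rule TL[OF u])
  show "AE x in M. T (\<lambda>y. c * u y) x = c * T u x" for c
    by (subst L1_emb_eq_iff[symmetric])
      (use u in \<open>simp_all add: TL eT L1_scale L1_emb_scale scale\<close>)
  fix v assume v: "v \<in> L1 M"
  show "AE x in M. T (\<lambda>y. u y + v y) x = T u x + T v x"
    by (subst L1_emb_eq_iff[symmetric])
      (use u v in \<open>simp_all add: TL eT L1_add L1_emb_add add\<close>)
  show "AE x in M. T u x = T v x" if "AE x in M. u x = v x"
    using that L1_emb_eq_iff[OF u v] L1_emb_eq_iff[OF TL[OF u] TL[OF v]] eT[OF u] eT[OF v] by simp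
qed (auto intro: L1_add L1_scale)

lemma represents_positive_contraction_iff:
  assumes r: "represents M T T'"
  shows "positive_contraction M T \<longleftrightarrow> L1.pos_contraction T'"
proof
  note TL = representsD(1)[OF r] and eT = representsD(2)[OF r]
  assume T: "positive_contraction M T"
  have "T' (L1_emb M u + L1_emb M v) = T' (L1_emb M u) + T' (L1_emb M v)"
    if "u \<in> L1 M" "v \<in> L1 M" for u v
    using L1_emb_eq_iff[THEN iffD2, OF _ _ positive_contraction_add[OF T that]] that
    by (simp add: TL L1_add eT L1_emb_add)
  moreover have "T' (c *\<^sub>R L1_emb M u) = c *\<^sub>R T' (L1_emb M u)" if "u \<in> L1 M" for c u
    using L1_emb_eq_iff[THEN iffD2, OF _ _ positive_contraction_scale[OF T that, of c]] that
    by (simp add: TL L1_scale eT L1_emb_scale)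
  moreover have "T' (L1_emb M u) \<in> L1_image M \<and> norm (T' (L1_emb M u)) \<le> norm (L1_emb M u)"
    if "u \<in> L1 M" for u
    using positive_contraction_norm[OF T that] that
    by (simp add: eT[OF that, symmetric] TL norm_L1_emb)
  moreover have "T' (L1_emb M u) \<in> L1.cone" if "u \<in> L1_plus M" for u
    using positive_contraction_L1_plus[OF T that] L1_plus_L1[OF that]
    by (simp add: eT[symmetric] cone_L1_emb TL)
  ultimately show "L1.pos_contraction T'"
    unfolding L1.pos_contraction_def ball_L1_image ball_cone by blast
next
  note TL = representsD(1)[OF r] and eT = representsD(2)[OF r]
  assume T': "L1.pos_contraction T'"
  have "linear_operator M (L1 M) T"
    by (rule represents_linear_operator[OF r L1.pc_add[OF T'] L1.pc_scale[OF T']])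
  moreover have "T u \<in> L1_plus M" if "u \<in> L1_plus M" for u
    using L1.pc_cone[OF T', of "L1_emb M u"] that L1_plus_L1[OF that]
    by (simp add: eT[symmetric] cone_L1_emb TL)
  moreover have "L1_norm M (T u) \<le> L1_norm M u" if "u \<in> L1 M" for u
    using L1.pc_norm[OF T', of "L1_emb M u"] that by (simp add: eT[symmetric] TL norm_L1_emb)
  ultimately show "positive_contraction M T"
    unfolding positive_contraction_def by blast
qed

lemma represents_generator_graph_iff:
  assumes rep: "\<forall>t\<ge>0. represents M (S t) (S' t)" and u: "u \<in> L1 M" and v: "v \<in> L1 M"
  shows "generator_graph M S u v \<longleftrightarrow> L1.gen S' (L1_emb M u) (L1_emb M v)"
proof -
  have r: "represents M (S t) (S' t)" if "0 \<le> t" for t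
    using rep that by blast
  have "L1_norm M (\<lambda>x. (S t u x - u x) / t - v x)
      = norm ((S' t (L1_emb M u) - L1_emb M u) /\<^sub>R t - L1_emb M v)" if t: "0 < t" for t
  proof -
    note St = representsD[OF r[OF less_imp_le[OF t]] u]
    have "(\<lambda>x. (S t u x - u x) / t - v x) = (\<lambda>x. inverse t * (S t u x - u x) - v x)"
      by (simp add: divide_inverse mult.commute)
    moreover have d: "(\<lambda>x. S t u x - u x) \<in> L1 M" "(\<lambda>x. inverse t * (S t u x - u x)) \<in> L1 M"
      using St(1) u by auto
    ultimately show ?thesis
      using St u v by (simp add: norm_L1_emb[symmetric] L1_diff L1_emb_diff[OF d(2) v]
          L1_emb_scale[OF d(1)] L1_emb_diff[OF St(1) u])
  qed
  then have "((\<lambda>t. L1_norm M (\<lambda>x. (S t u x - u x) / t - v x)) \<longlongrightarrow> 0) (at_right 0) \<longleftrightarrow>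
      ((\<lambda>t. norm ((S' t (L1_emb M u) - L1_emb M u) /\<^sub>R t - L1_emb M v)) \<longlongrightarrow> 0) (at_right 0)"
    by (intro tendsto_cong) (auto simp: eventually_at_filter)
  then show ?thesis
    using u v by (simp add: generator_graph_def L1.gen_def tendsto_norm_zero_iff LIM_zero_iff)
qed

lemma represents_semigroup_iff:
  assumes rep: "\<forall>t\<ge>0. represents M (S t) (S' t)"
  shows "substochastic_semigroup M S \<longleftrightarrow> L1.pc_semigroup S'"
proof -
  have r: "represents M (S t) (S' t)" if "0 \<le> t" for t
    using rep that by blast
  note SL = representsD(1)[OF r] and eS = representsD(2)[OF r]
  have pc: "(\<forall>t\<ge>0. positive_contraction M (S t)) \<longleftrightarrow> (\<forall>t\<ge>0. L1.pos_contraction (S' t))"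
    using represents_positive_contraction_iff[OF r] by blast
  have bounded: "linear_operator M (L1 M) T \<and> (\<exists>c. \<forall>u\<in>L1 M. L1_norm M (T u) \<le> c * L1_norm M u)"
    if "positive_contraction M T" for T
    using that unfolding positive_contraction_def by (auto intro: exI[of _ 1])
  have zero: "(AE x in M. S 0 u x = u x) \<longleftrightarrow> S' 0 (L1_emb M u) = L1_emb M u" if "u \<in> L1 M" for u
    using L1_emb_eq_iff[OF SL[OF order_refl that] that] eS[OF order_refl that] by simp
  have add: "(AE x in M. S (s + t) u x = S s (S t u) x) \<longleftrightarrow>
      S' (s + t) (L1_emb M u) = S' s (S' t (L1_emb M u))" if "0 \<le> s" "0 \<le> t" "u \<in> L1 M" for s t u
    using that by (subst L1_emb_eq_iff[symmetric]) (simp_all add: SL eS)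
  have cont: "((\<lambda>t. L1_norm M (\<lambda>x. S t u x - u x)) \<longlongrightarrow> 0) (at_right 0) \<longleftrightarrow>
      ((\<lambda>t. S' t (L1_emb M u)) \<longlongrightarrow> L1_emb M u) (at_right 0)" if u: "u \<in> L1 M" for u
  proof -
    have "((\<lambda>t. L1_norm M (\<lambda>x. S t u x - u x)) \<longlongrightarrow> 0) (at_right 0) \<longleftrightarrow>
        ((\<lambda>t. norm (S' t (L1_emb M u) - L1_emb M u)) \<longlongrightarrow> 0) (at_right 0)"
      by (intro tendsto_cong)
        (auto simp: eventually_at_filter norm_L1_emb[symmetric] L1_diff L1_emb_diff SL eS u)
    then show ?thesis
      by (simp add: tendsto_norm_zero_iff LIM_zero_iff)
  qed
  have zero_all: "(\<forall>u\<in>L1 M. AE x in M. S 0 u x = u x) \<longleftrightarrow> (\<forall>x\<in>L1_image M. S' 0 x = x)"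
    unfolding ball_L1_image by (rule ball_cong[OF refl zero])
  have add_all: "(\<forall>s\<ge>0. \<forall>t\<ge>0. \<forall>u\<in>L1 M. AE x in M. S (s + t) u x = S s (S t u) x) \<longleftrightarrow>
      (\<forall>s\<ge>0. \<forall>t\<ge>0. \<forall>x\<in>L1_image M. S' (s + t) x = S' s (S' t x))"
    unfolding ball_L1_image using add by simp
  have cont_all: "(\<forall>u\<in>L1 M. ((\<lambda>t. L1_norm M (\<lambda>x. S t u x - u x)) \<longlongrightarrow> 0) (at_right 0)) \<longleftrightarrow>
      (\<forall>x\<in>L1_image M. ((\<lambda>t. S' t x) \<longlongrightarrow> x) (at_right 0))"
    unfolding ball_L1_image by (rule ball_cong[OF refl cont])
  have "(\<forall>t\<ge>0. linear_operator M (L1 M) (S t) \<and>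
        (\<exists>c. \<forall>u\<in>L1 M. L1_norm M (S t u) \<le> c * L1_norm M u))"
    if "\<forall>t\<ge>0. positive_contraction M (S t)"
    using bounded that by simp
  then show ?thesis
    unfolding substochastic_semigroup_def C0_semigroup_def L1.pc_semigroup_def
      zero_all add_all cont_all pc by argo
qed

text \<open>
  Densities only test the nonnegative elements of norm one; scaling and the decomposition into positive
  and negative part reach all of the space.
\<close>

lemma represents_stochastic_semigroup_iff:
  assumes rep: "\<forall>t\<ge>0. represents M (S t) (S' t)" and S: "substochastic_semigroup M S"
  shows "stochastic_semigroup M S \<longleftrightarrow>
    (\<forall>t\<ge>0. \<forall>x\<in>L1_image M. total_mass M (S' t x) = total_mass M x)"
proof -
  have r: "represents M (S t) (S' t)" if "0 \<le> t" for t
    using rep that by blast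
  note eS = representsD(2)[OF r]
  note S' = S[unfolded represents_semigroup_iff[OF rep]]
  have pc: "positive_contraction M (S t)" if "0 \<le> t" for t
    using S that by (simp add: substochastic_semigroup_def)
  have 1: "stochastic_semigroup M S"
    if mass: "\<forall>t\<ge>0. \<forall>x\<in>L1_image M. total_mass M (S' t x) = total_mass M x"
  proof -
    have "S t u \<in> densities M" if t: "0 \<le> t" and u: "u \<in> densities M" for t u
    proof -
      have u': "u \<in> L1_plus M" "(LINT x|M. u x) = 1"
        using u L1_norm_L1_plus[of u M] by (auto simp: densities_def)
      then have Stu: "S t u \<in> L1_plus M"
        using positive_contraction_L1_plus[OF pc[OF t]] by simp
      have "total_mass M (S' t (L1_emb M u)) = total_mass M (L1_emb M u)"
        using mass t L1_plus_L1[OF u'(1)] by simp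
      then have "(LINT x|M. S t u x) = (LINT x|M. u x)"
        using total_mass_L1_emb[OF L1_plus_L1[OF Stu]] total_mass_L1_emb[OF L1_plus_L1[OF u'(1)]]
          eS[OF t L1_plus_L1[OF u'(1)]] by simp
      then show ?thesis
        using u' Stu by (simp add: densities_def L1_norm_L1_plus)
    qed
    then show "stochastic_semigroup M S"
      using S unfolding stochastic_semigroup_def substochastic_semigroup_def
        stochastic_operator_def positive_contraction_def by blast
  qed
  have 2: "\<forall>t\<ge>0. \<forall>x\<in>L1_image M. total_mass M (S' t x) = total_mass M x"
    if stoch: "stochastic_semigroup M S"
  proof -
    have plus: "total_mass M (S' t (L1_emb M u)) = total_mass M (L1_emb M u)"
      if t: "0 \<le> t" and u: "u \<in> L1_plus M" for t u
    proof -
      note uL = L1_plus_L1[OF u]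
      define a where "a = L1_norm M u"
      have pt: "L1.pos_contraction (S' t)"
        using L1.sg_pc[OF S' t] .
      have na: "norm (L1_emb M u) = a"
        unfolding a_def by (rule norm_L1_emb[OF uL])
      show ?thesis
      proof (cases "a = 0")
        case True
        then have "L1_emb M u = 0"
          using na by simp
        then show ?thesis
          using L1.pc_0[OF pt] by simp
      next
        case False
        then have a: "0 < a"
          by (simp add: a_def L1_norm_def less_le)
        let ?v = "\<lambda>x. inverse a * u x"
        have v: "?v \<in> L1_plus M"
          using u uL a by (auto simp: L1_plus_def)
        have nv: "L1_norm M ?v = 1"
          using a by (simp add: norm_L1_emb[symmetric] L1_plus_L1[OF v] L1_emb_scale[OF uL] na)
        have "S t ?v \<in> densities M"
          using stoch t v nv by (simp add: stochastic_semigroup_def stochastic_operator_def densities_def)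
        then have "total_mass M (S' t (L1_emb M ?v)) = 1"
          using eS[OF t L1_plus_L1[OF v]] total_mass_L1_emb[of "S t ?v" M] L1_norm_L1_plus[of "S t ?v" M]
          by (simp add: densities_def L1_plus_L1)
        then have "inverse a * total_mass M (S' t (L1_emb M u)) = 1"
          using uL by (simp add: L1_emb_scale L1.pc_scale[OF pt] L1.mass_scale)
        then show ?thesis
          using a na cone_L1_emb[OF uL] u L1.cone_norm by (simp add: field_simps)
      qed
    qed
    show "\<forall>t\<ge>0. \<forall>x\<in>L1_image M. total_mass M (S' t x) = total_mass M x"
    proof (intro allI impI ballI)
      fix t :: real and x assume t: "0 \<le> t" and x: "x \<in> L1_image M"
      obtain p q where pq: "p \<in> L1.cone" "q \<in> L1.cone" "x = p - q"
        using L1.cone_decomposition[OF x] by blast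
      have "\<forall>w\<in>L1.cone. total_mass M (S' t w) = total_mass M w"
        unfolding ball_cone using plus t by blast
      then show "total_mass M (S' t x) = total_mass M x"
        using pq L1.pc_diff[OF L1.sg_pc[OF S' t]] L1.cone_V by (simp add: L1.mass_diff)
    qed
  qed
  show ?thesis
    using 1 2 by (rule iffI[rotated])
qed

lemma represents_mean_ergodic_iff:
  assumes r: "represents M T T'"
  shows "mean_ergodic M T \<longleftrightarrow>
    (\<forall>x\<in>L1_image M. \<exists>y\<in>L1_image M. (\<lambda>N. (1 / real N) *\<^sub>R (\<Sum>n<N. (T' ^^ n) x)) \<longlonglongrightarrow> y)"
proof -
  have TL: "u \<in> L1 M \<Longrightarrow> (T ^^ n) u \<in> L1 M"
    and eT: "u \<in> L1 M \<Longrightarrow> L1_emb M ((T ^^ n) u) = (T' ^^ n) (L1_emb M u)" for u n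
    using representsD[OF represents_power[OF r]] by auto
  have sum: "(\<lambda>x. \<Sum>n<N. (T ^^ n) u x) \<in> L1 M \<and>
      L1_emb M (\<lambda>x. \<Sum>n<N. (T ^^ n) u x) = (\<Sum>n<N. (T' ^^ n) (L1_emb M u))" if "u \<in> L1 M" for u N
    using that by (induction N) (simp_all add: L1_emb_0 L1_emb_add L1_add TL eT)
  have "L1_norm M (\<lambda>x. (1 / real N) * (\<Sum>n<N. (T ^^ n) u x) - v x)
      = norm ((1 / real N) *\<^sub>R (\<Sum>n<N. (T' ^^ n) (L1_emb M u)) - L1_emb M v)"
    if u: "u \<in> L1 M" and v: "v \<in> L1 M" for u v N
  proof -
    note s = conjunct1[OF sum[OF u, of N]]
    have "L1_norm M (\<lambda>x. (1 / real N) * (\<Sum>n<N. (T ^^ n) u x) - v x)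
        = norm (L1_emb M (\<lambda>x. (1 / real N) * (\<Sum>n<N. (T ^^ n) u x) - v x))"
      by (rule norm_L1_emb[symmetric]) (intro L1_diff L1_scale s v)
    also have "L1_emb M (\<lambda>x. (1 / real N) * (\<Sum>n<N. (T ^^ n) u x) - v x)
        = (1 / real N) *\<^sub>R L1_emb M (\<lambda>x. \<Sum>n<N. (T ^^ n) u x) - L1_emb M v"
      unfolding L1_emb_diff[OF L1_scale[OF s] v] L1_emb_scale[OF s] ..
    finally show ?thesis
      using sum[OF u] by simp
  qed
  then show ?thesis
    unfolding mean_ergodic_def ball_L1_image
    by (simp add: L1_image_def tendsto_norm_zero_iff LIM_zero_iff)
qed

end

theorem theorem3p4:
  fixes M :: "'a measure"
    and A B :: "('a \<Rightarrow> real) \<Rightarrow> ('a \<Rightarrow> real)"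
    and DA DB :: "('a \<Rightarrow> real) set"
    and S P :: "real \<Rightarrow> ('a \<Rightarrow> real) \<Rightarrow> ('a \<Rightarrow> real)"
    and l :: real
  assumes sigma_finite: "sigma_finite_measure M"
    and lin_A: "linear_operator M DA A"
    and lin_B: "linear_operator M DB B"
    and G1: "substochastic_semigroup M S" "generates M DA A S"
    and G2: "DA \<subseteq> DB" "\<And>u. u \<in> DA \<inter> L1_plus M \<Longrightarrow> AE x in M. 0 \<le> B u x"
    and G3: "\<And>u. u \<in> DA \<inter> L1_plus M \<Longrightarrow> (LINT x|M. A u x + B u x) = 0"
    and P: "smallest_substochastic_semigroup M DA (\<lambda>u x. A u x + B u x) P"
    and l: "0 < l"
  shows "(stochastic_semigroup M P \<longleftrightarrow> mean_ergodic M (BR M DA A B l)) \<and>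
         (mean_ergodic M (BR M DA A B l) \<longleftrightarrow>
            emeasure M {x \<in> space M. 0 < f_lim M DA A B l x} = 0) \<and>
         (emeasure M {x \<in> space M. 0 < f_lim M DA A B l x} = 0 \<longleftrightarrow>
            (\<exists>u\<in>L1_plus M. (AE x in M. 0 < u x) \<and>
               (\<lambda>n. L1_norm M ((BR M DA A B l ^^ n) u)) \<longlonglongrightarrow> 0))"
proof -
  let ?e = "L1_emb M" and ?V = "L1_image M"
  define S' where "S' t w = ?e (S t (L1_rep M w))" for t w
  define P' where "P' t w = ?e (P t (L1_rep M w))" for t w
  define B' where "B' w = ?e (B (L1_rep M w))" for w
  interpret L1: al_space ?V "total_mass M"
    by (rule al_space_L1)
  have P_sub: "substochastic_semigroup M P"
    using P by (simp add: smallest_substochastic_semigroup_def)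
  have rS: "\<forall>t\<ge>0. represents M (S t) (S' t)" and rP: "\<forall>t\<ge>0. represents M (P t) (P' t)"
  proof -
    have "positive_contraction M (S t)" "positive_contraction M (P t)" if "0 \<le> t" for t
      using G1(1) P_sub that by (simp_all add: substochastic_semigroup_def)
    then show "\<forall>t\<ge>0. represents M (S t) (S' t)" "\<forall>t\<ge>0. represents M (P t) (P' t)"
      unfolding S'_def[abs_def] P'_def[abs_def]
      by (auto intro!: represents_lift simp: positive_contraction_def)
  qed
  have sgS: "L1.pc_semigroup S'" and sgP: "L1.pc_semigroup P'"
    using represents_semigroup_iff[OF rS] represents_semigroup_iff[OF rP] G1(1) P_sub by auto
  have DA: "u \<in> L1 M" "A u \<in> L1 M" "B u \<in> L1 M" if "u \<in> DA" for u
    using linear_operator_dom_L1[OF lin_A that] linear_operator_L1[OF lin_A that]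
      linear_operator_L1[OF lin_B subsetD[OF G2(1) that]] by auto
  have gen_iff: "L1.gen S' (?e u) (?e v) \<longleftrightarrow> u \<in> DA \<and> (AE x in M. v x = A u x)"
    if "u \<in> L1 M" "v \<in> L1 M" for u v
    using represents_generator_graph_iff[OF rS that] G1(2) that by (simp add: generates_def)
  have genE: "\<exists>u\<in>DA. x = ?e u \<and> y = ?e (A u)" if g: "L1.gen S' x y" for x y
  proof -
    obtain u v where uv: "u \<in> L1 M" "v \<in> L1 M" "x = ?e u" "y = ?e v"
      using L1.gen_V[OF g] by (auto simp: L1_image_def)
    then have "u \<in> DA" "AE x in M. v x = A u x"
      using gen_iff g by auto
    then show ?thesis
      using uv L1_emb_eq_iff[OF uv(2) DA(2)] by blast
  qed
  have B': "B' (?e u) = ?e (B u)" if "u \<in> DA" for u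
    unfolding B'_def using lift_L1_emb[OF lin_B] G2(1) that by blast
  \<comment> \<open>The relation \<open>gen S'\<close> holds exactly between the images of \<open>u\<close> and \<open>A u\<close> for \<open>u\<close> in the
    domain of \<open>A\<close>, so the hypotheses on \<open>A\<close> and \<open>B\<close> become those of the abstract perturbation.\<close>
  interpret kato_perturbation ?V "total_mass M" S' B'
  proof
    show "L1.pc_semigroup S'"
      by (rule sgS)
    fix x y assume "L1.gen S' x y"
    then obtain u where u: "u \<in> DA" "x = ?e u" "y = ?e (A u)"
      using genE by blast
    show "B' x \<in> ?V"
      using u DA B' by simp
    show "B' (c *\<^sub>R x) = c *\<^sub>R B' x" for c
    proof -
      note cu = linear_operator_dom_scale[OF lin_A u(1), of c]
      have "?e (B (\<lambda>x. c * u x)) = ?e (\<lambda>x. c * B u x)"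
        using linear_operator_scale[OF lin_B subsetD[OF G2(1) u(1)], of c]
          L1_emb_eq_iff[OF DA(3)[OF cu] L1_scale[OF DA(3)[OF u(1)]]] by simp
      then show ?thesis
        using B'[OF cu] B'[OF u(1)] u DA by (simp add: L1_emb_scale)
    qed
    show "B' x \<in> L1.cone" if "x \<in> L1.cone"
    proof -
      have "u \<in> DA \<inter> L1_plus M"
        using that u cone_L1_emb DA(1) by blast
      then have "B u \<in> L1_plus M"
        using G2(2) DA(3)[OF u(1)] by (simp add: L1_plus_def)
      then have "?e (B u) \<in> L1.cone"
        by (rule cone_L1_emb[OF DA(3)[OF u(1)], THEN iffD2])
      then show ?thesis
        unfolding u(2) B'[OF u(1)] .
    qed
    show "total_mass M y + total_mass M (B' x) = 0" if "x \<in> L1.cone"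
    proof -
      have "u \<in> DA \<inter> L1_plus M"
        using that u cone_L1_emb DA(1) by blast
      from G3[OF this] show ?thesis
        using B'[OF u(1)] u DA[OF u(1)] by (simp add: total_mass_L1_emb L1_integrable)
    qed
    fix x' y' assume "L1.gen S' x' y'"
    then obtain u' where u': "u' \<in> DA" "x' = ?e u'" "y' = ?e (A u')"
      using genE by blast
    note uu = linear_operator_dom_add[OF lin_A u(1) u'(1)]
    have "?e (B (\<lambda>x. u x + u' x)) = ?e (\<lambda>x. B u x + B u' x)"
      using linear_operator_add[OF lin_B subsetD[OF G2(1) u(1)] subsetD[OF G2(1) u'(1)]]
        L1_emb_eq_iff[OF DA(3)[OF uu] L1_add[OF DA(3)[OF u(1)] DA(3)[OF u'(1)]]] by simp
    then show "B' (x + x') = B' x + B' x'"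
      using B'[OF uu] B'[OF u(1)] B'[OF u'(1)] u u' DA by (simp add: L1_emb_add)
  qed
  have ext_iff: "generator_extends M Q DA (\<lambda>u x. A u x + B u x) \<longleftrightarrow> extends_perturbed Q'"
    if rQ: "\<forall>t\<ge>0. represents M (Q t) (Q' t)" for Q Q'
  proof -
    have iff: "generator_graph M Q u (\<lambda>x. A u x + B u x) \<longleftrightarrow> L1.gen Q' (?e u) (?e (A u) + B' (?e u))"
      if u: "u \<in> DA" for u
      using represents_generator_graph_iff[OF rQ DA(1)[OF u] L1_add[OF DA(2)[OF u] DA(3)[OF u]]]
        B'[OF u] DA[OF u] by (simp add: L1_emb_add)
    have genS: "L1.gen S' (?e u) (?e (A u))" if u: "u \<in> DA" for u
      using gen_iff[OF DA(1,2)[OF u]] u by simp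
    have "extends_perturbed Q' \<longleftrightarrow> (\<forall>u\<in>DA. L1.gen Q' (?e u) (?e (A u) + B' (?e u)))"
      unfolding extends_perturbed_def
    proof (intro iffI allI impI ballI)
      fix x y
      assume ext: "\<forall>u\<in>DA. L1.gen Q' (?e u) (?e (A u) + B' (?e u))" and "L1.gen S' x y"
      then obtain u where "u \<in> DA" "x = ?e u" "y = ?e (A u)"
        using genE by blast
      with ext show "L1.gen Q' x (y + B' x)"
        by simp
    qed (use genS in simp)
    then show ?thesis
      unfolding generator_extends_def using iff by simp
  qed
  have extP: "extends_perturbed P'"
    using P ext_iff[OF rP] by (simp add: smallest_substochastic_semigroup_def)
  have minimal: "Q' t x - P' t x \<in> L1.cone"
    if Q': "L1.pc_semigroup Q'" "extends_perturbed Q'" and t: "0 \<le> t" and x: "x \<in> L1.cone" for Q' t x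
  proof -
    define Q where "Q t u = L1_rep M (Q' t (?e u))" for t u
    have rQ: "\<forall>t\<ge>0. represents M (Q t) (Q' t)"
    proof (intro allI impI)
      fix t :: real assume "0 \<le> t"
      then show "represents M (Q t) (Q' t)"
        unfolding Q_def[abs_def]
        by (intro represents_unlift L1.pc_V[OF L1.sg_pc[OF Q'(1)]])
    qed
    have Q: "substochastic_semigroup M Q" "generator_extends M Q DA (\<lambda>u x. A u x + B u x)"
      using represents_semigroup_iff[OF rQ] ext_iff[OF rQ] Q' by auto
    obtain u where u: "u \<in> L1 M" "x = ?e u"
      using L1.cone_V[OF x] by (auto simp: L1_image_def)
    then have "u \<in> L1_plus M"
      using x cone_L1_emb by blast
    then have "AE x in M. P t u x \<le> Q t u x"
      using P Q t unfolding smallest_substochastic_semigroup_def by blast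
    moreover note Qu = representsD[OF rQ[rule_format, OF t] u(1)]
      and Pu = representsD[OF rP[rule_format, OF t] u(1)]
    ultimately have "(\<lambda>x. Q t u x - P t u x) \<in> L1_plus M"
      by (auto simp: L1_plus_def)
    then have "?e (\<lambda>x. Q t u x - P t u x) \<in> L1.cone"
      using cone_L1_emb L1_plus_L1 by blast
    then show ?thesis
      using L1_emb_diff[OF Qu(1) Pu(1)] Qu(2) Pu(2) u(2) by simp
  qed
  \<comment> \<open>The choice made by \<open>resolvent\<close> among almost everywhere equal functions disappears under the
    embedding.\<close>
  have rK: "represents M (BR M DA A B l) (K l)"
    unfolding represents_def
  proof
    fix u assume u: "u \<in> L1 M"
    let ?res = "\<lambda>r. r \<in> DA \<and> (AE x in M. l * r x - A r x = u x)"
    have eu: "?e u \<in> ?V"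
      using u by simp
    define r0 where "r0 = L1_rep M (R l (?e u))"
    have r0: "r0 \<in> L1 M" "?e r0 = R l (?e u)"
      using L1_rep[OF R_V[OF l eu]] by (auto simp: r0_def)
    have "L1.gen S' (?e r0) (?e (\<lambda>x. l * r0 x - u x))"
      using R_gen[OF l eu] r0 u by (simp add: L1_emb_diff L1_scale L1_emb_scale)
    then have "r0 \<in> DA" "AE x in M. l * r0 x - u x = A r0 x"
      using gen_iff[OF r0(1) L1_diff[OF L1_scale[OF r0(1)] u]] by auto
    then have "?res r0"
      by (auto elim: eventually_mono)
    then have r: "?res (resolvent M DA A l u)"
      unfolding resolvent_def by (rule someI[of ?res])
    let ?r = "resolvent M DA A l u"
    have rDA: "?r \<in> DA"
      using r by blast
    have "?e (\<lambda>x. l * ?r x - A ?r x) = ?e u"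
      using r L1_emb_eq_iff[OF L1_diff[OF L1_scale[OF DA(1)[OF rDA]] DA(2)[OF rDA]] u] by blast
    then have "l *\<^sub>R ?e ?r - ?e u = ?e (A ?r)"
      using DA[OF rDA] by (simp add: L1_emb_diff L1_scale L1_emb_scale algebra_simps)
    moreover have "L1.gen S' (?e ?r) (?e (A ?r))"
      using gen_iff[OF DA(1,2)[OF rDA]] rDA by simp
    ultimately have "R l (?e u) = ?e ?r"
      by (intro L1.res_eqI[OF sgS l]) simp
    then show "BR M DA A B l u \<in> L1 M \<and> ?e (BR M DA A B l u) = K l (?e u)"
      using B'[OF rDA] DA(3)[OF rDA] by (simp add: BR_def K_def)
  qed
  have BR: "positive_contraction M (BR M DA A B l)"
    using represents_positive_contraction_iff[OF rK] K_pc[OF l] by blast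
  have rKn: "u \<in> L1 M \<Longrightarrow> (BR M DA A B l ^^ n) u \<in> L1 M"
    "u \<in> L1 M \<Longrightarrow> ?e ((BR M DA A B l ^^ n) u) = (K l ^^ n) (?e u)" for u n
    using representsD[OF represents_power[OF rK]] by auto
  let ?vanish = "\<forall>v\<in>?V. (\<lambda>n. (K l ^^ n) v) \<longlonglongrightarrow> 0"
  have vanish: "?vanish \<longleftrightarrow> (\<forall>u\<in>L1_plus M. (\<lambda>n. L1_norm M ((BR M DA A B l ^^ n) u)) \<longlonglongrightarrow> 0)"
  proof -
    have *: "(\<lambda>n. L1_norm M ((BR M DA A B l ^^ n) u)) \<longlonglongrightarrow> 0 \<longleftrightarrow> (\<lambda>n. (K l ^^ n) (?e u)) \<longlonglongrightarrow> 0"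
      if "u \<in> L1_plus M" for u
    proof -
      have "L1_norm M ((BR M DA A B l ^^ n) u) = norm ((K l ^^ n) (?e u))" for n
        using rKn[OF L1_plus_L1[OF that], of n] norm_L1_emb by metis
      then show ?thesis
        by (simp add: tendsto_norm_zero_iff)
    qed
    have "?vanish \<longleftrightarrow> (\<forall>v\<in>L1.cone. (\<lambda>n. (K l ^^ n) v) \<longlonglongrightarrow> 0)"
    proof
      assume cone: "\<forall>v\<in>L1.cone. (\<lambda>n. (K l ^^ n) v) \<longlonglongrightarrow> 0"
      have "(\<lambda>n. total_mass M ((K l ^^ n) v)) \<longlonglongrightarrow> 0" if "v \<in> L1.cone" for v
        using L1.tendsto_mass[OF bspec[OF cone that]] by simp
      then show ?vanish
        using K_power_tendsto_0_on_V[OF l] by blast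
    qed (use L1.cone_V in blast)
    also have "\<dots> \<longleftrightarrow> (\<forall>u\<in>L1_plus M. (\<lambda>n. L1_norm M ((BR M DA A B l ^^ n) u)) \<longlonglongrightarrow> 0)"
      unfolding ball_cone using * by blast
    finally show ?thesis .
  qed
  have 1: "stochastic_semigroup M P \<longleftrightarrow> ?vanish"
    unfolding represents_stochastic_semigroup_iff[OF rP P_sub]
    by (rule conservative_iff_K_power_tendsto_0[OF sgP extP _ l]) (rule minimal)
  have 2: "mean_ergodic M (BR M DA A B l) \<longleftrightarrow> ?vanish"
    unfolding represents_mean_ergodic_iff[OF rK] by (rule mean_ergodic_iff_K_power_tendsto_0[OF l])
  have 3: "emeasure M {x \<in> space M. 0 < f_lim M DA A B l x} = 0 \<longleftrightarrow> ?vanish"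
    unfolding vanish f_lim_def
    by (rule sigma_finite_measure.L1_adjoint_limit_null_iff(1)[OF sigma_finite BR])
  have 4: "emeasure M {x \<in> space M. 0 < f_lim M DA A B l x} = 0 \<longleftrightarrow>
      (\<exists>u\<in>L1_plus M. (AE x in M. 0 < u x) \<and>
        (\<lambda>n. L1_norm M ((BR M DA A B l ^^ n) u)) \<longlonglongrightarrow> 0)"
    unfolding f_lim_def
    by (rule sigma_finite_measure.L1_adjoint_limit_null_iff(2)[OF sigma_finite BR])
  show ?thesis
    unfolding 4[symmetric] 1 2 3 by simp
qed

end
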